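(* There is a family of multi-stage integer programming instances, with numbers of stages $\tau \ge 1$ (varying over the family), with stage sizes bounded by an absolute constant, and with constraint-matrix entries bounded in absolute value by an absolute constant, such that, assuming the Exponential Time Hypothesis (ETH), no algorithm solves every instance $I$ of the family in time $$2^{2^{2^{o(\tau)}}}\,|I|^{O(1)},$$ where $\tau$ is the number of stages of $I$ and $|I|$ is the encoding length of $I$.
   Context: Integer program (IP): given $A\in\mathbb{Z}^{m\times n}$, $b\in\mathbb{Z}^m$, $c\in\mathbb{Z}^n$ and bounds $l,u$, solve $\min\{c^\intercal x : Ax=b,\ l\le x\le u,\ x\in\mathbb{Z}^n\}$. The encoding length $|I|$ is the number of bits of the binary encoding of all data. Tree-fold matrices (recursive definition): any matrix $A\in\mathbb{Z}^{m\times n}$ is a tree-fold matrix with one level and level size $m$. A matrix $A$ is a tree-fold matrix with $\tau\ge 2$ levels and level sizes $\sigma=(\sigma_1,\dots,\sigma_\tau)\in\mathbb{Z}_{\ge1}^\tau$ if deleting the first $\sigma_1$ rows of $A$ decomposes the matrix into a block-diagonal matrix, where each (not necessarily square) block is a tree-fold matrix with $\tau-1$ levels and level sizes $(\sigma_2,\dots,\sigma_\tau)$. Multi-stage matrices: $A$ is a multi-stage matrix with $\tau$ stages and stage sizes $\sigma$ if $A^\intercal$ is a tree-fold matrix with $\tau$ levels and level sizes $\sigma$. A multi-stage IP is an IP whose constraint matrix $A$ is a multi-stage matrix. ETH: there is $\delta>0$ such that 3-SAT with $N$ variables cannot be solved in time $O(2^{\delta N})$. Asymptotic convention: "time $2^{2^{2^{o(\tau)}}}|I|^{O(1)}$"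 means time at most $2^{2^{2^{f(\tau)}}}\cdot|I|^C$ for some constant $C$ and some function $f$ with $f(\tau)/\tau\to0$ as $\tau\to\infty$. *)

theory Defs
  imports Complex_Main "Jordan_Normal_Form.Matrix"
begin

section \<open>Deterministic multi-tape Turing machines\<close>

text \<open>
  States and tape symbols are initial segments of the natural numbers. State 0 is initial and
  state 1 is halting; symbol 0 is the blank, and the symbols 1 and 2 stand for the bits
  \<^term>\<open>False\<close> and \<^term>\<open>True\<close>. Tapes are infinite in both directions.
\<close>

datatype dir = Go_Left | Stay | Go_Right

record tm =
  tm_tapes :: nat
  tm_states :: nat
  tm_symbols :: nat
  tm_delta :: "nat \<Rightarrow> nat list \<Rightarrow> nat \<times> (nat \<times> dir) list"

definition wf_tm :: "tm \<Rightarrow> bool" where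
  "wf_tm M \<longleftrightarrow>
     1 \<le> tm_tapes M \<and> 2 \<le> tm_states M \<and> 3 \<le> tm_symbols M \<and>
     (\<forall>q < tm_states M. \<forall>ss. length ss = tm_tapes M \<and> set ss \<subseteq> {..<tm_symbols M} \<longrightarrow>
        (case tm_delta M q ss of (q', as) \<Rightarrow>
           q' < tm_states M \<and> length as = tm_tapes M \<and> fst ` set as \<subseteq> {..<tm_symbols M}))"

type_synonym tape = "(int \<Rightarrow> nat) \<times> int"  \<comment> \<open>contents and head position\<close>
type_synonym config = "nat \<times> tape list"

fun move :: "dir \<Rightarrow> int \<Rightarrow> int" where
  "move Go_Left h = h - 1"
| "move Stay h = h"
| "move Go_Right h = h + 1"

definition read_tape :: "tape \<Rightarrow> nat" where
  "read_tape T = fst T (snd T)"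

definition act_tape :: "nat \<times> dir \<Rightarrow> tape \<Rightarrow> tape" where
  "act_tape a T = ((fst T)(snd T := fst a), move (snd a) (snd T))"

definition tm_step :: "tm \<Rightarrow> config \<Rightarrow> config" where
  "tm_step M C = (case C of (q, Ts) \<Rightarrow>
     if q = 1 then C
     else (case tm_delta M q (map read_tape Ts) of (q', as) \<Rightarrow> (q', map2 act_tape as Ts)))"

definition bit_symbol :: "bool \<Rightarrow> nat" where
  "bit_symbol b = (if b then 2 else 1)"

definition input_tape :: "bool list \<Rightarrow> tape" where
  "input_tape w =
     (\<lambda>i. if 0 \<le> i \<and> i < int (length w) then bit_symbol (w ! nat i) else 0, 0)"

definition tm_init :: "tm \<Rightarrow> bool list \<Rightarrow> config" where
  "tm_init M w = (0, input_tape w # replicate (tm_tapes M - 1) (\<lambda>_. 0, 0))"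

text \<open>
  The output is read off the first tape, from cell 0 up to the first blank. The halting
  configuration is a fixed point of \<^const>\<open>tm_step\<close>, so the number \<open>t\<close> below is
  an upper bound on the number of steps until halting.
\<close>

definition tape_holds :: "tape \<Rightarrow> bool list \<Rightarrow> bool" where
  "tape_holds T v \<longleftrightarrow>
     (\<forall>i < length v. fst T (int i) = bit_symbol (v ! i)) \<and> fst T (int (length v)) = 0"

definition tm_outputs :: "tm \<Rightarrow> bool list \<Rightarrow> bool list \<Rightarrow> real \<Rightarrow> bool" where
  "tm_outputs M w v T \<longleftrightarrow>
     (\<exists>t::nat. real t \<le> T \<and>
        (case (tm_step M ^^ t) (tm_init M w) of (q, Ts) \<Rightarrow> q = 1 \<and> tape_holds (hd Ts) v))"


section \<open>Binary encodings\<close>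

fun binary :: "nat \<Rightarrow> bool list" where
  "binary n = (if n = 0 then [] else odd n # binary (n div 2))"

declare binary.simps [simp del]

text \<open>Each binary digit is preceded by \<^term>\<open>True\<close>, and a final \<^term>\<open>False\<close>
  makes the code prefix-free.\<close>

definition enc_nat :: "nat \<Rightarrow> bool list" where
  "enc_nat n = concat (map (\<lambda>b. [True, b]) (binary n)) @ [False]"

definition enc_int :: "int \<Rightarrow> bool list" where
  "enc_int z = (z < 0) # enc_nat (nat \<bar>z\<bar>)"

definition enc_vec :: "int vec \<Rightarrow> bool list" where
  "enc_vec v = concat (map enc_int (list_of_vec v))"

definition enc_mat :: "int mat \<Rightarrow> bool list" where
  "enc_mat A = concat (map enc_vec (rows A))"


section \<open>3-SAT and the Exponential Time Hypothesis\<close>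

text \<open>
  A literal is a sign together with a variable. The literals of a clause need not be distinct, so
  this covers clauses with one to three literals. An instance \<open>(N, cs)\<close> has the variables
  \<open>0, \<dots>, N - 1\<close>. The clauses in \<open>cs\<close> are distinct: with unbounded repetition of
  clauses no bound in terms of \<open>N\<close> alone would leave enough time to read the input.
\<close>

type_synonym literal = "bool \<times> nat"
type_synonym clause3 = "literal \<times> literal \<times> literal"
type_synonym cnf3 = "nat \<times> clause3 list"

fun clause_lits :: "clause3 \<Rightarrow> literal list" where
  "clause_lits (l1, l2, l3) = [l1, l2, l3]"

definition wf_cnf3 :: "cnf3 \<Rightarrow> bool" where
  "wf_cnf3 \<phi> \<longleftrightarrow>
     distinct (snd \<phi>) \<and> (\<forall>cl \<in> set (snd \<phi>). \<forall>lit \<in> set (clause_lits cl). snd lit < fst \<phi>)"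

definition satisfiable :: "cnf3 \<Rightarrow> bool" where
  "satisfiable \<phi> \<longleftrightarrow>
     (\<exists>a :: nat \<Rightarrow> bool. \<forall>cl \<in> set (snd \<phi>). \<exists>lit \<in> set (clause_lits cl). a (snd lit) = fst lit)"

definition enc_literal :: "literal \<Rightarrow> bool list" where
  "enc_literal lit = fst lit # enc_nat (snd lit)"

definition enc_cnf3 :: "cnf3 \<Rightarrow> bool list" where
  "enc_cnf3 \<phi> = enc_nat (fst \<phi>) @ enc_nat (length (snd \<phi>)) @
     concat (map (\<lambda>cl. concat (map enc_literal (clause_lits cl))) (snd \<phi>))"

definition solves_3SAT_in :: "tm \<Rightarrow> (nat \<Rightarrow> real) \<Rightarrow> bool" where
  "solves_3SAT_in M T \<longleftrightarrow>
     (\<forall>\<phi>. wf_cnf3 \<phi> \<longrightarrow> tm_outputs M (enc_cnf3 \<phi>) [satisfiable \<phi>] (T (fst \<phi>)))"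

definition ETH :: bool where
  "ETH \<longleftrightarrow>
     (\<exists>\<delta>::real. \<delta> > 0 \<and>
        \<not> (\<exists>M K. wf_tm M \<and> solves_3SAT_in M (\<lambda>N. K * 2 powr (\<delta> * real N))))"


section \<open>Integer programs\<close>

record ip =
  ip_A :: "int mat"
  ip_b :: "int vec"
  ip_c :: "int vec"
  ip_l :: "int vec"
  ip_u :: "int vec"

definition wf_ip :: "ip \<Rightarrow> bool" where
  "wf_ip I \<longleftrightarrow>
     ip_b I \<in> carrier_vec (dim_row (ip_A I)) \<and>
     ip_c I \<in> carrier_vec (dim_col (ip_A I)) \<and>
     ip_l I \<in> carrier_vec (dim_col (ip_A I)) \<and>
     ip_u I \<in> carrier_vec (dim_col (ip_A I))"

definition ip_feasible :: "ip \<Rightarrow> int vec set" where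
  "ip_feasible I =
     {x \<in> carrier_vec (dim_col (ip_A I)). ip_A I *\<^sub>v x = ip_b I \<and> ip_l I \<le> x \<and> x \<le> ip_u I}"

definition ip_optimal :: "ip \<Rightarrow> int vec \<Rightarrow> bool" where
  "ip_optimal I x \<longleftrightarrow> x \<in> ip_feasible I \<and> (\<forall>y \<in> ip_feasible I. ip_c I \<bullet> x \<le> ip_c I \<bullet> y)"

definition enc_ip :: "ip \<Rightarrow> bool list" where
  "enc_ip I = enc_nat (dim_row (ip_A I)) @ enc_nat (dim_col (ip_A I)) @ enc_mat (ip_A I) @
     enc_vec (ip_b I) @ enc_vec (ip_c I) @ enc_vec (ip_l I) @ enc_vec (ip_u I)"

definition ip_size :: "ip \<Rightarrow> nat" where
  "ip_size I = length (enc_ip I)"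

text \<open>
  A correct answer is \<open>[False]\<close> for an infeasible program, and otherwise \<open>True\<close> followed by
  the encoding of some optimal solution (which exists, as the bounds are finite).
\<close>

definition ip_answer :: "ip \<Rightarrow> bool list \<Rightarrow> bool" where
  "ip_answer I v \<longleftrightarrow>
     (if ip_feasible I = {} then v = [False] else \<exists>x. ip_optimal I x \<and> v = True # enc_vec x)"

definition solves_ip_in :: "tm \<Rightarrow> ip \<Rightarrow> real \<Rightarrow> bool" where
  "solves_ip_in M I T \<longleftrightarrow> (\<exists>v. ip_answer I v \<and> tm_outputs M (enc_ip I) v T)"


section \<open>Tree-fold and multi-stage matrices\<close>

definition delete_rows :: "nat \<Rightarrow> 'a mat \<Rightarrow> 'a mat" where
  "delete_rows s A = mat (dim_row A - s) (dim_col A) (\<lambda>(i, j). A $$ (i + s, j))"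

text \<open>
  \<^term>\<open>\<sigma> :: nat list\<close> lists the level sizes, so the number of levels is \<open>length \<sigma>\<close>.
  Matrices are taken to have at least one row and one column; in particular blocks are nonempty.
\<close>

fun tree_fold :: "nat list \<Rightarrow> int mat \<Rightarrow> bool" where
  "tree_fold [] A \<longleftrightarrow> False"
| "tree_fold [s] A \<longleftrightarrow> s \<ge> 1 \<and> dim_row A = s \<and> dim_col A \<ge> 1"
| "tree_fold (s # s' # \<sigma>) A \<longleftrightarrow>
     s \<ge> 1 \<and> s \<le> dim_row A \<and>
     (\<exists>Bs. Bs \<noteq> [] \<and> delete_rows s A = diag_block_mat Bs \<and> (\<forall>B \<in> set Bs. tree_fold (s' # \<sigma>) B))"

definition multi_stage :: "nat list \<Rightarrow> int mat \<Rightarrow> bool" where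
  "multi_stage \<sigma> A \<longleftrightarrow> tree_fold \<sigma> (transpose_mat A)"

end

theory Submission
  imports Defs "HOL-Number_Theory.Number_Theory" "HOL-Real_Asymp.Real_Asymp"
begin

text \<open>
  Attach a prime to every variable of a 3-CNF formula and let an integer \<open>x\<close> encode the assignment
  that makes a variable true iff its prime does not divide \<open>x\<close>. By the Chinese remainder theorem all
  assignments arise, and a clause says that \<open>x\<close> avoids certain residues modulo the product \<open>m\<close> of its
  three primes. A Chebyshev-type bound makes \<open>m\<close> polynomial in the input length, so the condition
  \<open>x = q * m + z\<close> for one forbidden residue is a chain of \<open>O(log N)\<close> doublings with coefficients of
  absolute value at most two. Eliminating the middle node of the chain first leaves two independent
  halves; hence, below the common variable \<open>x\<close>, \<open>O(log log N)\<close> stages of size two suffice. Thus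
  \<open>2^\<tau> = O(log N)\<close>, and \<open>2^2^2^o(\<tau>)\<close> is at most \<open>2^N^o(1)\<close>.

  That the reduction runs on a Turing machine in polynomial time is obtained from a small language
  of loop programs on unary counters, in which every program takes polynomial time by construction.
  The compiled program writes the integer program on the input tape of the assumed solver, which is
  then simulated.
\<close>

section \<open>Turing machine fragments\<close>

text \<open>Excluding a residue is an interval condition: \<open>x\<close> is not congruent to
  \<open>r\<close> modulo \<open>m\<close> iff \<open>x = q * m + z\<close> for integers with
  \<open>r < z < r + m\<close>. Bounds express this, so the blocks of different residues share only
  \<open>x\<close>, a stage of size one. The modulus must not become a coefficient; its binary
  digits are fed one by one into a chain \<open>y' = 2 * y\<close>,
  \<open>z' = z + digit * y\<close> that ends in \<open>x\<close>. The constraint graph of the chain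
  is a path of length \<open>O(log N)\<close>, and the stages below \<open>x\<close> are the levels
  of an elimination tree of this path: hence the two logarithms, which with the exponential of ETH
  make three. Every pair of a clause index and a candidate residue gets a block, and a block that
  forbids nothing is left loose. So the shape of the program depends on the input length alone, and
  nested loops can print it. The objective is zero, so the first bit of an answer decides
  satisfiability. Sparsification is avoided: distinct clauses keep the input polynomial in
  \<open>N\<close>, and the number of stages sees only the logarithm of a modulus.\<close>

type_synonym delta = "nat \<Rightarrow> nat list \<Rightarrow> nat \<times> (nat \<times> dir) list"
type_synonym frag = "nat \<times> delta"

inductive run :: "delta \<Rightarrow> nat \<Rightarrow> tape list \<Rightarrow> nat \<Rightarrow> tape list \<Rightarrow> bool" for \<delta> where
  run_halt: "run \<delta> 1 Ts 0 Ts"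
| run_step: "q \<noteq> 1 \<Longrightarrow> \<delta> q (map read_tape Ts) = (q', as) \<Longrightarrow>
    run \<delta> q' (map2 act_tape as Ts) n Ts' \<Longrightarrow> run \<delta> q Ts (Suc n) Ts'"

lemmas run_halt' = run_halt[unfolded One_nat_def]

lemma tm_step_eq:
  "q \<noteq> 1 \<Longrightarrow> tm_delta M q (map read_tape Ts) = (q', as) \<Longrightarrow> tm_step M (q, Ts) = (q', map2 act_tape as Ts)"
  by (simp add: tm_step_def)

lemma run_tm_step: "run (tm_delta M) q Ts n Ts' \<Longrightarrow> (tm_step M ^^ n) (q, Ts) = (1, Ts')"
  by (induction rule: run.induct) (simp_all add: funpow_Suc_right tm_step_eq del: funpow.simps(2))

lemma tm_step_fixed: "(tm_step M ^^ n) (1, Ts) = (1, Ts)"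
  by (induction n) (simp_all add: tm_step_def)

lemma tm_step_run:
  "(tm_step M ^^ n) (q, Ts) = (1, Ts') \<Longrightarrow> \<exists>n'\<le>n. run (tm_delta M) q Ts n' Ts'"
proof (induction n arbitrary: q Ts)
  case 0
  then show ?case by (auto intro: run_halt')
next
  case (Suc n)
  show ?case
  proof (cases "q = 1")
    case True
    then have "Ts' = Ts" using Suc.prems tm_step_fixed[where n = "Suc n" and M = M and Ts = Ts] by simp
    then show ?thesis using True by (auto intro: run_halt')
  next
    case False
    obtain q' as where d: "tm_delta M q (map read_tape Ts) = (q', as)" by (cases "tm_delta M q (map read_tape Ts)")
    have "(tm_step M ^^ n) (q', map2 act_tape as Ts) = (1, Ts')"
      using Suc.prems tm_step_eq[OF False d] by (simp add: funpow_Suc_right del: funpow.simps(2))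
    from Suc.IH[OF this] obtain n' where "n' \<le> n" "run (tm_delta M) q' (map2 act_tape as Ts) n' Ts'" by blast
    then show ?thesis using run_step[of q "tm_delta M" Ts q' as n' Ts'] False d by auto
  qed
qed

text \<open>An upper bound instead of the exact step count lets both branches of a conditional, and
  all rounds of a loop, be charged the same cost.\<close>

definition exec :: "frag \<Rightarrow> tape list \<Rightarrow> nat \<Rightarrow> tape list \<Rightarrow> bool" where
  "exec F Ts n Ts' \<longleftrightarrow> (\<exists>n'\<le>n. run (snd F) 0 Ts n' Ts')"

lemma exec_mono: "exec F Ts n Ts' \<Longrightarrow> n \<le> m \<Longrightarrow> exec F Ts m Ts'"
  unfolding exec_def by (meson le_trans)

text \<open>Unlike in \<open>wf_tm\<close>, the state \<open>q\<close> ranges over all numbers: the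
  combinators below halve and shift states, so a part may be asked for states beyond its own
  range.\<close>

definition wfF :: "nat \<Rightarrow> nat \<Rightarrow> frag \<Rightarrow> bool" where
  "wfF k G F \<longleftrightarrow> 2 \<le> fst F \<and> (\<forall>q ss. length ss = k \<and> set ss \<subseteq> {..<G} \<longrightarrow>
     (case snd F q ss of (q', as) \<Rightarrow> q' < fst F \<and> length as = k \<and> fst ` set as \<subseteq> {..<G}))"

definition stay :: "nat list \<Rightarrow> (nat \<times> dir) list" where
  "stay ss = map (\<lambda>s. (s, Stay)) ss"

lemma act_tape_read [simp]: "act_tape (read_tape T, Stay) T = T"
  by (cases T) (simp add: act_tape_def read_tape_def)

lemma act_tape_same: "act_tape (read_tape T, d) T = (fst T, move d (snd T))"
  by (simp add: act_tape_def read_tape_def)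

lemma length_stay [simp]: "length (stay ss) = length ss"
  by (simp add: stay_def)

lemma map2_stay [simp]: "map2 act_tape (stay (map read_tape Ts)) Ts = Ts"
  by (rule nth_equalityI) (simp_all add: stay_def)

lemma fst_set_stay [simp]: "fst ` set (stay ss) = set ss"
  by (simp add: stay_def image_image)

definition actF :: "(nat list \<Rightarrow> (nat \<times> dir) list) \<Rightarrow> frag" where
  "actF f = (2, \<lambda>q ss. (1, f ss))"

text \<open>States of \<open>F\<close> become even and states of \<open>G\<close> odd, with two
  exceptions: 2 is at once the halting state of \<open>F\<close> and the initial state of
  \<open>G\<close>, so that control passes without an extra step, and 1 remains the halting
  state.\<close>

definition seqF :: "frag \<Rightarrow> frag \<Rightarrow> frag" where
  "seqF F G = (2 * max (fst F) (fst G) + 3, \<lambda>q ss.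
     if even q \<and> q \<noteq> 2 then map_prod (\<lambda>q'. 2 * q') id (snd F (q div 2) ss)
     else map_prod (\<lambda>q'. if q' = 0 then 2 else if q' = 1 then 1 else 2 * q' + 1) id
       (snd G (if q = 2 then 0 else q div 2) ss))"

text \<open>State 0 tests, 2 and 3 are the initial states of the branches, and both branches halt in
  1; their other states are told apart by parity.\<close>

definition ifF :: "(nat list \<Rightarrow> bool) \<Rightarrow> frag \<Rightarrow> frag \<Rightarrow> frag" where
  "ifF c F G = (2 * max (fst F) (fst G) + 4, \<lambda>q ss.
     if q = 0 then (if c ss then 2 else 3, stay ss)
     else if even q then map_prod (\<lambda>q'. if q' = 0 then 2 else if q' = 1 then 1 else 2 * q') id
       (snd F (if q = 2 then 0 else q div 2) ss)
     else map_prod (\<lambda>q'. if q' = 0 then 3 else if q' = 1 then 1 else 2 * q' + 1) id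
       (snd G (if q = 3 then 0 else q div 2) ss))"

text \<open>The halting state of the body is identified with the testing state 0, which closes the
  loop.\<close>

definition whF :: "(nat list \<Rightarrow> bool) \<Rightarrow> frag \<Rightarrow> frag" where
  "whF c F = (fst F + 2, \<lambda>q ss.
     if q = 0 then (if c ss then 2 else 1, stay ss)
     else map_prod (\<lambda>q'. if q' = 0 then 2 else if q' = 1 then 0 else q' + 1) id
       (snd F (if q = 2 then 0 else q - 1) ss))"

lemma wfF_actF:
  assumes "2 \<le> G"
    and "\<And>ss. length ss = k \<Longrightarrow> set ss \<subseteq> {..<G} \<Longrightarrow> length (f ss) = k \<and> fst ` set (f ss) \<subseteq> {..<G}"
  shows "wfF k G (actF f)"
  using assms by (auto simp: wfF_def actF_def)

lemma wfF_D:
  assumes "wfF k G F" "length ss = k" "set ss \<subseteq> {..<G}" "snd F q ss = (q', as)"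
  shows "q' < fst F" "length as = k" "fst ` set as \<subseteq> {..<G}"
  using assms unfolding wfF_def by (auto split: prod.splits)

lemma wfF_seqF:
  assumes "wfF k G F" "wfF k G F'" shows "wfF k G (seqF F F')"
  unfolding wfF_def
proof (intro conjI allI impI)
  show "2 \<le> fst (seqF F F')" by (simp add: seqF_def)
  fix q ss assume ss: "length ss = k \<and> set ss \<subseteq> {..<G}"
  obtain q1 a1 where 1: "snd F (q div 2) ss = (q1, a1)" by fastforce
  obtain q2 a2 where 2: "snd F' (if q = 2 then 0 else q div 2) ss = (q2, a2)" by fastforce
  show "case snd (seqF F F') q ss of (q', as) \<Rightarrow>
     q' < fst (seqF F F') \<and> length as = k \<and> fst ` set as \<subseteq> {..<G}"
    using wfF_D[OF assms(1) _ _ 1] wfF_D[OF assms(2) _ _ 2] ss 1 2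
    by (simp add: seqF_def max_def)
qed

lemma wfF_ifF:
  assumes "wfF k G F" "wfF k G F'" shows "wfF k G (ifF c F F')"
  unfolding wfF_def
proof (intro conjI allI impI)
  show "2 \<le> fst (ifF c F F')" by (simp add: ifF_def)
  fix q ss assume ss: "length ss = k \<and> set ss \<subseteq> {..<G}"
  obtain q1 a1 where 1: "snd F (if q = 2 then 0 else q div 2) ss = (q1, a1)" by fastforce
  obtain q2 a2 where 2: "snd F' (if q = 3 then 0 else q div 2) ss = (q2, a2)" by fastforce
  show "case snd (ifF c F F') q ss of (q', as) \<Rightarrow>
     q' < fst (ifF c F F') \<and> length as = k \<and> fst ` set as \<subseteq> {..<G}"
    using wfF_D[OF assms(1) _ _ 1] wfF_D[OF assms(2) _ _ 2] ss 1 2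
    by (simp add: ifF_def max_def)
qed

lemma wfF_whF:
  assumes "wfF k G F" shows "wfF k G (whF c F)"
  unfolding wfF_def
proof (intro conjI allI impI)
  show "2 \<le> fst (whF c F)" by (simp add: whF_def)
  fix q ss assume ss: "length ss = k \<and> set ss \<subseteq> {..<G}"
  obtain q1 a1 where 1: "snd F (if q = 2 then 0 else q - 1) ss = (q1, a1)" by fastforce
  show "case snd (whF c F) q ss of (q', as) \<Rightarrow>
     q' < fst (whF c F) \<and> length as = k \<and> fst ` set as \<subseteq> {..<G}"
    using wfF_D[OF assms(1) _ _ 1] ss 1
    by (simp add: whF_def)
qed

lemma run_seqF_right:
  assumes "run (snd G) q Ts n Ts'"
  shows "run (snd (seqF F G)) (if q = 0 then 2 else if q = 1 then 1 else 2 * q + 1) Ts n Ts'"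
  using assms
proof (induction rule: run.induct)
  case (run_halt Ts)
  show ?case by (simp add: run_halt')
next
  case (run_step q Ts q' as n Ts')
  show ?case
    by (rule run.run_step[OF _ _ run_step.IH]) (use run_step.hyps in \<open>auto simp: seqF_def\<close>)
qed

lemma run_seqF_left:
  assumes "run (snd F) q Ts n Ts'" "run (snd (seqF F G)) 2 Ts' m Ts''"
  shows "run (snd (seqF F G)) (2 * q) Ts (n + m) Ts''"
  using assms
proof (induction rule: run.induct)
  case (run_halt Ts)
  then show ?case by simp
next
  case (run_step q Ts q' as n Ts')
  show ?case unfolding add_Suc
    by (rule run.run_step[OF _ _ run_step.IH[OF run_step.prems]])
      (use run_step.hyps in \<open>auto simp: seqF_def, presburger?\<close>)
qed

lemma exec_seqF:
  assumes "exec F Ts n Ts'" "exec G Ts' m Ts''"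
  shows "exec (seqF F G) Ts (n + m) Ts''"
proof -
  obtain n' m' where "n' \<le> n" "m' \<le> m" and r: "run (snd F) 0 Ts n' Ts'" "run (snd G) 0 Ts' m' Ts''"
    using assms unfolding exec_def by blast
  then show ?thesis
    using run_seqF_left[OF r(1), of G m' Ts''] run_seqF_right[OF r(2), of F] unfolding exec_def
    by (intro exI[of _ "n' + m'"]) simp
qed

lemma run_ifF_left:
  assumes "run (snd F) q Ts n Ts'"
  shows "run (snd (ifF c F G)) (if q = 0 then 2 else if q = 1 then 1 else 2 * q) Ts n Ts'"
  using assms
proof (induction rule: run.induct)
  case (run_halt Ts)
  show ?case by (simp add: run_halt')
next
  case (run_step q Ts q' as n Ts')
  show ?case
    by (rule run.run_step[OF _ _ run_step.IH]) (use run_step.hyps in \<open>auto simp: ifF_def\<close>)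
qed

lemma run_ifF_right:
  assumes "run (snd G) q Ts n Ts'"
  shows "run (snd (ifF c F G)) (if q = 0 then 3 else if q = 1 then 1 else 2 * q + 1) Ts n Ts'"
  using assms
proof (induction rule: run.induct)
  case (run_halt Ts)
  show ?case by (simp add: run_halt')
next
  case (run_step q Ts q' as n Ts')
  show ?case
    by (rule run.run_step[OF _ _ run_step.IH]) (use run_step.hyps in \<open>auto simp: ifF_def\<close>)
qed

lemma exec_ifF:
  assumes "c (map read_tape Ts) \<Longrightarrow> exec F Ts n Ts'" "\<not> c (map read_tape Ts) \<Longrightarrow> exec G Ts n Ts'"
  shows "exec (ifF c F G) Ts (Suc n) Ts'"
proof (cases "c (map read_tape Ts)")
  case True
  then obtain n' where n': "n' \<le> n" "run (snd F) 0 Ts n' Ts'" using assms(1) by (auto simp: exec_def)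
  have "run (snd (ifF c F G)) 0 Ts (Suc n') Ts'"
    by (rule run_step[where q' = 2 and as = "stay (map read_tape Ts)"])
      (use True run_ifF_left[OF n'(2), of c G] in \<open>auto simp: ifF_def\<close>)
  then show ?thesis using n' unfolding exec_def by (intro exI[of _ "Suc n'"]) simp
next
  case False
  then obtain n' where n': "n' \<le> n" "run (snd G) 0 Ts n' Ts'" using assms(2) by (auto simp: exec_def)
  have "run (snd (ifF c F G)) 0 Ts (Suc n') Ts'"
    by (rule run_step[where q' = 3 and as = "stay (map read_tape Ts)"])
      (use False run_ifF_right[OF n'(2), of c F] in \<open>auto simp: ifF_def\<close>)
  then show ?thesis using n' unfolding exec_def by (intro exI[of _ "Suc n'"]) simp
qed

lemma run_whF:
  assumes "run (snd F) q Ts n Ts'" "run (snd (whF c F)) 0 Ts' m Ts''"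
  shows "run (snd (whF c F)) (if q = 0 then 2 else if q = 1 then 0 else q + 1) Ts (n + m) Ts''"
  using assms
proof (induction rule: run.induct)
  case (run_halt Ts)
  then show ?case by simp
next
  case (run_step q Ts q' as n Ts')
  show ?case unfolding add_Suc
    by (rule run.run_step[OF _ _ run_step.IH[OF run_step.prems]])
      (use run_step.hyps in \<open>auto simp: whF_def\<close>)
qed

lemma exec_whF_done:
  assumes "\<not> c (map read_tape Ts)"
  shows "exec (whF c F) Ts 1 Ts"
proof -
  have "run (snd (whF c F)) 0 Ts (Suc 0) Ts"
    by (rule run_step[where q' = 1 and as = "stay (map read_tape Ts)"])
      (use assms in \<open>auto simp: whF_def intro: run_halt'\<close>)
  then show ?thesis unfolding exec_def by (intro exI[of _ 1]) simp
qed

lemma exec_whF_step: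
  assumes "c (map read_tape Ts)" "exec F Ts n Ts'" "exec (whF c F) Ts' m Ts''"
  shows "exec (whF c F) Ts (Suc (n + m)) Ts''"
proof -
  obtain n' m' where l: "n' \<le> n" "m' \<le> m" and r: "run (snd F) 0 Ts n' Ts'" "run (snd (whF c F)) 0 Ts' m' Ts''"
    using assms unfolding exec_def by blast
  have "run (snd (whF c F)) 0 Ts (Suc (n' + m')) Ts''"
    by (rule run_step[where q' = 2 and as = "stay (map read_tape Ts)"])
      (use assms(1) run_whF[OF r] in \<open>auto simp: whF_def\<close>)
  then show ?thesis unfolding exec_def using l by (intro exI[of _ "Suc (n' + m')"]) simp
qed

lemma exec_actF: "exec (actF f) Ts 1 (map2 act_tape (f (map read_tape Ts)) Ts)"
proof -
  have "run (snd (actF f)) 0 Ts (Suc 0) (map2 act_tape (f (map read_tape Ts)) Ts)"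
    by (rule run_step[where q' = 1 and as = "f (map read_tape Ts)"])
      (auto simp: actF_def intro: run_halt')
  then show ?thesis unfolding exec_def by (intro exI[of _ 1]) simp
qed

definition skipF :: frag where "skipF = actF stay"

lemma exec_skipF: "exec skipF Ts 1 Ts"
  using exec_actF[of stay Ts] by (simp add: skipF_def)

definition actAt :: "nat \<Rightarrow> (nat list \<Rightarrow> nat \<times> dir) \<Rightarrow> frag" where
  "actAt i h = actF (\<lambda>ss. (stay ss)[i := h ss])"

lemma exec_actAt:
  assumes "i < length Ts" "Ts' = Ts[i := act_tape (h (map read_tape Ts)) (Ts ! i)]"
  shows "exec (actAt i h) Ts 1 Ts'"
proof -
  have "map2 act_tape ((stay (map read_tape Ts))[i := h (map read_tape Ts)]) Ts = Ts'"
    unfolding assms(2) using assms(1)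
    by (intro nth_equalityI) (auto simp: nth_list_update stay_def)
  then show ?thesis unfolding actAt_def using exec_actF[of "\<lambda>ss. (stay ss)[i := h ss]" Ts] by simp
qed

lemma wfF_skipF: "2 \<le> G \<Longrightarrow> wfF k G skipF"
  unfolding skipF_def by (rule wfF_actF) auto

lemma wfF_actAt:
  assumes "2 \<le> G" "\<And>ss. length ss = k \<Longrightarrow> set ss \<subseteq> {..<G} \<Longrightarrow> fst (h ss) < G"
  shows "wfF k G (actAt i h)"
  unfolding actAt_def
proof (rule wfF_actF[OF assms(1)], intro conjI)
  fix ss :: "nat list" assume ss: "length ss = k" "set ss \<subseteq> {..<G}"
  show "length ((stay ss)[i := h ss]) = k" using ss by simp
  have "fst ` set ((stay ss)[i := h ss]) \<subseteq> fst ` insert (h ss) (set (stay ss))"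
    by (intro image_mono set_update_subset_insert)
  then show "fst ` set ((stay ss)[i := h ss]) \<subseteq> {..<G}" using assms(2)[OF ss] ss by auto
qed

text \<open>A counter is a tape whose only mark sits in cell 0; its value is the head position.\<close>

definition ctr :: "nat \<Rightarrow> tape" where
  "ctr n = (\<lambda>i. if i = 0 then 1 else 0, int n)"

text \<open>The default 0 keeps the symbol inside the alphabet even for a tape that does not exist,
  so that well-formedness holds for every index \<open>i\<close>.\<close>

definition sy :: "nat \<Rightarrow> nat list \<Rightarrow> nat" where
  "sy i ss = (if i < length ss then ss ! i else 0)"

definition nz :: "nat \<Rightarrow> nat list \<Rightarrow> bool" where
  "nz v ss \<longleftrightarrow> ss ! (3 + v) \<noteq> 1"

definition incF :: "nat \<Rightarrow> frag" where
  "incF v = actAt (3 + v) (\<lambda>ss. (sy (3 + v) ss, Go_Right))"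

definition decF :: "nat \<Rightarrow> frag" where
  "decF v = actAt (3 + v) (\<lambda>ss. (sy (3 + v) ss, Go_Left))"

definition inrF :: frag where "inrF = actAt 0 (\<lambda>ss. (sy 0 ss, Go_Right))"
definition inlF :: frag where "inlF = actAt 0 (\<lambda>ss. (sy 0 ss, Go_Left))"

definition outF :: "nat \<Rightarrow> bool \<Rightarrow> frag" where
  "outF K b = actAt (3 + K) (\<lambda>_. (bit_symbol b, Go_Right))"

definition loopF :: "nat \<Rightarrow> frag \<Rightarrow> frag" where
  "loopF v F = whF (nz v) (seqF (decF v) F)"

definition mv1 :: "nat \<Rightarrow> nat \<Rightarrow> frag" where
  "mv1 v r = loopF v (incF r)"

text \<open>A counter can be read only by emptying it; moving it to two counters and one of them
  back makes a copy.\<close>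

definition mv2 :: "nat \<Rightarrow> nat \<Rightarrow> nat \<Rightarrow> frag" where
  "mv2 v r r' = loopF v (seqF (incF r) (incF r'))"

definition clearF :: "nat \<Rightarrow> frag" where
  "clearF v = loopF v skipF"

section \<open>Tape layout and counter operations\<close>

locale machine =
  fixes inp :: "bool list" and K :: nat and kM :: nat
begin

text \<open>The tapes are the input with head at \<open>p\<close>, two tapes reserved for the
  simulation, \<open>K\<close> counters, and the tapes of the machine to be simulated, the first of
  which collects the output \<open>w\<close> with the head behind it.\<close>

definition Tp :: "(nat \<Rightarrow> nat) \<Rightarrow> nat \<Rightarrow> bool list \<Rightarrow> tape list" where
  "Tp s p w = [(fst (input_tape inp), int p), (\<lambda>_. 0, 0), ctr 0] @ map (\<lambda>v. ctr (s v)) [0..<K] @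
     (fst (input_tape w), int (length w)) # replicate (kM - 1) (\<lambda>_. 0, 0)"

lemma length_Tp [simp]: "length (Tp s p w) = 3 + K + Suc (kM - 1)"
  by (simp add: Tp_def)

lemma Tp_nth: "v < K \<Longrightarrow> Tp s p w ! (3 + v) = ctr (s v)"
  by (simp add: Tp_def nth_append numeral_3_eq_3)

lemma Tp_0: "Tp s p w ! 0 = (fst (input_tape inp), int p)"
  by (simp add: Tp_def)

lemma Tp_out: "Tp s p w ! (3 + K) = (fst (input_tape w), int (length w))"
  by (simp add: Tp_def nth_append numeral_3_eq_3)

lemma Tp_upd: "v < K \<Longrightarrow> (Tp s p w)[3 + v := ctr n] = Tp (s(v := n)) p w"
  by (rule nth_equalityI) (auto simp: Tp_def nth_append nth_list_update nth_Cons' numeral_3_eq_3)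

lemma Tp_upd_0: "(Tp s p w)[0 := (fst (input_tape inp), int p')] = Tp s p' w"
  by (simp add: Tp_def)

lemma Tp_upd_out: "(Tp s p w)[3 + K := (fst (input_tape w'), int (length w'))] = Tp s p w'"
  by (rule nth_equalityI) (auto simp: Tp_def nth_append nth_list_update nth_Cons' numeral_3_eq_3)

lemma nz_Tp: "v < K \<Longrightarrow> nz v (map read_tape (Tp s p w)) \<longleftrightarrow> s v \<noteq> 0"
  unfolding nz_def by (simp add: Tp_nth del: One_nat_def) (simp add: ctr_def read_tape_def)

lemma exec_incF: "v < K \<Longrightarrow> exec (incF v) (Tp s p w) 1 (Tp (s(v := Suc (s v))) p w)"
  unfolding incF_def
proof (rule exec_actAt)
  assume v: "v < K"
  then show "3 + v < length (Tp s p w)" by simp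
  have "act_tape (sy (3 + v) (map read_tape (Tp s p w)), Go_Right) (Tp s p w ! (3 + v)) = ctr (Suc (s v))"
    using v by (simp add: Tp_nth act_tape_same sy_def) (simp add: ctr_def)
  then show "Tp (s(v := Suc (s v))) p w = (Tp s p w)[3 + v :=
      act_tape (sy (3 + v) (map read_tape (Tp s p w)), Go_Right) (Tp s p w ! (3 + v))]"
    using Tp_upd[OF v] by simp
qed

lemma exec_decF: "v < K \<Longrightarrow> s v = Suc n \<Longrightarrow> exec (decF v) (Tp s p w) 1 (Tp (s(v := n)) p w)"
  unfolding decF_def
proof (rule exec_actAt)
  assume v: "v < K" and n: "s v = Suc n"
  then show "3 + v < length (Tp s p w)" by simp
  have "act_tape (sy (3 + v) (map read_tape (Tp s p w)), Go_Left) (Tp s p w ! (3 + v)) = ctr n"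
    using v n by (simp add: Tp_nth act_tape_same sy_def) (simp add: ctr_def)
  then show "Tp (s(v := n)) p w = (Tp s p w)[3 + v :=
      act_tape (sy (3 + v) (map read_tape (Tp s p w)), Go_Left) (Tp s p w ! (3 + v))]"
    using Tp_upd[OF v] by simp
qed

lemma exec_inrF: "exec inrF (Tp s p w) 1 (Tp s (Suc p) w)"
  unfolding inrF_def
  by (rule exec_actAt) (auto simp: Tp_0 simp flip: Tp_upd_0[of s p w "Suc p"], simp add: Tp_def act_tape_def read_tape_def add.commute sy_def)

lemma exec_inlF: "exec inlF (Tp s (Suc p) w) 1 (Tp s p w)"
  unfolding inlF_def
  by (rule exec_actAt) (auto simp: Tp_0 simp flip: Tp_upd_0[of s "Suc p" w "p"], simp add: Tp_def act_tape_def read_tape_def sy_def)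

lemma exec_outF: "exec (outF K b) (Tp s p w) 1 (Tp s p (w @ [b]))"
  unfolding outF_def
  by (rule exec_actAt)
    (auto simp: Tp_out act_tape_def input_tape_def nth_append simp flip: Tp_upd_out[of s p w "w @ [b]"]
      intro!: arg_cong[where f = "\<lambda>x. (Tp s p w)[3 + K := x]"] ext)

text \<open>\<open>S i\<close>, \<open>P i\<close> and \<open>W i\<close> describe counters, input
  head and output after \<open>i\<close> rounds, except that counter \<open>v\<close> holds the
  number of rounds left. The cost is stated with a bound \<open>N\<close> on the number of rounds,
  so that it can be made independent of the state.\<close>

lemma exec_loopF:
  assumes v: "v < K" and N: "n \<le> N"
    and F: "\<And>i. i < n \<Longrightarrow> exec F (Tp ((S i)(v := n - Suc i)) (P i) (W i)) c
      (Tp ((S (Suc i))(v := n - Suc i)) (P (Suc i)) (W (Suc i)))"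
    and s0: "s0 = (S 0)(v := n)" and s1: "s1 = (S n)(v := 0)"
  shows "exec (loopF v F) (Tp s0 (P 0) (W 0)) (N * (c + 2) + 1) (Tp s1 (P n) (W n))"
proof -
  \<comment> \<open>Induction on the number \<open>j\<close> of rounds left; \<open>n - j\<close>
    rounds are done.\<close>
  have "exec (loopF v F) (Tp ((S (n - j))(v := j)) (P (n - j)) (W (n - j))) (j * (c + 2) + 1) (Tp s1 (P n) (W n))"
    if "j \<le> n" for j
    using that
  proof (induction j)
    case 0
    then show ?case unfolding loopF_def s1 using exec_whF_done[of "nz v"] nz_Tp[OF v] by simp
  next
    case (Suc j)
    let ?s = "(S (n - Suc j))(v := Suc j)"
    let ?p = "P (n - Suc j)" and ?w = "W (n - Suc j)"
    have e: "Suc (n - Suc j) = n - j" "n - Suc (n - Suc j) = j" using Suc.prems by auto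
    have 1: "exec (decF v) (Tp ?s ?p ?w) 1 (Tp ((S (n - Suc j))(v := j)) ?p ?w)"
      using exec_decF[OF v, of ?s j ?p ?w] by simp
    have 2: "exec F (Tp ((S (n - Suc j))(v := j)) ?p ?w) c (Tp ((S (n - j))(v := j)) (P (n - j)) (W (n - j)))"
      using F[of "n - Suc j"] Suc.prems unfolding e by simp
    have "exec (loopF v F) (Tp ?s ?p ?w) (Suc ((1 + c) + (j * (c + 2) + 1))) (Tp s1 (P n) (W n))"
      unfolding loopF_def
    proof (rule exec_whF_step[OF _ exec_seqF[OF 1 2]])
      show "nz v (map read_tape (Tp ?s ?p ?w))" using nz_Tp[OF v, of ?s ?p ?w] by simp
      show "exec (whF (nz v) (seqF (decF v) F)) (Tp ((S (n - j))(v := j)) (P (n - j)) (W (n - j)))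
          (j * (c + 2) + 1) (Tp s1 (P n) (W n))"
        using Suc.IH[OF Suc_leD[OF Suc.prems]] unfolding loopF_def .
    qed
    then show ?case by (rule exec_mono) (simp add: algebra_simps)
  qed
  from this[of n] have "exec (loopF v F) (Tp s0 (P 0) (W 0)) (n * (c + 2) + 1) (Tp s1 (P n) (W n))"
    using s0 by simp
  then show ?thesis by (rule exec_mono) (use N in \<open>simp add: add_mono mult_le_mono1\<close>)
qed

lemma exec_mv1:
  assumes "v < K" "r < K" "v \<noteq> r" "s v \<le> N" "s' = s(r := s r + s v, v := 0)"
  shows "exec (mv1 v r) (Tp s p w) (N * 3 + 1) (Tp s' p w)"
proof -
  have "exec (loopF v (incF r)) (Tp s p w) (N * (1 + 2) + 1) (Tp s' p w)"
  proof (rule exec_loopF[where S = "\<lambda>i. s(r := s r + i)" and P = "\<lambda>_. p" and W = "\<lambda>_. w", OF assms(1,4)])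
    fix i assume "i < s v"
    let ?s = "s(r := s r + i, v := s v - Suc i)"
    have "?s(r := Suc (?s r)) = s(r := s r + Suc i, v := s v - Suc i)"
      using assms by (auto simp: fun_eq_iff)
    then show "exec (incF r) (Tp ?s p w) 1 (Tp (s(r := s r + Suc i, v := s v - Suc i)) p w)"
      using exec_incF[OF assms(2), of ?s p w] by metis
  qed (use assms in \<open>auto simp: fun_eq_iff\<close>)
  then show ?thesis unfolding mv1_def by (rule exec_mono) simp
qed

lemma exec_mv2:
  assumes "v < K" "r < K" "r' < K" "v \<noteq> r" "v \<noteq> r'" "r \<noteq> r'" "s v \<le> N"
    "s' = s(r := s r + s v, r' := s r' + s v, v := 0)"
  shows "exec (mv2 v r r') (Tp s p w) (N * 4 + 1) (Tp s' p w)"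
proof -
  have "exec (loopF v (seqF (incF r) (incF r'))) (Tp s p w) (N * (2 + 2) + 1) (Tp s' p w)"
  proof (rule exec_loopF[where S = "\<lambda>i. s(r := s r + i, r' := s r' + i)" and P = "\<lambda>_. p" and W = "\<lambda>_. w", OF assms(1,7)])
    fix i assume "i < s v"
    let ?s = "s(r := s r + i, r' := s r' + i, v := s v - Suc i)"
    have "exec (seqF (incF r) (incF r')) (Tp ?s p w) (1 + 1) (Tp (?s(r := Suc (?s r), r' := Suc ((?s(r := Suc (?s r))) r'))) p w)"
      by (rule exec_seqF[OF exec_incF[OF assms(2)] exec_incF[OF assms(3)]])
    moreover have "?s(r := Suc (?s r), r' := Suc ((?s(r := Suc (?s r))) r')) = s(r := s r + Suc i, r' := s r' + Suc i, v := s v - Suc i)"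
      using assms by (auto simp: fun_eq_iff)
    ultimately show "exec (seqF (incF r) (incF r')) (Tp ?s p w) 2 (Tp (s(r := s r + Suc i, r' := s r' + Suc i, v := s v - Suc i)) p w)"
      by (simp only: one_add_one)
  qed (use assms in \<open>auto simp: fun_eq_iff\<close>)
  then show ?thesis unfolding mv2_def by simp
qed

lemma exec_clearF:
  assumes "v < K" "s v \<le> N"
  shows "exec (clearF v) (Tp s p w) (N * 3 + 1) (Tp (s(v := 0)) p w)"
proof -
  have "exec (loopF v skipF) (Tp s p w) (N * (1 + 2) + 1) (Tp (s(v := 0)) p w)"
    by (rule exec_loopF[where S = "\<lambda>i. s" and P = "\<lambda>_. p" and W = "\<lambda>_. w", OF assms])
      (use exec_skipF in auto)
  then show ?thesis unfolding clearF_def by (rule exec_mono) simp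
qed

end

section \<open>Expressions with polynomial evaluation time\<close>

text \<open>\<open>ITER x n a b y\<close> performs \<open>n\<close> rounds of
  \<open>x := min b y\<close>, starting from \<open>a\<close>. The cap \<open>y\<close> is a
  variable and not an expression, so that it cannot grow with the iterates.\<close>

datatype exp = Cn nat | V nat | ADD exp exp | SUB exp exp | MUL exp exp | SIG nat exp exp
  | LETX nat exp exp | COND exp exp exp | INP exp | ITER nat exp exp exp nat

definition bit :: "bool list \<Rightarrow> nat \<Rightarrow> bool" where
  "bit w i \<longleftrightarrow> i < length w \<and> w ! i"

primrec eval :: "bool list \<Rightarrow> exp \<Rightarrow> (nat \<Rightarrow> nat) \<Rightarrow> nat" where
  "eval w (Cn n) s = n"
| "eval w (V x) s = s x"
| "eval w (ADD a b) s = eval w a s + eval w b s"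
| "eval w (SUB a b) s = eval w a s - eval w b s"
| "eval w (MUL a b) s = eval w a s * eval w b s"
| "eval w (SIG x a b) s = (\<Sum>i<eval w a s. eval w b (s(x := i)))"
| "eval w (LETX x a b) s = eval w b (s(x := eval w a s))"
| "eval w (COND c a b) s = (if eval w c s \<noteq> 0 then eval w a s else eval w b s)"
| "eval w (INP a) s = of_bool (bit w (eval w a s))"
| "eval w (ITER x n a b y) s =
     ((\<lambda>v. min (eval w b (s(x := v))) ((s(x := v)) y)) ^^ eval w n s) (eval w a s)"

primrec vb :: "exp \<Rightarrow> nat" where
  "vb (Cn n) = 0"
| "vb (V x) = Suc x"
| "vb (ADD a b) = max (vb a) (vb b)"
| "vb (SUB a b) = max (vb a) (vb b)"
| "vb (MUL a b) = max (vb a) (vb b)"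
| "vb (SIG x a b) = max (Suc x) (max (vb a) (vb b))"
| "vb (LETX x a b) = max (Suc x) (max (vb a) (vb b))"
| "vb (COND c a b) = max (vb c) (max (vb a) (vb b))"
| "vb (INP a) = vb a"
| "vb (ITER x n a b y) = max (Suc x) (max (Suc y) (max (vb n) (max (vb a) (vb b))))"

lemma eval_cong: "(\<And>x. x < vb e \<Longrightarrow> s x = s' x) \<Longrightarrow> eval w e s = eval w e s'"
proof (induction e arbitrary: s s')
  case (SIG x a b)
  have "eval w b (s(x := i)) = eval w b (s'(x := i))" for i
    by (rule SIG.IH(2)) (use SIG.prems in auto)
  moreover have "eval w a s = eval w a s'" by (rule SIG.IH(1)) (use SIG.prems in auto)
  ultimately show ?case by simp
next
  case (LETX x a b)
  have "eval w b (s(x := i)) = eval w b (s'(x := i))" for i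
    by (rule LETX.IH(2)) (use LETX.prems in auto)
  moreover have "eval w a s = eval w a s'" by (rule LETX.IH(1)) (use LETX.prems in auto)
  ultimately show ?case by simp
next
  case (ITER x n a b y)
  have "eval w b (s(x := i)) = eval w b (s'(x := i))" for i
    by (rule ITER.IH(3)) (use ITER.prems in auto)
  moreover have "eval w n s = eval w n s'" by (rule ITER.IH(1)) (use ITER.prems in auto)
  moreover have "eval w a s = eval w a s'" by (rule ITER.IH(2)) (use ITER.prems in auto)
  moreover have "(s(x := v)) y = (s'(x := v)) y" for v using ITER.prems by simp
  ultimately show ?case by (simp del: fun_upd_apply)
next
  case (ADD a b)
  have "eval w a s = eval w a s'" "eval w b s = eval w b s'" by (rule ADD.IH; use ADD.prems in auto)+
  then show ?case by simp
next
  case (SUB a b)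
  have "eval w a s = eval w a s'" "eval w b s = eval w b s'" by (rule SUB.IH; use SUB.prems in auto)+
  then show ?case by simp
next
  case (MUL a b)
  have "eval w a s = eval w a s'" "eval w b s = eval w b s'" by (rule MUL.IH; use MUL.prems in auto)+
  then show ?case by simp
next
  case (COND c a b)
  have "eval w c s = eval w c s'" "eval w a s = eval w a s'" "eval w b s = eval w b s'"
    by (rule COND.IH; use COND.prems in auto)+
  then show ?case by simp
next
  case (INP a)
  have "eval w a s = eval w a s'" by (rule INP.IH; use INP.prems in auto)
  then show ?case by simp
qed auto

text \<open>The bound on values is polynomial in \<open>m\<close> because iteration is capped by a variable.\<close>

primrec bnd :: "exp \<Rightarrow> nat \<Rightarrow> nat" where
  "bnd (Cn n) m = n"
| "bnd (V x) m = m"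
| "bnd (ADD a b) m = bnd a m + bnd b m"
| "bnd (SUB a b) m = bnd a m"
| "bnd (MUL a b) m = bnd a m * bnd b m"
| "bnd (SIG x a b) m = bnd a m * bnd b (m + bnd a m)"
| "bnd (LETX x a b) m = bnd b (m + bnd a m)"
| "bnd (COND c a b) m = bnd a m + bnd b m"
| "bnd (INP a) m = 1"
| "bnd (ITER x n a b y) m = m + bnd a m"

text \<open>The cap is a variable bounded by \<open>m\<close> or, if \<open>y = x\<close>, the
  previous iterate.\<close>

lemma iter_bound:
  assumes "\<And>x. x < N \<Longrightarrow> s x \<le> m" "y < N" "v0 \<le> (m::nat) + A"
  shows "((\<lambda>v. min (f v) ((s(x := v)) y)) ^^ n) v0 \<le> m + A"
proof (induction n)
  case (Suc n)
  let ?v = "((\<lambda>v. min (f v) ((s(x := v)) y)) ^^ n) v0"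
  have "(s(x := ?v)) y \<le> m + A" using Suc assms by (auto simp: trans_le_add1)
  then show ?case by (simp add: min_le_iff_disj)
qed (use assms in simp)

lemma eval_le_bnd:
  "(\<And>x. x < N \<Longrightarrow> s x \<le> m) \<Longrightarrow> vb e \<le> N \<Longrightarrow> eval w e s \<le> bnd e m"
proof (induction e arbitrary: s m)
  case (SIG x a b)
  have a: "eval w a s \<le> bnd a m" by (rule SIG.IH(1)) (use SIG.prems in auto)
  have "eval w b (s(x := i)) \<le> bnd b (m + bnd a m)" if "i < eval w a s" for i
    by (rule SIG.IH(2)) (use SIG.prems a that in \<open>auto simp: trans_le_add1 intro: order_trans\<close>)
  then have "(\<Sum>i<eval w a s. eval w b (s(x := i))) \<le> eval w a s * bnd b (m + bnd a m)"
    using sum_bounded_above[of "{..<eval w a s}" "\<lambda>i. eval w b (s(x := i))" "bnd b (m + bnd a m)"] by simp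
  also have "\<dots> \<le> bnd a m * bnd b (m + bnd a m)" using a by simp
  finally show ?case by simp
next
  case (LETX x a b)
  have a: "eval w a s \<le> bnd a m" by (rule LETX.IH(1)) (use LETX.prems in auto)
  have "eval w b (s(x := eval w a s)) \<le> bnd b (m + bnd a m)"
    by (rule LETX.IH(2)) (use LETX.prems a in \<open>auto simp: trans_le_add1 trans_le_add2\<close>)
  then show ?case by simp
next
  case (ITER x n a b y)
  have a: "eval w a s \<le> bnd a m" by (rule ITER.IH(2)) (use ITER.prems in auto)
  show ?case using ITER.prems a
    by (simp del: fun_upd_apply) (rule iter_bound[of N], auto)
next
  case (ADD a b)
  then show ?case by (simp add: add_mono)
next
  case (SUB a b)
  have "eval w a s \<le> bnd a m" by (rule SUB.IH(1)) (use SUB.prems in auto)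
  then show ?case by simp
next
  case (MUL a b)
  then show ?case by (simp add: mult_le_mono)
next
  case (COND c a b)
  have "eval w a s \<le> bnd a m" "eval w b s \<le> bnd b m" by (rule COND.IH; use COND.prems in auto)+
  then show ?case by auto
qed auto

primrec rep :: "nat \<Rightarrow> frag \<Rightarrow> frag" where
  "rep 0 F = skipF"
| "rep (Suc n) F = seqF F (rep n F)"

text \<open>\<open>cexp e r t\<close> adds the value of \<open>e\<close> to counter \<open>r\<close>; the counters from \<open>t\<close> on are
  scratch space, zero before and after.\<close>

primrec cexp :: "exp \<Rightarrow> nat \<Rightarrow> nat \<Rightarrow> frag" where
  "cexp (Cn n) r t = rep n (incF r)"
| "cexp (V x) r t = seqF (mv2 x r t) (mv1 t x)"
| "cexp (ADD a b) r t = seqF (cexp a r t) (cexp b r t)"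
| "cexp (SUB a b) r t = seqF (cexp a t (t+1)) (seqF (cexp b (t+1) (t+2))
     (seqF (loopF (t+1) (ifF (nz t) (decF t) skipF)) (mv1 t r)))"
| "cexp (MUL a b) r t = seqF (cexp a t (t+1)) (loopF t (cexp b r (t+1)))"
| "cexp (SIG x a b) r t = seqF (cexp a t (t+1)) (seqF (mv1 x (t+1))
     (seqF (loopF t (seqF (cexp b r (t+2)) (incF x))) (seqF (clearF x) (mv1 (t+1) x))))"
| "cexp (LETX x a b) r t = seqF (cexp a t (t+1)) (seqF (mv1 x (t+1)) (seqF (mv1 t x)
     (seqF (cexp b r (t+2)) (seqF (clearF x) (mv1 (t+1) x)))))"
| "cexp (COND c a b) r t = seqF (cexp c t (t+1))
     (ifF (nz t) (seqF (clearF t) (cexp a r (t+1))) (cexp b r (t+1)))"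
| "cexp (INP a) r t = seqF (cexp a t (t+1)) (seqF (loopF t (seqF inrF (incF (t+1))))
     (seqF (ifF (\<lambda>ss. ss ! 0 = 2) (incF r) skipF) (loopF (t+1) inlF)))"
| "cexp (ITER x n a b y) r t = seqF (cexp n t (t+1)) (seqF (cexp a (t+1) (t+2)) (seqF (mv1 x (t+2))
     (seqF (mv1 (t+1) x) (seqF (loopF t
        (seqF (cexp b (t+1) (t+3)) (seqF (mv2 y (t+3) (t+4)) (seqF (mv1 (t+4) y) (seqF (clearF x)
          (seqF (loopF (t+1) (ifF (nz (t+3)) (seqF (decF (t+3)) (incF x)) skipF)) (clearF (t+3))))))))
     (seqF (mv1 x r) (mv1 (t+2) x))))))"

text \<open>A crude count of scratch counters: \<open>ITER\<close> occupies the five counters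
  \<open>t\<close> to \<open>t+4\<close>, and no other constructor needs more for itself.\<close>

primrec wd :: "exp \<Rightarrow> nat" where
  "wd (Cn n) = 5"
| "wd (V x) = 5"
| "wd (ADD a b) = 5 + wd a + wd b"
| "wd (SUB a b) = 5 + wd a + wd b"
| "wd (MUL a b) = 5 + wd a + wd b"
| "wd (SIG x a b) = 5 + wd a + wd b"
| "wd (LETX x a b) = 5 + wd a + wd b"
| "wd (COND c a b) = 5 + wd c + wd a + wd b"
| "wd (INP a) = 5 + wd a"
| "wd (ITER x n a b y) = 5 + wd n + wd a + wd b"

text \<open>The sums are left in the order in which \<open>cexp\<close> composes its parts, so that
  the run times match term by term.\<close>

primrec cost :: "exp \<Rightarrow> nat \<Rightarrow> nat" where
  "cost (Cn n) m = n + 1"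
| "cost (V x) m = (m*4+1) + (m*3+1)"
| "cost (ADD a b) m = cost a m + cost b m"
| "cost (SUB a b) m = cost a m + (cost b m + ((bnd b m * 4 + 1) + (bnd a m * 3 + 1)))"
| "cost (MUL a b) m = cost a m + (bnd a m * (cost b m + 2) + 1)"
| "cost (SIG x a b) m = cost a m + ((m*3+1) +
     ((bnd a m * ((cost b (m + bnd a m) + 1) + 2) + 1) + ((bnd a m * 3 + 1) + (m*3+1))))"
| "cost (LETX x a b) m = cost a m + ((m*3+1) + ((bnd a m * 3 + 1) +
     (cost b (m + bnd a m) + ((bnd a m * 3 + 1) + (m*3+1)))))"
| "cost (COND c a b) m = cost c m + Suc ((bnd c m * 3 + 1) + (cost a m + cost b m))"
| "cost (INP a) m = cost a m + ((bnd a m * ((1 + 1) + 2) + 1) + (Suc 1 + (bnd a m * (1 + 2) + 1)))"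
| "cost (ITER x n a b y) m = (let B = m + bnd a m; D = bnd b (m + B) in
     cost n m + (cost a m + ((m*3+1) + ((bnd a m * 3 + 1) + ((bnd n m *
       ((cost b (m + B) + ((B*4+1) + ((B*3+1) + ((B*3+1) + ((D * (Suc (1 + 1) + 2) + 1) + (B*3+1)))))) + 2) + 1)
       + ((B*3+1) + (m*3+1)))))))"

section \<open>Polynomially bounded functions\<close>

text \<open>The base \<open>m + 2\<close> is at least two even at \<open>m = 0\<close>, so constants
  and sums are absorbed by a larger exponent and no coefficient has to be carried along.\<close>

definition pb :: "(nat \<Rightarrow> nat) \<Rightarrow> bool" where
  "pb f \<longleftrightarrow> (\<exists>d. \<forall>m. f m \<le> (m + 2) ^ d)"

lemma pb_const: "pb (\<lambda>_. n)"
proof -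
  have "n \<le> (m + 2) ^ n" for m
  proof -
    have "n \<le> 2 ^ n" by (simp add: less_imp_le)
    also have "(2::nat) ^ n \<le> (m + 2) ^ n" by (rule power_mono) auto
    finally show ?thesis .
  qed
  then show ?thesis unfolding pb_def by blast
qed

lemma pb_id: "pb (\<lambda>m. m)"
  unfolding pb_def by (intro exI[of _ 1]) simp

lemma pb_mult: assumes "pb f" "pb g" shows "pb (\<lambda>m. f m * g m)"
proof -
  obtain d e where "\<And>m. f m \<le> (m + 2) ^ d" "\<And>m. g m \<le> (m + 2) ^ e" using assms unfolding pb_def by blast
  then have "f m * g m \<le> (m + 2) ^ (d + e)" for m by (simp add: power_add mult_le_mono)
  then show ?thesis unfolding pb_def by blast
qed

lemma pb_add: assumes "pb f" "pb g" shows "pb (\<lambda>m. f m + g m)"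
proof -
  obtain d e where *: "\<And>m. f m \<le> (m + 2) ^ d" "\<And>m. g m \<le> (m + 2) ^ e" using assms unfolding pb_def by blast
  have "f m + g m \<le> (m + 2) ^ (d + e + 1)" for m
  proof -
    have "f m \<le> (m + 2) ^ (d + e)" "g m \<le> (m + 2) ^ (d + e)"
      using *[of m] power_increasing[of d "d + e" "m + 2"] power_increasing[of e "d + e" "m + 2"]
      by (meson le_trans le_add1 le_add2 trans_le_add2 one_le_numeral)+
    then have "f m + g m \<le> 2 * (m + 2) ^ (d + e)" by simp
    also have "\<dots> \<le> (m + 2) * (m + 2) ^ (d + e)" by simp
    finally show ?thesis by simp
  qed
  then show ?thesis unfolding pb_def by blast
qed

lemma pb_comp: assumes "pb f" "pb g" shows "pb (\<lambda>m. f (g m))"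
proof -
  obtain d where d: "\<And>m. f m \<le> (m + 2) ^ d" using assms unfolding pb_def by blast
  obtain e where e: "\<And>m. g m + 2 \<le> (m + 2) ^ e"
    using pb_add[OF assms(2) pb_const[of 2]] unfolding pb_def by blast
  have "f (g m) \<le> (m + 2) ^ (e * d)" for m
  proof -
    have "f (g m) \<le> (g m + 2) ^ d" by (rule d)
    also have "\<dots> \<le> ((m + 2) ^ e) ^ d" by (rule power_mono[OF e]) simp
    finally show ?thesis by (simp add: power_mult)
  qed
  then show ?thesis unfolding pb_def by blast
qed

lemmas pb_intros = pb_const pb_id pb_add pb_mult

lemma pb_bnd: "pb (bnd e)"
proof (induction e)
  case (SIG x a b)
  have "pb (\<lambda>m. bnd b (m + bnd a m))" by (rule pb_comp) (intro pb_intros SIG.IH)+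
  then show ?case using SIG.IH by (simp add: pb_mult)
next
  case (LETX x a b)
  have "pb (\<lambda>m. bnd b (m + bnd a m))" by (rule pb_comp) (intro pb_intros LETX.IH)+
  then show ?case by simp
qed (auto intro!: pb_intros)

lemma pb_cost: "pb (cost e)"
proof (induction e)
  case (SIG x a b)
  have "pb (\<lambda>m. cost b (m + bnd a m))" by (rule pb_comp) (intro pb_intros SIG.IH pb_bnd)+
  then show ?case using SIG.IH unfolding cost.simps by (intro pb_intros pb_bnd)
next
  case (LETX x a b)
  have "pb (\<lambda>m. cost b (m + bnd a m))" by (rule pb_comp) (intro pb_intros LETX.IH pb_bnd)+
  then show ?case using LETX.IH unfolding cost.simps by (intro pb_intros pb_bnd)
next
  case (ITER x n a b y)
  have 1: "pb (\<lambda>m. cost b (m + (m + bnd a m)))" by (rule pb_comp) (intro pb_intros ITER.IH pb_bnd)+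
  have 2: "pb (\<lambda>m. bnd b (m + (m + bnd a m)))" by (rule pb_comp) (intro pb_intros ITER.IH pb_bnd)+
  show ?case using ITER.IH 1 2 unfolding cost.simps Let_def Suc_eq_plus1 by (intro pb_intros pb_bnd)
qed (unfold cost.simps Suc_eq_plus1, (intro pb_intros pb_bnd; assumption?)+)

context machine begin

lemma exec_rep_inc: "r < K \<Longrightarrow> exec (rep n (incF r)) (Tp s p w) (n + 1) (Tp (s(r := s r + n)) p w)"
proof (induction n arbitrary: s)
  case 0
  then show ?case using exec_skipF by simp
next
  case (Suc n)
  have "exec (rep (Suc n) (incF r)) (Tp s p w) (1 + (n + 1)) (Tp ((s(r := Suc (s r)))(r := (s(r := Suc (s r))) r + n)) p w)"
    unfolding rep.simps by (rule exec_seqF[OF exec_incF[OF Suc.prems] Suc.IH[OF Suc.prems]])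
  then show ?case by (simp add: fun_upd_same del: fun_upd_apply)
qed

text \<open>There are three zones: program variables below \<open>N\<close>, the target
  \<open>r\<close>, and scratch counters from \<open>t\<close> on. Expressions read only the first
  zone, so by \<open>eval_cong\<close> intermediate results in the other two do not disturb the
  subexpressions evaluated later.\<close>

lemma exec_cexp:
  assumes "\<And>x. x < N \<Longrightarrow> s x \<le> m" "vb e \<le> N" "N \<le> r" "r < t" "t + wd e \<le> K" "\<And>x. t \<le> x \<Longrightarrow> s x = 0"
    "s' = s(r := s r + eval inp e s)"
  shows "exec (cexp e r t) (Tp s 0 w) (cost e m) (Tp s' 0 w)"
  using assms
proof (induction e arbitrary: r t s s' m)
  case (Cn n)
  then show ?case unfolding Cn(7) using exec_rep_inc[of r n s 0 w] by (simp del: fun_upd_apply)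
next
  case (V x)
  have x: "x < N" "s x \<le> m" using V by auto
  have 1: "exec (mv2 x r t) (Tp s 0 w) (m * 4 + 1) (Tp (s(r := s r + s x, t := s x, x := 0)) 0 w)"
    by (rule exec_mv2) (use V x in \<open>auto simp: fun_eq_iff\<close>)
  have 2: "exec (mv1 t x) (Tp (s(r := s r + s x, t := s x, x := 0)) 0 w) (m * 3 + 1) (Tp (s(r := s r + s x)) 0 w)"
    by (rule exec_mv1) (use V x in \<open>auto simp: fun_eq_iff\<close>)
  show ?case unfolding V(7) using exec_seqF[OF 1 2] by (simp only: cexp.simps cost.simps eval.simps)
next
  case (ADD a b)
  let ?s = "s(r := s r + eval inp a s)"
  have 1: "exec (cexp a r t) (Tp s 0 w) (cost a m) (Tp ?s 0 w)"
    by (rule ADD.IH(1)) (use ADD.prems in auto)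
  have e: "eval inp b ?s = eval inp b s" by (rule eval_cong) (use ADD.prems in auto)
  have 2: "exec (cexp b r t) (Tp ?s 0 w) (cost b m) (Tp (?s(r := ?s r + eval inp b s)) 0 w)"
    proof (rule ADD.IH(2))
    show "?s(r := ?s r + eval inp b s) = ?s(r := ?s r + eval inp b ?s)" unfolding e ..
  qed (use ADD.prems in auto)
  then show ?case unfolding ADD.prems(7) using exec_seqF[OF 1 2] by (simp add: add.assoc fun_upd_same del: fun_upd_apply)
next
  case (SUB a b)
  let ?a = "eval inp a s" and ?b = "eval inp b s"
  let ?s1 = "s(t := ?a)"
  have a: "?a \<le> bnd a m" by (rule eval_le_bnd[of N]) (use SUB.prems in auto)
  have b: "?b \<le> bnd b m" by (rule eval_le_bnd[of N]) (use SUB.prems in auto)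
  have st: "s t = 0" "s (t+1) = 0" using SUB.prems by auto
  have 1: "exec (cexp a t (t+1)) (Tp s 0 w) (cost a m) (Tp ?s1 0 w)"
    by (rule SUB.IH(1)) (use SUB.prems st in \<open>auto simp: fun_eq_iff\<close>)
  have e: "eval inp b ?s1 = ?b" by (rule eval_cong) (use SUB.prems in auto)
  have 2: "exec (cexp b (t+1) (t+2)) (Tp ?s1 0 w) (cost b m) (Tp (?s1(t+1 := ?b)) 0 w)"
    proof (rule SUB.IH(2))
    show "?s1(t+1 := ?b) = ?s1(t+1 := ?s1 (t+1) + eval inp b ?s1)" unfolding e using st by simp
  qed (use SUB.prems in auto)
  have 3: "exec (loopF (t+1) (ifF (nz t) (decF t) skipF)) (Tp (?s1(t+1 := ?b)) 0 w) (bnd b m * (2 + 2) + 1)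
     (Tp (s(t := ?a - ?b)) 0 w)"
  proof (rule exec_loopF[where S = "\<lambda>i. s(t := ?a - i)" and P = "\<lambda>_. 0" and W = "\<lambda>_. w", OF _ b])
    fix i assume "i < ?b"
    let ?s = "(s(t := ?a - i))(t+1 := ?b - Suc i)"
    let ?s' = "(s(t := ?a - Suc i))(t+1 := ?b - Suc i)"
    have "exec (ifF (nz t) (decF t) skipF) (Tp ?s 0 w) (Suc 1) (Tp ?s' 0 w)"
    proof (rule exec_ifF)
      assume "nz t (map read_tape (Tp ?s 0 w))"
      then have *: "?s t = Suc (?a - Suc i)" using nz_Tp[of t ?s 0 w] SUB.prems by auto
      show "exec (decF t) (Tp ?s 0 w) 1 (Tp ?s' 0 w)"
        using exec_decF[of t ?s "?a - Suc i" 0 w] * SUB.prems by (simp add: fun_upd_twist)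
    next
      assume "\<not> nz t (map read_tape (Tp ?s 0 w))"
      then have *: "?a - i = 0" using nz_Tp[of t ?s 0 w] SUB.prems by auto
      then have "?s = ?s'" by (auto simp: fun_eq_iff)
      then show "exec skipF (Tp ?s 0 w) 1 (Tp ?s' 0 w)" using exec_skipF[of "Tp ?s 0 w"] by argo
    qed
    then show "exec (ifF (nz t) (decF t) skipF) (Tp ?s 0 w) 2 (Tp ?s' 0 w)" by (rule exec_mono) simp
  qed (use SUB.prems st in \<open>auto simp: fun_eq_iff\<close>)
  have 4: "exec (mv1 t r) (Tp (s(t := ?a - ?b)) 0 w) (bnd a m * 3 + 1) (Tp (s(r := s r + (?a - ?b))) 0 w)"
    by (rule exec_mv1) (use SUB.prems st a in \<open>auto simp: fun_eq_iff\<close>)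
  show ?case unfolding SUB.prems(7) using exec_seqF[OF 1 exec_seqF[OF 2 exec_seqF[OF 3 4]]] by (simp del: fun_upd_apply)
next
  case (MUL a b)
  let ?a = "eval inp a s" and ?b = "eval inp b s"
  let ?s1 = "s(t := ?a)"
  have a: "?a \<le> bnd a m" by (rule eval_le_bnd[of N]) (use MUL.prems in auto)
  have st: "s t = 0" using MUL.prems by auto
  have 1: "exec (cexp a t (t+1)) (Tp s 0 w) (cost a m) (Tp ?s1 0 w)"
    by (rule MUL.IH(1)) (use MUL.prems st in \<open>auto simp: fun_eq_iff\<close>)
  have 2: "exec (loopF t (cexp b r (t+1))) (Tp ?s1 0 w) (bnd a m * (cost b m + 2) + 1)
     (Tp (s(r := s r + ?a * ?b)) 0 w)"
  proof (rule exec_loopF[where S = "\<lambda>i. s(r := s r + i * ?b)" and P = "\<lambda>_. 0" and W = "\<lambda>_. w", OF _ a])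
    fix i assume "i < ?a"
    let ?s = "(s(r := s r + i * ?b))(t := ?a - Suc i)"
    have e: "eval inp b ?s = ?b" by (rule eval_cong) (use MUL.prems in auto)
    have "exec (cexp b r (t+1)) (Tp ?s 0 w) (cost b m) (Tp (?s(r := ?s r + ?b)) 0 w)"
      proof (rule MUL.IH(2))
        show "?s(r := ?s r + ?b) = ?s(r := ?s r + eval inp b ?s)" unfolding e ..
      qed (use MUL.prems in auto)
    moreover have "?s(r := ?s r + ?b) = (s(r := s r + Suc i * ?b))(t := ?a - Suc i)"
      using MUL.prems by (auto simp: fun_eq_iff)
    ultimately show "exec (cexp b r (t+1)) (Tp ?s 0 w) (cost b m) (Tp ((s(r := s r + Suc i * ?b))(t := ?a - Suc i)) 0 w)"
      by simp
  qed (use MUL.prems st in \<open>auto simp: fun_eq_iff\<close>)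
  show ?case unfolding MUL.prems(7) using exec_seqF[OF 1 2] by (simp del: fun_upd_apply)
next
  case (SIG x a b)
  let ?a = "eval inp a s" and ?b = "\<lambda>i. eval inp b (s(x := i))"
  let ?s1 = "s(t := ?a)" and ?m = "m + bnd a m"
  let ?S = "\<lambda>i. s(t+1 := s x, r := s r + (\<Sum>j<i. ?b j), x := i)"
  have a: "?a \<le> bnd a m" by (rule eval_le_bnd[of N]) (use SIG.prems in auto)
  have x: "x < N" "s x \<le> m" using SIG.prems by auto
  have st: "s t = 0" "s (t+1) = 0" using SIG.prems by auto
  have 1: "exec (cexp a t (t+1)) (Tp s 0 w) (cost a m) (Tp ?s1 0 w)"
    by (rule SIG.IH(1)) (use SIG.prems st in \<open>auto simp: fun_eq_iff\<close>)
  have 2: "exec (mv1 x (t+1)) (Tp ?s1 0 w) (m*3+1) (Tp (s(t := ?a, t+1 := s x, x := 0)) 0 w)"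
    by (rule exec_mv1) (use SIG.prems x st in \<open>auto simp: fun_eq_iff\<close>)
  have 3: "exec (loopF t (seqF (cexp b r (t+2)) (incF x))) (Tp (s(t := ?a, t+1 := s x, x := 0)) 0 w)
     (bnd a m * ((cost b ?m + 1) + 2) + 1) (Tp (?S ?a) 0 w)"
  proof (rule exec_loopF[where S = ?S and P = "\<lambda>_. 0" and W = "\<lambda>_. w", OF _ a])
    fix i assume i: "i < ?a"
    let ?s = "(?S i)(t := ?a - Suc i)"
    have e: "eval inp b ?s = ?b i" by (rule eval_cong) (use SIG.prems in auto)
    have *: "exec (cexp b r (t+2)) (Tp ?s 0 w) (cost b ?m) (Tp (?s(r := ?s r + ?b i)) 0 w)"
      proof (rule SIG.IH(2))
        show "?s(r := ?s r + ?b i) = ?s(r := ?s r + eval inp b ?s)" unfolding e ..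
      qed (use SIG.prems i a in \<open>auto simp: trans_le_add1\<close>)
    have **: "exec (incF x) (Tp (?s(r := ?s r + ?b i)) 0 w) 1 (Tp ((?S (Suc i))(t := ?a - Suc i)) 0 w)"
    proof -
      have "(?s(r := ?s r + ?b i))(x := Suc ((?s(r := ?s r + ?b i)) x)) = (?S (Suc i))(t := ?a - Suc i)"
        using SIG.prems x by (auto simp: fun_eq_iff)
      then show ?thesis using exec_incF[of x "?s(r := ?s r + ?b i)" 0 w] SIG.prems x by auto
    qed
    show "exec (seqF (cexp b r (t+2)) (incF x)) (Tp ?s 0 w) (cost b ?m + 1) (Tp ((?S (Suc i))(t := ?a - Suc i)) 0 w)"
      by (rule exec_seqF[OF * **])
  qed (use SIG.prems st x in \<open>auto simp: fun_eq_iff\<close>)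
  have 4: "exec (clearF x) (Tp (?S ?a) 0 w) (bnd a m * 3 + 1) (Tp ((?S ?a)(x := 0)) 0 w)"
    by (rule exec_clearF) (use SIG.prems x a in auto)
  have 5: "exec (mv1 (t+1) x) (Tp ((?S ?a)(x := 0)) 0 w) (m*3+1) (Tp (s(r := s r + (\<Sum>j<?a. ?b j))) 0 w)"
    by (rule exec_mv1) (use SIG.prems x st in \<open>auto simp: fun_eq_iff\<close>)
  show ?case unfolding SIG.prems(7) using exec_seqF[OF 1 exec_seqF[OF 2 exec_seqF[OF 3 exec_seqF[OF 4 5]]]] by (simp del: fun_upd_apply)
next
  case (LETX x a b)
  let ?a = "eval inp a s" and ?m = "m + bnd a m"
  let ?b = "eval inp b (s(x := ?a))"
  let ?s1 = "s(t := ?a)"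
  let ?s3 = "s(t+1 := s x, x := ?a)"
  have a: "?a \<le> bnd a m" by (rule eval_le_bnd[of N]) (use LETX.prems in auto)
  have x: "x < N" "s x \<le> m" using LETX.prems by auto
  have st: "s t = 0" "s (t+1) = 0" using LETX.prems by auto
  have 1: "exec (cexp a t (t+1)) (Tp s 0 w) (cost a m) (Tp ?s1 0 w)"
    by (rule LETX.IH(1)) (use LETX.prems st in \<open>auto simp: fun_eq_iff\<close>)
  have 2: "exec (mv1 x (t+1)) (Tp ?s1 0 w) (m*3+1) (Tp (s(t := ?a, t+1 := s x, x := 0)) 0 w)"
    by (rule exec_mv1) (use LETX.prems x st in \<open>auto simp: fun_eq_iff\<close>)
  have 3: "exec (mv1 t x) (Tp (s(t := ?a, t+1 := s x, x := 0)) 0 w) (bnd a m * 3 + 1) (Tp ?s3 0 w)"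
    by (rule exec_mv1) (use LETX.prems x st a in \<open>auto simp: fun_eq_iff\<close>)
  have e: "eval inp b ?s3 = ?b" by (rule eval_cong) (use LETX.prems in auto)
  have 4: "exec (cexp b r (t+2)) (Tp ?s3 0 w) (cost b ?m) (Tp (?s3(r := ?s3 r + ?b)) 0 w)"
    proof (rule LETX.IH(2))
      show "?s3(r := ?s3 r + ?b) = ?s3(r := ?s3 r + eval inp b ?s3)" unfolding e ..
    qed (use LETX.prems a in \<open>auto simp: trans_le_add1 trans_le_add2\<close>)
  have 5: "exec (clearF x) (Tp (?s3(r := ?s3 r + ?b)) 0 w) (bnd a m * 3 + 1) (Tp ((?s3(r := ?s3 r + ?b))(x := 0)) 0 w)"
    by (rule exec_clearF) (use LETX.prems x a in auto)
  have 6: "exec (mv1 (t+1) x) (Tp ((?s3(r := ?s3 r + ?b))(x := 0)) 0 w) (m*3+1) (Tp (s(r := s r + ?b)) 0 w)"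
    by (rule exec_mv1) (use LETX.prems x st in \<open>auto simp: fun_eq_iff\<close>)
  show ?case unfolding LETX.prems(7) using exec_seqF[OF 1 exec_seqF[OF 2 exec_seqF[OF 3 exec_seqF[OF 4 exec_seqF[OF 5 6]]]]] by (simp del: fun_upd_apply)
next
  case (COND c a b)
  let ?c = "eval inp c s" and ?a = "eval inp a s" and ?b = "eval inp b s"
  let ?s1 = "s(t := ?c)"
  have c: "?c \<le> bnd c m" by (rule eval_le_bnd[of N]) (use COND.prems in auto)
  have st: "s t = 0" using COND.prems by auto
  have 1: "exec (cexp c t (t+1)) (Tp s 0 w) (cost c m) (Tp ?s1 0 w)"
    by (rule COND.IH(1)) (use COND.prems st in \<open>auto simp: fun_eq_iff\<close>)
  let ?r = "eval inp (COND c a b) s"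
  have 2: "exec (ifF (nz t) (seqF (clearF t) (cexp a r (t+1))) (cexp b r (t+1))) (Tp ?s1 0 w)
     (Suc ((bnd c m * 3 + 1) + (cost a m + cost b m))) (Tp (s(r := s r + ?r)) 0 w)"
  proof (rule exec_ifF)
    assume "nz t (map read_tape (Tp ?s1 0 w))"
    then have nz: "?c \<noteq> 0" using nz_Tp[of t ?s1 0 w] COND.prems by auto
    have 3: "exec (clearF t) (Tp ?s1 0 w) (bnd c m * 3 + 1) (Tp s 0 w)"
    proof -
      have "?s1(t := 0) = s" using st by (auto simp: fun_eq_iff)
      then show ?thesis using exec_clearF[of t ?s1 "bnd c m" 0 w] COND.prems c by auto
    qed
    have 4: "exec (cexp a r (t+1)) (Tp s 0 w) (cost a m) (Tp (s(r := s r + ?a)) 0 w)"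
      by (rule COND.IH(2)) (use COND.prems in auto)
    show "exec (seqF (clearF t) (cexp a r (t+1))) (Tp ?s1 0 w) ((bnd c m * 3 + 1) + (cost a m + cost b m)) (Tp (s(r := s r + ?r)) 0 w)"
      using exec_mono[OF exec_seqF[OF 3 4], of "(bnd c m * 3 + 1) + (cost a m + cost b m)"] nz by simp
  next
    assume "\<not> nz t (map read_tape (Tp ?s1 0 w))"
    then have z: "?c = 0" using nz_Tp[of t ?s1 0 w] COND.prems by auto
    \<comment> \<open>The test found counter \<open>t\<close> at zero, so only the other branch has
      to clear it.\<close>
    then have s: "?s1 = s" using st by (auto simp: fun_eq_iff)
    have 4: "exec (cexp b r (t+1)) (Tp s 0 w) (cost b m) (Tp (s(r := s r + ?b)) 0 w)"
      by (rule COND.IH(3)) (use COND.prems in auto)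
    show "exec (cexp b r (t+1)) (Tp ?s1 0 w) ((bnd c m * 3 + 1) + (cost a m + cost b m)) (Tp (s(r := s r + ?r)) 0 w)"
      unfolding s using exec_mono[OF 4, of "(bnd c m * 3 + 1) + (cost a m + cost b m)"] z by simp
  qed
  show ?case unfolding COND.prems(7) using exec_seqF[OF 1 2] by (simp del: fun_upd_apply)
next
  case (INP a)
  let ?a = "eval inp a s"
  let ?s1 = "s(t := ?a)" and ?s2 = "s(t+1 := ?a)"
  have a: "?a \<le> bnd a m" by (rule eval_le_bnd[of N]) (use INP.prems in auto)
  have st: "s t = 0" "s (t+1) = 0" using INP.prems by auto
  have 1: "exec (cexp a t (t+1)) (Tp s 0 w) (cost a m) (Tp ?s1 0 w)"
    by (rule INP.IH(1)) (use INP.prems st in \<open>auto simp: fun_eq_iff\<close>)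
  have 2: "exec (loopF t (seqF inrF (incF (t+1)))) (Tp ?s1 0 w) (bnd a m * ((1 + 1) + 2) + 1) (Tp ?s2 ?a w)"
  proof (rule exec_loopF[where S = "\<lambda>i. s(t+1 := i)" and P = "\<lambda>i. i" and W = "\<lambda>_. w" and n = ?a, OF _ a])
    fix i assume "i < ?a"
    let ?s = "(s(t+1 := i))(t := ?a - Suc i)"
    have "?s(t+1 := Suc (?s (t+1))) = (s(t+1 := Suc i))(t := ?a - Suc i)"
      by (auto simp: fun_eq_iff)
    then have "exec (incF (t+1)) (Tp ?s (Suc i) w) 1 (Tp ((s(t+1 := Suc i))(t := ?a - Suc i)) (Suc i) w)"
      using exec_incF[of "t+1" ?s "Suc i" w] INP.prems by auto
    from exec_seqF[OF exec_inrF this]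
    show "exec (seqF inrF (incF (t+1))) (Tp ?s i w) (1 + 1) (Tp ((s(t+1 := Suc i))(t := ?a - Suc i)) (Suc i) w)" .
  qed (use INP.prems st in \<open>auto simp: fun_eq_iff\<close>)
  let ?v = "of_bool (bit inp ?a)"
  have rd: "map read_tape (Tp ?s2 ?a w) ! 0 = 2 \<longleftrightarrow> bit inp ?a"
    by (auto simp: Tp_def read_tape_def input_tape_def bit_def bit_symbol_def)
  have 3: "exec (ifF (\<lambda>ss. ss ! 0 = 2) (incF r) skipF) (Tp ?s2 ?a w) (Suc 1) (Tp (?s2(r := s r + ?v)) ?a w)"
  proof (rule exec_ifF)
    assume "map read_tape (Tp ?s2 ?a w) ! 0 = 2"
    then have "bit inp ?a" using rd by simp
    then have "?s2(r := Suc (?s2 r)) = ?s2(r := s r + ?v)" using INP.prems by (auto simp: fun_eq_iff)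
    then show "exec (incF r) (Tp ?s2 ?a w) 1 (Tp (?s2(r := s r + ?v)) ?a w)"
      using exec_incF[of r ?s2 ?a w] INP.prems by auto
  next
    assume "map read_tape (Tp ?s2 ?a w) ! 0 \<noteq> 2"
    then have "\<not> bit inp ?a" using rd by simp
    then have "?s2 = ?s2(r := s r + ?v)" using INP.prems by (auto simp: fun_eq_iff)
    then show "exec skipF (Tp ?s2 ?a w) 1 (Tp (?s2(r := s r + ?v)) ?a w)"
      using exec_skipF[of "Tp ?s2 ?a w"] by argo
  qed
  have 4: "exec (loopF (t+1) inlF) (Tp (?s2(r := s r + ?v)) ?a w) (bnd a m * (1 + 2) + 1) (Tp (s(r := s r + ?v)) (?a - ?a) w)"
  proof -
    have "exec (loopF (t+1) inlF) (Tp (?s2(r := s r + ?v)) (?a - 0) w) (bnd a m * (1 + 2) + 1) (Tp (s(r := s r + ?v)) (?a - ?a) w)"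
    proof (rule exec_loopF[where S = "\<lambda>i. s(r := s r + ?v)" and P = "\<lambda>i. ?a - i" and W = "\<lambda>_. w" and n = ?a, OF _ a])
      fix i assume "i < ?a"
      then have "?a - i = Suc (?a - Suc i)" by simp
      then show "exec inlF (Tp ((s(r := s r + ?v))(t+1 := ?a - Suc i)) (?a - i) w) 1
        (Tp ((s(r := s r + ?v))(t+1 := ?a - Suc i)) (?a - Suc i) w)"
        using exec_inlF[of "(s(r := s r + ?v))(t+1 := ?a - Suc i)" "?a - Suc i" w] by argo
    qed (use INP.prems st in \<open>auto simp: fun_eq_iff\<close>)
    then show ?thesis by simp
  qed
  show ?case unfolding INP.prems(7) using exec_seqF[OF 1 exec_seqF[OF 2 exec_seqF[OF 3 4]]] by (simp del: fun_upd_apply)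
next
  case (ITER x n a b y)
  let ?n = "eval inp n s" and ?a = "eval inp a s"
  define f where "f = (\<lambda>v. min (eval inp b (s(x := v))) ((s(x := v)) y))"
  define B where "B = m + bnd a m"
  define D where "D = bnd b (m + B)"
  have a: "?a \<le> bnd a m" by (rule eval_le_bnd[of N]) (use ITER.prems in auto)
  have n: "?n \<le> bnd n m" by (rule eval_le_bnd[of N]) (use ITER.prems in auto)
  have x: "x < N" "s x \<le> m" using ITER.prems by auto
  have y: "y < N" "s y \<le> m" using ITER.prems by auto
  have st: "s t = 0" "s (t+1) = 0" "s (t+2) = 0" "s (t+3) = 0" "s (t+4) = 0" using ITER.prems by auto
  have KK: "t + 4 < K" "x < t" "y < t" "t < K" "x < K" "y < K" "r < K" "x \<noteq> r" "y \<noteq> r" using ITER.prems x y by auto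
  have it: "(f ^^ i) ?a \<le> B" for i
    unfolding f_def B_def by (rule iter_bound[of N]) (use ITER.prems a y in auto)
  have 1: "exec (cexp n t (t+1)) (Tp s 0 w) (cost n m) (Tp (s(t := ?n)) 0 w)"
    by (rule ITER.IH(1)) (use ITER.prems st in \<open>auto simp: fun_eq_iff\<close>)
  have e: "eval inp a (s(t := ?n)) = ?a" by (rule eval_cong) (use ITER.prems in auto)
  have 2: "exec (cexp a (t+1) (t+2)) (Tp (s(t := ?n)) 0 w) (cost a m) (Tp (s(t := ?n, t+1 := ?a)) 0 w)"
    proof (rule ITER.IH(2))
    let ?s = "s(t := ?n)"
    show "?s(t+1 := ?a) = ?s(t+1 := ?s (t+1) + eval inp a ?s)" unfolding e using st by simp
  qed (use ITER.prems in auto)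
  have 3: "exec (mv1 x (t+2)) (Tp (s(t := ?n, t+1 := ?a)) 0 w) (m*3+1) (Tp (s(t := ?n, t+1 := ?a, t+2 := s x, x := 0)) 0 w)"
    by (rule exec_mv1) (use KK x st in \<open>auto simp: fun_eq_iff\<close>)
  have 4: "exec (mv1 (t+1) x) (Tp (s(t := ?n, t+1 := ?a, t+2 := s x, x := 0)) 0 w) (bnd a m * 3+1) (Tp (s(t := ?n, t+2 := s x, x := ?a)) 0 w)"
    by (rule exec_mv1) (use KK x st a in \<open>auto simp: fun_eq_iff\<close>)
  let ?S = "\<lambda>i. s(t+2 := s x, x := (f ^^ i) ?a)"
  let ?body = "seqF (cexp b (t+1) (t+3)) (seqF (mv2 y (t+3) (t+4)) (seqF (mv1 (t+4) y) (seqF (clearF x)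
          (seqF (loopF (t+1) (ifF (nz (t+3)) (seqF (decF (t+3)) (incF x)) skipF)) (clearF (t+3))))))"
  let ?c = "cost b (m + B) + ((B*4+1) + ((B*3+1) + ((B*3+1) + ((D * (Suc (1 + 1) + 2) + 1) + (B*3+1)))))"
  have 5: "exec (loopF t ?body) (Tp (s(t := ?n, t+2 := s x, x := ?a)) 0 w) (bnd n m * (?c + 2) + 1) (Tp (?S ?n) 0 w)"
  proof (rule exec_loopF[where S = ?S and P = "\<lambda>_. 0" and W = "\<lambda>_. w", OF _ n])
    fix i assume "i < ?n"
    let ?v = "(f ^^ i) ?a"
    let ?s = "(?S i)(t := ?n - Suc i)"
    let ?b = "eval inp b (s(x := ?v))"
    let ?y = "(s(x := ?v)) y"
    have v: "?v \<le> B" by (rule it)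
    have yB: "?y \<le> B" using y v by (auto simp: B_def)
    have s_le: "\<And>x'. x' < N \<Longrightarrow> ?s x' \<le> m + B" using ITER.prems v by (auto simp: trans_le_add1)
    have e: "eval inp b ?s = ?b" by (rule eval_cong) (use ITER.prems in auto)
    have bD: "?b \<le> D" unfolding e[symmetric] D_def by (rule eval_le_bnd[of N]) (use s_le ITER.prems in auto)
    have 1: "exec (cexp b (t+1) (t+3)) (Tp ?s 0 w) (cost b (m + B)) (Tp (?s(t+1 := ?b)) 0 w)"
      proof (rule ITER.IH(3))
      show "?s(t+1 := ?b) = ?s(t+1 := ?s (t+1) + eval inp b ?s)" unfolding e using st KK by simp
    qed (use s_le ITER.prems st KK in auto)
    \<comment> \<open>The cap is copied before \<open>x\<close> is cleared, because \<open>y\<close>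
      may be \<open>x\<close>.\<close>
    have 2: "exec (mv2 y (t+3) (t+4)) (Tp (?s(t+1 := ?b)) 0 w) (B*4+1)
      (Tp (?s(t+1 := ?b, t+3 := ?y, t+4 := ?y, y := 0)) 0 w)"
      by (rule exec_mv2) (use KK yB st in \<open>auto simp: fun_eq_iff\<close>)
    have 3: "exec (mv1 (t+4) y) (Tp (?s(t+1 := ?b, t+3 := ?y, t+4 := ?y, y := 0)) 0 w) (B*3+1)
      (Tp (?s(t+1 := ?b, t+3 := ?y)) 0 w)"
      by (rule exec_mv1) (use KK yB st in \<open>auto simp: fun_eq_iff\<close>)
    have 4: "exec (clearF x) (Tp (?s(t+1 := ?b, t+3 := ?y)) 0 w) (B*3+1) (Tp (?s(t+1 := ?b, t+3 := ?y, x := 0)) 0 w)"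
      by (rule exec_clearF) (use KK v in auto)
    \<comment> \<open>The minimum arises by counting: each of the \<open>?b\<close> rounds moves one
      unit from the copy of the cap to \<open>x\<close> as long as any is left.\<close>
    have 5: "exec (loopF (t+1) (ifF (nz (t+3)) (seqF (decF (t+3)) (incF x)) skipF)) (Tp (?s(t+1 := ?b, t+3 := ?y, x := 0)) 0 w)
      (D * (Suc (1 + 1) + 2) + 1) (Tp (?s(t+3 := ?y - ?b, x := min ?b ?y)) 0 w)"
    proof (rule exec_loopF[where S = "\<lambda>j. ?s(t+3 := ?y - j, x := min j ?y)" and P = "\<lambda>_. 0" and W = "\<lambda>_. w" and n = ?b, OF _ bD])
      fix j assume "j < ?b"
      let ?u = "(?s(t+3 := ?y - j, x := min j ?y))(t+1 := ?b - Suc j)"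
      let ?u' = "(?s(t+3 := ?y - Suc j, x := min (Suc j) ?y))(t+1 := ?b - Suc j)"
      show "exec (ifF (nz (t+3)) (seqF (decF (t+3)) (incF x)) skipF) (Tp ?u 0 w) (Suc (1 + 1)) (Tp ?u' 0 w)"
      proof (rule exec_ifF)
        assume "nz (t+3) (map read_tape (Tp ?u 0 w))"
        then have *: "j < ?y" using nz_Tp[of "t+3" ?u 0 w] KK by auto
        then have u3: "?u (t+3) = Suc (?y - Suc j)" using KK by auto
        have 1: "exec (decF (t+3)) (Tp ?u 0 w) 1 (Tp (?u(t+3 := ?y - Suc j)) 0 w)"
          by (rule exec_decF) (use u3 KK in auto)
        have "(?u(t+3 := ?y - Suc j))(x := Suc ((?u(t+3 := ?y - Suc j)) x)) = ?u'"
          using * KK by (simp only: fun_eq_iff fun_upd_apply) (simp split: if_splits)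
        then have "exec (incF x) (Tp (?u(t+3 := ?y - Suc j)) 0 w) 1 (Tp ?u' 0 w)"
          using exec_incF[of x "?u(t+3 := ?y - Suc j)" 0 w] KK by argo
        from exec_seqF[OF 1 this] show "exec (seqF (decF (t+3)) (incF x)) (Tp ?u 0 w) (1 + 1) (Tp ?u' 0 w)" .
      next
        assume "\<not> nz (t+3) (map read_tape (Tp ?u 0 w))"
        then have *: "\<not> j < ?y" using nz_Tp[of "t+3" ?u 0 w] KK by auto
        then have "?y - j = 0" "?y - Suc j = 0" "min j ?y = ?y" "min (Suc j) ?y = ?y" by auto
        then have "?u = ?u'" by argo
        then show "exec skipF (Tp ?u 0 w) (1 + 1) (Tp ?u' 0 w)"
          using exec_mono[OF exec_skipF[of "Tp ?u 0 w"], of "1 + 1"] by simp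
      qed
    qed (use KK st in \<open>auto simp: fun_eq_iff\<close>)
    have 6: "exec (clearF (t+3)) (Tp (?s(t+3 := ?y - ?b, x := min ?b ?y)) 0 w) (B*3+1) (Tp ((?S (Suc i))(t := ?n - Suc i)) 0 w)"
    proof -
      have "(?s(t+3 := ?y - ?b, x := min ?b ?y))(t+3 := 0) = (?S (Suc i))(t := ?n - Suc i)"
        using KK st by (simp only: fun_eq_iff fun_upd_apply) (simp add: f_def)
      moreover have "(?s(t+3 := ?y - ?b, x := min ?b ?y)) (t+3) \<le> B" using KK yB by auto
      ultimately show ?thesis using exec_clearF[of "t+3" "?s(t+3 := ?y - ?b, x := min ?b ?y)" B 0 w] KK by auto
    qed
    show "exec ?body (Tp ?s 0 w) ?c (Tp ((?S (Suc i))(t := ?n - Suc i)) 0 w)"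
      by (rule exec_seqF[OF 1 exec_seqF[OF 2 exec_seqF[OF 3 exec_seqF[OF 4 exec_seqF[OF 5 6]]]]])
  qed (use KK st in \<open>auto simp: fun_eq_iff\<close>)
  let ?r = "(f ^^ ?n) ?a"
  have 6: "exec (mv1 x r) (Tp (?S ?n) 0 w) (B*3+1) (Tp (s(t+2 := s x, r := s r + ?r, x := 0)) 0 w)"
    by (rule exec_mv1) (use KK ITER.prems it[of ?n] in \<open>auto simp: fun_eq_iff\<close>)
  have 7: "exec (mv1 (t+2) x) (Tp (s(t+2 := s x, r := s r + ?r, x := 0)) 0 w) (m*3+1) (Tp (s(r := s r + ?r)) 0 w)"
    by (rule exec_mv1) (use KK ITER.prems st x in \<open>auto simp: fun_eq_iff\<close>)
  have "eval inp (ITER x n a b y) s = ?r" by (simp add: f_def)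
  then show ?case unfolding ITER.prems(7)
    using exec_seqF[OF 1 exec_seqF[OF 2 exec_seqF[OF 3 exec_seqF[OF 4 exec_seqF[OF 5 exec_seqF[OF 6 7]]]]]]
    unfolding cexp.simps cost.simps Let_def B_def D_def by (simp del: fun_upd_apply)
qed

end

section \<open>Programs that write bits\<close>

datatype stm = NOP | OUT bool | SEQ stm stm | IFS exp stm stm | FOR nat exp stm | LETS nat exp stm

primrec sem :: "bool list \<Rightarrow> stm \<Rightarrow> (nat \<Rightarrow> nat) \<Rightarrow> bool list" where
  "sem w NOP s = []"
| "sem w (OUT b) s = [b]"
| "sem w (SEQ c d) s = sem w c s @ sem w d s"
| "sem w (IFS e c d) s = (if eval w e s \<noteq> 0 then sem w c s else sem w d s)"
| "sem w (FOR x e c) s = concat (map (\<lambda>i. sem w c (s(x := i))) [0..<eval w e s])"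
| "sem w (LETS x e c) s = sem w c (s(x := eval w e s))"

primrec vbs :: "stm \<Rightarrow> nat" where
  "vbs NOP = 0"
| "vbs (OUT b) = 0"
| "vbs (SEQ c d) = max (vbs c) (vbs d)"
| "vbs (IFS e c d) = max (vb e) (max (vbs c) (vbs d))"
| "vbs (FOR x e c) = max (Suc x) (max (vb e) (vbs c))"
| "vbs (LETS x e c) = max (Suc x) (max (vb e) (vbs c))"

lemma sem_cong: "(\<And>x. x < vbs c \<Longrightarrow> s x = s' x) \<Longrightarrow> sem w c s = sem w c s'"
proof (induction c arbitrary: s s')
  case (SEQ c d)
  have "sem w c s = sem w c s'" "sem w d s = sem w d s'" by (rule SEQ.IH; use SEQ.prems in auto)+
  then show ?case by simp
next
  case (IFS e c d)
  have "sem w c s = sem w c s'" "sem w d s = sem w d s'" by (rule IFS.IH; use IFS.prems in auto)+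
  moreover have "eval w e s = eval w e s'" by (rule eval_cong) (use IFS.prems in auto)
  ultimately show ?case by simp
next
  case (FOR x e c)
  have "sem w c (s(x := i)) = sem w c (s'(x := i))" for i
    by (rule FOR.IH) (use FOR.prems in auto)
  moreover have "eval w e s = eval w e s'" by (rule eval_cong) (use FOR.prems in auto)
  ultimately show ?case by simp
next
  case (LETS x e c)
  have "sem w c (s(x := i)) = sem w c (s'(x := i))" for i
    by (rule LETS.IH) (use LETS.prems in auto)
  moreover have "eval w e s = eval w e s'" by (rule eval_cong) (use LETS.prems in auto)
  ultimately show ?case by simp
qed auto

primrec wds :: "stm \<Rightarrow> nat" where
  "wds NOP = 5"
| "wds (OUT b) = 5"
| "wds (SEQ c d) = 5 + wds c + wds d"
| "wds (IFS e c d) = 5 + wd e + wds c + wds d"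
| "wds (FOR x e c) = 5 + wd e + wds c"
| "wds (LETS x e c) = 5 + wd e + wds c"

primrec cstm :: "nat \<Rightarrow> stm \<Rightarrow> nat \<Rightarrow> frag" where
  "cstm K NOP t = skipF"
| "cstm K (OUT b) t = outF K b"
| "cstm K (SEQ c d) t = seqF (cstm K c t) (cstm K d t)"
| "cstm K (IFS e c d) t = seqF (cexp e t (t+1))
     (ifF (nz t) (seqF (clearF t) (cstm K c (t+1))) (cstm K d (t+1)))"
| "cstm K (FOR x e c) t = seqF (cexp e t (t+1)) (seqF (mv1 x (t+1))
     (seqF (loopF t (seqF (cstm K c (t+2)) (incF x))) (seqF (clearF x) (mv1 (t+1) x))))"
| "cstm K (LETS x e c) t = seqF (cexp e t (t+1)) (seqF (mv1 x (t+1)) (seqF (mv1 t x)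
     (seqF (cstm K c (t+2)) (seqF (clearF x) (mv1 (t+1) x)))))"

primrec scost :: "stm \<Rightarrow> nat \<Rightarrow> nat" where
  "scost NOP m = 1"
| "scost (OUT b) m = 1"
| "scost (SEQ c d) m = scost c m + scost d m"
| "scost (IFS e c d) m = cost e m + Suc ((bnd e m * 3 + 1) + (scost c m + scost d m))"
| "scost (FOR x e c) m = cost e m + ((m*3+1) +
     ((bnd e m * ((scost c (m + bnd e m) + 1) + 2) + 1) + ((bnd e m * 3 + 1) + (m*3+1))))"
| "scost (LETS x e c) m = cost e m + ((m*3+1) + ((bnd e m * 3 + 1) +
     (scost c (m + bnd e m) + ((bnd e m * 3 + 1) + (m*3+1)))))"

lemma pb_scost: "pb (scost c)"
proof (induction c)
  case (FOR x e c)
  have "pb (\<lambda>m. scost c (m + bnd e m))" by (rule pb_comp) (intro pb_intros FOR.IH pb_bnd)+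
  then show ?case unfolding scost.simps by (intro pb_intros pb_bnd pb_cost)
next
  case (LETS x e c)
  have "pb (\<lambda>m. scost c (m + bnd e m))" by (rule pb_comp) (intro pb_intros LETS.IH pb_bnd)+
  then show ?case unfolding scost.simps by (intro pb_intros pb_bnd pb_cost)
qed (unfold scost.simps Suc_eq_plus1, (intro pb_intros pb_bnd pb_cost; assumption?)+)

text \<open>Every bit written takes a step, so the cost also bounds the output. This later makes
  \<open>ip_size\<close> polynomial.\<close>

lemma length_sem_le:
  "(\<And>x. x < N \<Longrightarrow> s x \<le> m) \<Longrightarrow> vbs c \<le> N \<Longrightarrow> length (sem w c s) \<le> scost c m"
proof (induction c arbitrary: s m)
  case (SEQ c d)
  have "length (sem w c s) \<le> scost c m" "length (sem w d s) \<le> scost d m"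
    by (rule SEQ.IH; use SEQ.prems in auto)+
  then show ?case by simp
next
  case (IFS e c d)
  have "length (sem w c s) \<le> scost c m" "length (sem w d s) \<le> scost d m"
    by (rule IFS.IH; use IFS.prems in auto)+
  then show ?case by simp
next
  case (FOR x e c)
  have a: "eval w e s \<le> bnd e m" by (rule eval_le_bnd[of N]) (use FOR.prems in auto)
  have *: "length (sem w c (s(x := i))) \<le> scost c (m + bnd e m)" if "i < eval w e s" for i
    by (rule FOR.IH) (use FOR.prems a that in \<open>auto simp: trans_le_add1\<close>)
  have "length (sem w (FOR x e c) s) = (\<Sum>i<eval w e s. length (sem w c (s(x := i))))"
    by (simp add: length_concat comp_def interv_sum_list_conv_sum_set_nat atLeast0LessThan)
  also have "\<dots> \<le> eval w e s * scost c (m + bnd e m)"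
    using sum_bounded_above[of "{..<eval w e s}" "\<lambda>i. length (sem w c (s(x := i)))" "scost c (m + bnd e m)"] * by simp
  also have "\<dots> \<le> bnd e m * scost c (m + bnd e m)" using a by simp
  also have "\<dots> \<le> scost (FOR x e c) m" by (simp add: algebra_simps)
  finally show ?case .
next
  case (LETS x e c)
  have a: "eval w e s \<le> bnd e m" by (rule eval_le_bnd[of N]) (use LETS.prems in auto)
  have "length (sem w c (s(x := eval w e s))) \<le> scost c (m + bnd e m)"
    by (rule LETS.IH) (use LETS.prems a in \<open>auto simp: trans_le_add1 trans_le_add2\<close>)
  then show ?case by simp
qed auto

lemma (in machine) exec_cstm:
  assumes "\<And>x. x < N \<Longrightarrow> s x \<le> m" "vbs c \<le> N" "N \<le> t" "t + wds c \<le> K" "\<And>x. t \<le> x \<Longrightarrow> s x = 0"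
  shows "exec (cstm K c t) (Tp s 0 w) (scost c m) (Tp s 0 (w @ sem inp c s))"
  using assms
proof (induction c arbitrary: t s m w)
  case NOP
  then show ?case using exec_skipF by simp
next
  case (OUT b)
  then show ?case using exec_outF by simp
next
  case (SEQ c d)
  have 1: "exec (cstm K c t) (Tp s 0 w) (scost c m) (Tp s 0 (w @ sem inp c s))"
    by (rule SEQ.IH(1)) (use SEQ.prems in auto)
  have 2: "exec (cstm K d t) (Tp s 0 (w @ sem inp c s)) (scost d m) (Tp s 0 ((w @ sem inp c s) @ sem inp d s))"
    by (rule SEQ.IH(2)) (use SEQ.prems in auto)
  show ?case using exec_seqF[OF 1 2] by simp
next
  case (IFS e c d)
  let ?e = "eval inp e s" and ?r = "w @ sem inp (IFS e c d) s"
  have ee: "?e \<le> bnd e m" by (rule eval_le_bnd[of N]) (use IFS.prems in auto)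
  have st: "s t = 0" using IFS.prems by auto
  have 1: "exec (cexp e t (t+1)) (Tp s 0 w) (cost e m) (Tp (s(t := ?e)) 0 w)"
    by (rule exec_cexp[of N]) (use IFS.prems st in \<open>auto simp: fun_eq_iff\<close>)
  have 2: "exec (ifF (nz t) (seqF (clearF t) (cstm K c (t+1))) (cstm K d (t+1))) (Tp (s(t := ?e)) 0 w)
     (Suc ((bnd e m * 3 + 1) + (scost c m + scost d m))) (Tp s 0 ?r)"
  proof (rule exec_ifF)
    assume "nz t (map read_tape (Tp (s(t := ?e)) 0 w))"
    then have nz: "?e \<noteq> 0" using nz_Tp[of t "s(t := ?e)" 0 w] IFS.prems by auto
    have "(s(t := ?e))(t := 0) = s" using st by (auto simp: fun_eq_iff)
    then have 3: "exec (clearF t) (Tp (s(t := ?e)) 0 w) (bnd e m * 3 + 1) (Tp s 0 w)"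
      using exec_clearF[of t "s(t := ?e)" "bnd e m" 0 w] IFS.prems ee by auto
    have 4: "exec (cstm K c (t+1)) (Tp s 0 w) (scost c m) (Tp s 0 (w @ sem inp c s))"
      by (rule IFS.IH(1)) (use IFS.prems in auto)
    show "exec (seqF (clearF t) (cstm K c (t+1))) (Tp (s(t := ?e)) 0 w) ((bnd e m * 3 + 1) + (scost c m + scost d m)) (Tp s 0 ?r)"
      using exec_mono[OF exec_seqF[OF 3 4], of "(bnd e m * 3 + 1) + (scost c m + scost d m)"] nz by simp
  next
    assume "\<not> nz t (map read_tape (Tp (s(t := ?e)) 0 w))"
    then have z: "?e = 0" using nz_Tp[of t "s(t := ?e)" 0 w] IFS.prems by auto
    then have s: "s(t := ?e) = s" using st by (auto simp: fun_eq_iff)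
    have 4: "exec (cstm K d (t+1)) (Tp s 0 w) (scost d m) (Tp s 0 (w @ sem inp d s))"
      by (rule IFS.IH(2)) (use IFS.prems in auto)
    show "exec (cstm K d (t+1)) (Tp (s(t := ?e)) 0 w) ((bnd e m * 3 + 1) + (scost c m + scost d m)) (Tp s 0 ?r)"
      unfolding s using exec_mono[OF 4, of "(bnd e m * 3 + 1) + (scost c m + scost d m)"] z by simp
  qed
  show ?case using exec_seqF[OF 1 2] by simp
next
  case (FOR x e c)
  let ?a = "eval inp e s" and ?b = "\<lambda>i. sem inp c (s(x := i))"
  let ?s1 = "s(t := ?a)" and ?m = "m + bnd e m"
  let ?S = "\<lambda>i. s(t+1 := s x, x := i)"
  let ?W = "\<lambda>i. w @ concat (map ?b [0..<i])"
  have a: "?a \<le> bnd e m" by (rule eval_le_bnd[of N]) (use FOR.prems in auto)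
  have x: "x < N" "s x \<le> m" using FOR.prems by auto
  have st: "s t = 0" "s (t+1) = 0" using FOR.prems by auto
  have 1: "exec (cexp e t (t+1)) (Tp s 0 w) (cost e m) (Tp ?s1 0 w)"
    by (rule exec_cexp[of N]) (use FOR.prems st in \<open>auto simp: fun_eq_iff\<close>)
  have 2: "exec (mv1 x (t+1)) (Tp ?s1 0 w) (m*3+1) (Tp (s(t := ?a, t+1 := s x, x := 0)) 0 w)"
    by (rule exec_mv1) (use FOR.prems x st in \<open>auto simp: fun_eq_iff\<close>)
  have 3: "exec (loopF t (seqF (cstm K c (t+2)) (incF x))) (Tp (s(t := ?a, t+1 := s x, x := 0)) 0 (?W 0))
     (bnd e m * ((scost c ?m + 1) + 2) + 1) (Tp (?S ?a) 0 (?W ?a))"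
  proof (rule exec_loopF[where S = ?S and P = "\<lambda>_. 0" and W = ?W, OF _ a])
    fix i assume i: "i < ?a"
    let ?s = "(?S i)(t := ?a - Suc i)"
    have e: "sem inp c ?s = ?b i"
      by (rule sem_cong) (use FOR.prems in auto)
    have *: "exec (cstm K c (t+2)) (Tp ?s 0 (?W i)) (scost c ?m) (Tp ?s 0 (?W i @ sem inp c ?s))"
      by (rule FOR.IH) (use FOR.prems i a in \<open>auto simp: trans_le_add1\<close>)
    have "?s(x := Suc (?s x)) = (?S (Suc i))(t := ?a - Suc i)"
      using FOR.prems x by (auto simp: fun_eq_iff)
    then have **: "exec (incF x) (Tp ?s 0 (?W (Suc i))) 1 (Tp ((?S (Suc i))(t := ?a - Suc i)) 0 (?W (Suc i)))"
      using exec_incF[of x ?s 0 "?W (Suc i)"] FOR.prems x by auto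
    have w: "?W i @ sem inp c ?s = ?W (Suc i)" unfolding e by simp
    show "exec (seqF (cstm K c (t+2)) (incF x)) (Tp ?s 0 (?W i)) (scost c ?m + 1) (Tp ((?S (Suc i))(t := ?a - Suc i)) 0 (?W (Suc i)))"
      by (rule exec_seqF[OF *[unfolded w] **])
  qed (use FOR.prems st x in \<open>auto simp: fun_eq_iff\<close>)
  have 4: "exec (clearF x) (Tp (?S ?a) 0 (?W ?a)) (bnd e m * 3 + 1) (Tp ((?S ?a)(x := 0)) 0 (?W ?a))"
    by (rule exec_clearF) (use FOR.prems x a in auto)
  have 5: "exec (mv1 (t+1) x) (Tp ((?S ?a)(x := 0)) 0 (?W ?a)) (m*3+1) (Tp s 0 (?W ?a))"
    by (rule exec_mv1) (use FOR.prems x st in \<open>auto simp: fun_eq_iff\<close>)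
  have 33: "exec (loopF t (seqF (cstm K c (t+2)) (incF x))) (Tp (s(t := ?a, t+1 := s x, x := 0)) 0 w)
     (bnd e m * ((scost c ?m + 1) + 2) + 1) (Tp (?S ?a) 0 (?W ?a))" using 3 by (simp del: fun_upd_apply)
  show ?case using exec_seqF[OF 1 exec_seqF[OF 2 exec_seqF[OF 33 exec_seqF[OF 4 5]]]] by (simp del: fun_upd_apply)
next
  case (LETS x e c)
  let ?a = "eval inp e s" and ?m = "m + bnd e m"
  let ?s3 = "s(t+1 := s x, x := ?a)"
  let ?w = "w @ sem inp c ?s3"
  have a: "?a \<le> bnd e m" by (rule eval_le_bnd[of N]) (use LETS.prems in auto)
  have x: "x < N" "s x \<le> m" using LETS.prems by auto
  have st: "s t = 0" "s (t+1) = 0" using LETS.prems by auto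
  have 1: "exec (cexp e t (t+1)) (Tp s 0 w) (cost e m) (Tp (s(t := ?a)) 0 w)"
    by (rule exec_cexp[of N]) (use LETS.prems st in \<open>auto simp: fun_eq_iff\<close>)
  have 2: "exec (mv1 x (t+1)) (Tp (s(t := ?a)) 0 w) (m*3+1) (Tp (s(t := ?a, t+1 := s x, x := 0)) 0 w)"
    by (rule exec_mv1) (use LETS.prems x st in \<open>auto simp: fun_eq_iff\<close>)
  have 3: "exec (mv1 t x) (Tp (s(t := ?a, t+1 := s x, x := 0)) 0 w) (bnd e m * 3 + 1) (Tp ?s3 0 w)"
    by (rule exec_mv1) (use LETS.prems x st a in \<open>auto simp: fun_eq_iff\<close>)
  have 4: "exec (cstm K c (t+2)) (Tp ?s3 0 w) (scost c ?m) (Tp ?s3 0 ?w)"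
    by (rule LETS.IH) (use LETS.prems a in \<open>auto simp: trans_le_add1 trans_le_add2\<close>)
  have 5: "exec (clearF x) (Tp ?s3 0 ?w) (bnd e m * 3 + 1) (Tp (?s3(x := 0)) 0 ?w)"
    by (rule exec_clearF) (use LETS.prems x a in auto)
  have 6: "exec (mv1 (t+1) x) (Tp (?s3(x := 0)) 0 ?w) (m*3+1) (Tp s 0 ?w)"
    by (rule exec_mv1) (use LETS.prems x st in \<open>auto simp: fun_eq_iff\<close>)
  have w: "sem inp c ?s3 = sem inp c (s(x := ?a))"
    by (rule sem_cong) (use LETS.prems in auto)
  show ?case using exec_seqF[OF 1 exec_seqF[OF 2 exec_seqF[OF 3 exec_seqF[OF 4 exec_seqF[OF 5 6]]]]]
    unfolding w by (simp del: fun_upd_apply)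
qed


section \<open>Assembling the machine for a reduction\<close>

lemma set_stayD: "(a, d) \<in> set (stay ss) \<Longrightarrow> a \<in> set ss"
  by (auto simp: stay_def)

text \<open>The simulation of \<open>M\<close> moves a mark in lockstep with the first tape of \<open>M\<close> and keeps a copy of
  the symbol in cell 0 on a separate tape: when \<open>M\<close> halts, the position of its head is unknown.\<close>

definition simM :: "tm \<Rightarrow> nat \<Rightarrow> frag" where
  "simM M K = (max 2 (tm_states M), \<lambda>q ss.
     let (q', as) = tm_delta M q (drop (3 + K) ss) in
     if q < tm_states M then
       (q', (ss ! 0, Stay) # (if ss ! 2 = 1 then fst (hd as) else ss ! 1, Stay) # (ss ! 2, snd (hd as)) #
         stay (take K (drop 3 ss)) @ as)
     else (1, stay ss))"

lemma wf_tm_D: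
  assumes "wf_tm M" "q < tm_states M" "length ss = tm_tapes M" "set ss \<subseteq> {..<tm_symbols M}"
    "tm_delta M q ss = (q', as)"
  shows "q' < tm_states M" "length as = tm_tapes M" "fst ` set as \<subseteq> {..<tm_symbols M}"
  using assms unfolding wf_tm_def by (auto split: prod.splits)

lemma wfF_simM:
  assumes M: "wf_tm M" shows "wfF (3 + K + tm_tapes M) (tm_symbols M) (simM M K)"
  unfolding wfF_def
proof (intro conjI allI impI)
  show "2 \<le> fst (simM M K)" by (simp add: simM_def)
  fix q ss assume ss: "length ss = 3 + K + tm_tapes M \<and> set ss \<subseteq> {..<tm_symbols M}"
  obtain q' as where d: "tm_delta M q (drop (3 + K) ss) = (q', as)" by fastforce
  have M': "1 \<le> tm_tapes M" "2 \<le> tm_states M" using M by (auto simp: wf_tm_def)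
  show "case snd (simM M K) q ss of (q', as) \<Rightarrow> q' < fst (simM M K) \<and>
      length as = 3 + K + tm_tapes M \<and> fst ` set as \<subseteq> {..<tm_symbols M}"
  proof (cases "q < tm_states M")
    case True
    have "set (drop (3 + K) ss) \<subseteq> {..<tm_symbols M}" using ss set_drop_subset[of "3 + K" ss] by blast
    then have w: "q' < tm_states M" "length as = tm_tapes M" "fst ` set as \<subseteq> {..<tm_symbols M}"
      using wf_tm_D[OF M True _ _ d] ss by auto
    have "ss ! i < tm_symbols M" if "i < 3" for i
      using ss that nth_mem[of i ss] by (auto simp: subset_iff)
    moreover have "set (take K (drop 3 ss)) \<subseteq> {..<tm_symbols M}"
      using ss set_drop_subset[of 3 ss] set_take_subset[of K "drop 3 ss"] by blast
    moreover have "fst (hd as) < tm_symbols M"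
      using w M' by (cases as) auto
    ultimately show ?thesis using d w True ss M' by (auto simp: simM_def Let_def dest!: set_stayD)
  next
    case False
    then show ?thesis using d ss M' by (auto simp: simM_def Let_def)
  qed
qed

definition mk :: "int \<Rightarrow> nat" where "mk = (\<lambda>i. if i = 0 then 1 else 0)"

text \<open>The copy \<open>R\<close> of cell 0 is blank at the start and so may be wrong; but then
  the simulated head stands on cell 0 and at least one step follows, whose write makes
  \<open>R\<close> right. From then on \<open>R\<close> is updated exactly when the mark is under
  the head.\<close>

lemma run_simM:
  assumes "run (tm_delta M) q Ms n Ms'" and M: "wf_tm M"
    and "q < tm_states M" "length Ms = tm_tapes M" "\<And>T i. T \<in> set Ms \<Longrightarrow> fst T i < tm_symbols M" "length Cs = K"
    and "read_tape R = fst (hd Ms) 0 \<or> (n > 0 \<and> snd (hd Ms) = 0)"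
  shows "\<exists>R'. read_tape R' = fst (hd Ms') 0 \<and>
    run (snd (simM M K)) q (I # R # (mk, snd (hd Ms)) # Cs @ Ms) n (I # R' # (mk, snd (hd Ms')) # Cs @ Ms')"
  using assms(1,3-7)
proof (induction arbitrary: R rule: run.induct)
  case (run_halt Ms)
  then show ?case by (intro exI[of _ R]) (simp add: run_halt')
next
  case (run_step q Ms q' as n Ms')
  let ?ss = "map read_tape Ms"
  let ?G = "tm_symbols M"
  have tm1: "1 \<le> tm_tapes M" using M by (simp add: wf_tm_def)
  then obtain T Ts where Ms: "Ms = T # Ts" using run_step.prems(2) by (cases Ms) auto
  have "set ?ss \<subseteq> {..<?G}" using run_step.prems(3) by (auto simp: read_tape_def)
  then have w: "q' < tm_states M" "length as = tm_tapes M" "fst ` set as \<subseteq> {..<?G}"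
    using wf_tm_D[OF M run_step.prems(1) _ _ run_step.hyps(2)] run_step.prems(2) by auto
  then obtain a bs where as: "as = a # bs" using tm1 by (cases as) auto
  define Ms1 where "Ms1 = map2 act_tape as Ms"
  have len1: "length Ms1 = tm_tapes M" using w run_step.prems(2) by (simp add: Ms1_def)
  have sym1: "fst U i < ?G" if "U \<in> set Ms1" for U i
  proof -
    from that have "U \<in> (\<lambda>(b, W). act_tape b W) ` set (zip as Ms)" by (simp add: Ms1_def)
    then obtain z where z: "z \<in> set (zip as Ms)" "U = (case z of (b, W) \<Rightarrow> act_tape b W)" by blast
    obtain b W where "z = (b, W)" by (rule prod.exhaust)
    with z have U: "U = act_tape b W" and bW: "(b, W) \<in> set (zip as Ms)" by simp_all
    show ?thesis using U w(3) run_step.prems(3)[of W] set_zip_leftD[OF bW] set_zip_rightD[OF bW]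
      by (auto simp: act_tape_def)
  qed
  define R1 where "R1 = act_tape (if snd T = 0 then fst a else read_tape R, Stay) R"
  have hd1: "hd Ms1 = act_tape a T" by (simp add: Ms1_def as Ms)
  have R1: "read_tape R1 = fst (hd Ms1) 0"
    using run_step.prems(5) unfolding hd1 R1_def Ms by (auto simp: act_tape_def read_tape_def)
  obtain R' where R': "read_tape R' = fst (hd Ms') 0"
    "run (snd (simM M K)) q' (I # R1 # (mk, snd (hd Ms1)) # Cs @ Ms1) n (I # R' # (mk, snd (hd Ms')) # Cs @ Ms')"
    using run_step.IH[folded Ms1_def, OF w(1) len1 sym1 run_step.prems(4), of R1] R1 by blast
  let ?Ts = "I # R # (mk, snd (hd Ms)) # Cs @ Ms"
  let ?as = "(read_tape I, Stay) # (if snd T = 0 then fst a else read_tape R, Stay) #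
    (mk (snd T), snd a) # stay (map read_tape Cs) @ as"
  have d: "snd (simM M K) q (map read_tape ?Ts) = (q', ?as)"
    using run_step.hyps(2) run_step.prems(1,4)
    by (simp add: simM_def Let_def as Ms read_tape_def mk_def numeral_2_eq_2 numeral_3_eq_3 del: map_map)
  have "map2 act_tape ?as ?Ts = I # R1 # (mk, snd (hd Ms1)) # Cs @ Ms1"
    by (simp add: hd1 R1_def Ms zip_append Ms1_def[symmetric, unfolded Ms]) (simp add: act_tape_def)
  then have "run (snd (simM M K)) q' (map2 act_tape ?as ?Ts) n (I # R' # (mk, snd (hd Ms')) # Cs @ Ms')"
    using R' by simp
  with R' show ?case using run.run_step[where \<delta> = "snd (simM M K)" and Ts = ?Ts, OF run_step.hyps(1) d] by blast
qed

section \<open>Preparing the tapes, rewinding the output and delivering the answer\<close>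

definition rewF :: "nat \<Rightarrow> frag" where
  "rewF i = seqF (actAt i (\<lambda>ss. (sy i ss, Go_Left)))
     (seqF (whF (\<lambda>ss. sy i ss \<noteq> 0) (actAt i (\<lambda>ss. (sy i ss, Go_Left)))) (actAt i (\<lambda>ss. (sy i ss, Go_Right))))"

lemma exec_actAt_move:
  assumes "i < length Ts"
  shows "exec (actAt i (\<lambda>ss. (sy i ss, d))) Ts 1 (Ts[i := (fst (Ts ! i), move d (snd (Ts ! i)))])"
  using assms by (intro exec_actAt) (auto simp: sy_def act_tape_same)

lemma exec_rewF:
  assumes i: "i < length Ts" and T: "Ts ! i = (fst (input_tape w), int (length w))"
  shows "exec (rewF i) Ts (2 * length w + 3) (Ts[i := input_tape w])"
proof -
  let ?c = "fst (input_tape w)"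
  let ?L = "actAt i (\<lambda>ss. (sy i ss, Go_Left))"
  have 1: "exec ?L Ts 1 (Ts[i := (?c, int (length w) - 1)])"
    using exec_actAt_move[OF i, of Go_Left] T by simp
  have 2: "exec (whF (\<lambda>ss. sy i ss \<noteq> 0) ?L) (Ts[i := (?c, int j - 1)]) (2 * j + 1) (Ts[i := (?c, -1)])"
    if "j \<le> length w" for j
    using that
  proof (induction j)
    case 0
    show ?case using exec_whF_done[of "\<lambda>ss. sy i ss \<noteq> 0" "Ts[i := (?c, -1)]"] i
      by (simp add: sy_def read_tape_def input_tape_def)
  next
    case (Suc j)
    let ?T = "Ts[i := (?c, int (Suc j) - 1)]"
    have s: "sy i (map read_tape ?T) \<noteq> 0" using i Suc.prems
      by (simp add: sy_def read_tape_def input_tape_def bit_symbol_def)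
    have "exec ?L ?T 1 (Ts[i := (?c, int j - 1)])"
      using exec_actAt_move[of i ?T Go_Left] i by simp
    from exec_whF_step[of "\<lambda>ss. sy i ss \<noteq> 0", OF s this Suc.IH] Suc.prems show ?case by simp
  qed
  have 3: "exec (actAt i (\<lambda>ss. (sy i ss, Go_Right))) (Ts[i := (?c, -1)]) 1 (Ts[i := input_tape w])"
    using exec_actAt_move[of i "Ts[i := (?c, -1)]" Go_Right] i by (simp add: input_tape_def)
  show ?thesis unfolding rewF_def
    by (rule exec_mono[OF exec_seqF[OF 1 exec_seqF[OF 2[OF order_refl] 3]]]) simp
qed

definition initF :: "nat \<Rightarrow> frag" where
  "initF K = actF (\<lambda>ss. map (\<lambda>i. (if 2 \<le> i \<and> i < 3 + K then 1 else ss ! i, Stay)) [0..<length ss])"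

text \<open>The input head is brought back by spending counter 0, which is rebuilt in counter 1 and
  then moved back.\<close>

definition lenF :: frag where
  "lenF = seqF (whF (\<lambda>ss. sy 0 ss \<noteq> 0) (seqF inrF (incF 0))) (seqF (loopF 0 (seqF inlF (incF 1))) (mv1 1 0))"

text \<open>The first tape still holds the input, so cell 1 has to be blanked for the output to end
  after the answer bit.\<close>

definition finF :: frag where
  "finF = seqF (ifF (\<lambda>ss. sy 1 ss = 2) (actAt 0 (\<lambda>_. (2, Go_Right))) (actAt 0 (\<lambda>_. (1, Go_Right))))
     (actAt 0 (\<lambda>_. (0, Stay)))"

definition mainF :: "tm \<Rightarrow> stm \<Rightarrow> nat \<Rightarrow> nat \<Rightarrow> frag" where
  "mainF M c N K = seqF (initF K) (seqF lenF (seqF (cstm K c N) (seqF (rewF (3 + K)) (seqF (simM M K) finF))))"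

lemma sy_less: "0 < G \<Longrightarrow> set ss \<subseteq> {..<G} \<Longrightarrow> sy i ss < G"
  using nth_mem[of i ss] by (auto simp: sy_def subset_iff)

lemma wfF_move: "2 \<le> G \<Longrightarrow> wfF k G (actAt i (\<lambda>ss. (sy j ss, d)))"
  by (rule wfF_actAt) (auto intro: sy_less)

lemmas wfF_intros = wfF_seqF wfF_ifF wfF_whF wfF_skipF wfF_move

lemma wfF_prims:
  assumes "2 \<le> G"
  shows "wfF k G (incF v)" "wfF k G (decF v)" "wfF k G inrF" "wfF k G inlF"
    "wfF k G (mv1 v r)" "wfF k G (mv2 v r r')" "wfF k G (clearF v)" "wfF k G (rewF i)"
  using assms unfolding incF_def decF_def inrF_def inlF_def mv1_def mv2_def clearF_def loopF_def rewF_def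
  by (intro wfF_intros; assumption)+

lemma wfF_loopF: "2 \<le> G \<Longrightarrow> wfF k G F \<Longrightarrow> wfF k G (loopF v F)"
  unfolding loopF_def by (intro wfF_intros wfF_prims)

lemma wfF_rep: "2 \<le> G \<Longrightarrow> wfF k G F \<Longrightarrow> wfF k G (rep n F)"
  by (induction n) (auto intro: wfF_intros)

lemma wfF_cexp: "2 \<le> G \<Longrightarrow> wfF k G (cexp e r t)"
  by (induction e arbitrary: r t) (auto intro!: wfF_seqF wfF_ifF wfF_skipF wfF_loopF wfF_prims wfF_rep)

lemma wfF_cstm: "3 \<le> G \<Longrightarrow> wfF k G (cstm K c t)"
  by (induction c arbitrary: t)
    (auto intro!: wfF_seqF wfF_ifF wfF_skipF wfF_loopF wfF_prims wfF_cexp wfF_actAt simp: outF_def bit_symbol_def)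

lemma wfF_mainF:
  assumes M: "wf_tm M"
  shows "wfF (3 + K + tm_tapes M) (tm_symbols M) (mainF M c N K)"
proof -
  have G: "3 \<le> tm_symbols M" using M by (simp add: wf_tm_def)
  then have G2: "2 \<le> tm_symbols M" by simp
  have 1: "wfF (3 + K + tm_tapes M) (tm_symbols M) (initF K)"
    unfolding initF_def by (rule wfF_actF) (use G in \<open>auto simp: subset_iff\<close>)
  have 2: "wfF (3 + K + tm_tapes M) (tm_symbols M) lenF" unfolding lenF_def
    by (intro wfF_seqF wfF_whF wfF_loopF wfF_prims G2)
  have 3: "wfF (3 + K + tm_tapes M) (tm_symbols M) finF" unfolding finF_def
    by (intro wfF_seqF wfF_ifF wfF_actAt G2) (use G in auto)
  show ?thesis unfolding mainF_def
    by (intro wfF_seqF 1 2 3 wfF_cstm[OF G] wfF_prims[OF G2] wfF_simM[OF M])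
qed

lemma (in machine) exec_initF:
  assumes "kM \<ge> 1"
  shows "exec (initF K) (input_tape inp # replicate (2 + K + kM) (\<lambda>_. 0, 0)) 1 (Tp (\<lambda>_. 0) 0 [])"
proof -
  let ?Ts = "input_tape inp # replicate (2 + K + kM) (\<lambda>_. 0, 0)"
  have "map2 act_tape (map (\<lambda>i. (if 2 \<le> i \<and> i < 3 + K then 1 else map read_tape ?Ts ! i, Stay)) [0..<length (map read_tape ?Ts)]) ?Ts
      = Tp (\<lambda>_. 0) 0 []" (is "?l = ?r")
  proof (rule nth_equalityI)
    show "length ?l = length ?r" using assms by simp
    fix i assume "i < length ?l"
    then have i: "i < 3 + K + kM" by simp
    have li: "?l ! i = act_tape (if 2 \<le> i \<and> i < 3 + K then 1 else read_tape (?Ts ! i), Stay) (?Ts ! i)"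
    proof -
      have "map read_tape ?Ts ! i = read_tape (?Ts ! i)" using i by (subst nth_map) simp_all
      then show ?thesis using i by (simp del: upt_Suc replicate_Suc list.map map_replicate)
    qed
    have Tsi: "?Ts ! i = (\<lambda>_. 0, 0)" if "i \<noteq> 0" using that i by (simp add: nth_Cons' del: replicate_Suc)
    consider "i = 0" | "i = 1" | "2 \<le> i" "i < 3 + K" | "3 + K \<le> i" by linarith
    then show "?l ! i = ?r ! i"
    proof cases
      case 1
      then show ?thesis unfolding li by (simp add: Tp_def input_tape_def del: replicate_Suc)
    next
      case 2
      then show ?thesis unfolding li using Tsi by (simp add: Tp_def del: replicate_Suc)
    next
      case 3
      then have "?l ! i = act_tape (1, Stay) (\<lambda>_. 0, 0)" unfolding li using Tsi by (simp del: replicate_Suc)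
      also have "\<dots> = ctr 0" by (auto simp: act_tape_def ctr_def)
      also have "\<dots> = ?r ! i"
      proof (cases "i = 2")
        case True
        then show ?thesis by (simp add: Tp_def)
      next
        case False
        then obtain v where "i = 3 + v" "v < K" using 3 less_imp_Suc_add[of 2 i] by auto
        then show ?thesis using Tp_nth by presburger
      qed
      finally show ?thesis .
    next
      case 4
      then have "?l ! i = (\<lambda>_. 0, 0)" unfolding li using Tsi by (simp del: replicate_Suc)
      also have "\<dots> = ?r ! i"
      proof -
        obtain d where d: "i = 3 + K + d" using 4 le_Suc_ex by blast
        have "?r ! (3 + K + d) = ((fst (input_tape []), 0) # replicate (kM - 1) (\<lambda>_. 0, 0)) ! d"
          by (simp add: Tp_def nth_append numeral_3_eq_3)
        also have "\<dots> = (\<lambda>_. 0, 0)" using i d by (cases d) (auto simp: input_tape_def)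
        finally show ?thesis unfolding d by simp
      qed
      finally show ?thesis .
    qed
  qed
  then show ?thesis unfolding initF_def using exec_actF[of "\<lambda>ss. map (\<lambda>i. (if 2 \<le> i \<and> i < 3 + K then 1 else ss ! i, Stay)) [0..<length ss]" ?Ts]
    by simp
qed

lemma (in machine) exec_lenF:
  assumes K: "K \<ge> 2"
  shows "exec lenF (Tp (\<lambda>_. 0) 0 []) (11 * length inp + 3) (Tp ((\<lambda>_. 0)(0 := length inp)) 0 [])"
proof -
  let ?n = "length inp" and ?z = "(\<lambda>_. 0) :: nat \<Rightarrow> nat"
  let ?c = "\<lambda>ss. sy 0 ss \<noteq> 0"
  have rd: "?c (map read_tape (Tp s p w)) \<longleftrightarrow> p < ?n" for s p w
    by (simp add: Tp_def sy_def read_tape_def input_tape_def bit_symbol_def)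
  have 1: "exec (whF ?c (seqF inrF (incF 0))) (Tp (?z(0 := ?n - j)) (?n - j) []) (3 * j + 1) (Tp (?z(0 := ?n)) ?n [])"
    if "j \<le> ?n" for j
    using that
  proof (induction j)
    case 0
    then show ?case using exec_whF_done[of ?c "Tp (?z(0 := ?n)) ?n []"] rd[of "?z(0 := ?n)" ?n "[]"]
      by (simp del: fun_upd_apply)
  next
    case (Suc j)
    have e: "Suc (?n - Suc j) = ?n - j" using Suc.prems by simp
    have c: "?c (map read_tape (Tp (?z(0 := ?n - Suc j)) (?n - Suc j) []))" unfolding rd using Suc.prems by simp
    have "exec (incF 0) (Tp (?z(0 := ?n - Suc j)) (Suc (?n - Suc j)) []) 1 (Tp (?z(0 := Suc (?n - Suc j))) (Suc (?n - Suc j)) [])"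
      using exec_incF[of 0 "?z(0 := ?n - Suc j)" "Suc (?n - Suc j)" "[]"] K by simp
    then have "exec (seqF inrF (incF 0)) (Tp (?z(0 := ?n - Suc j)) (?n - Suc j) []) (1 + 1) (Tp (?z(0 := ?n - j)) (?n - j) [])"
      unfolding e[symmetric] by (rule exec_seqF[OF exec_inrF])
    from exec_whF_step[of ?c, OF c this Suc.IH[OF Suc_leD[OF Suc.prems]]] show ?case
      by (rule exec_mono) simp
  qed
  have 1: "exec (whF ?c (seqF inrF (incF 0))) (Tp ?z 0 []) (3 * ?n + 1) (Tp (?z(0 := ?n)) ?n [])"
  proof -
    have "?z(0 := 0) = ?z" by auto
    then show ?thesis using 1[of ?n] by (simp del: fun_upd_apply)
  qed
  have 2: "exec (loopF 0 (seqF inlF (incF 1))) (Tp (?z(0 := ?n)) (?n - 0) []) (?n * ((1 + 1) + 2) + 1) (Tp (?z(1 := ?n)) (?n - ?n) [])"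
  proof (rule exec_loopF[where S = "\<lambda>i. ?z(1 := i)" and P = "\<lambda>i. ?n - i" and W = "\<lambda>_. []" and n = ?n])
    fix i assume i: "i < ?n"
    let ?s = "(?z(1 := i))(0 := ?n - Suc i)"
    have "?s(1 := Suc (?s 1)) = (?z(1 := Suc i))(0 := ?n - Suc i)" by (auto simp: fun_eq_iff)
    then have *: "exec (incF 1) (Tp ?s (?n - Suc i) []) 1 (Tp ((?z(1 := Suc i))(0 := ?n - Suc i)) (?n - Suc i) [])"
      using exec_incF[of 1 ?s "?n - Suc i" "[]"] K by auto
    have "?n - i = Suc (?n - Suc i)" using i by simp
    then have "exec inlF (Tp ?s (?n - i) []) 1 (Tp ?s (?n - Suc i) [])"
      using exec_inlF[of ?s "?n - Suc i" "[]"] by argo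
    from exec_seqF[OF this *]
    show "exec (seqF inlF (incF 1)) (Tp ?s (?n - i) []) (1 + 1) (Tp ((?z(1 := Suc i))(0 := ?n - Suc i)) (?n - Suc i) [])" .
  qed (use K in \<open>auto simp: fun_eq_iff\<close>)
  have 2: "exec (loopF 0 (seqF inlF (incF 1))) (Tp (?z(0 := ?n)) ?n []) (?n * 4 + 1) (Tp (?z(1 := ?n)) 0 [])"
    by (rule exec_mono[OF 2[unfolded diff_self_eq_0 diff_zero]]) simp
  have 3: "exec (mv1 1 0) (Tp (?z(1 := ?n)) 0 []) (?n * 3 + 1) (Tp (?z(0 := ?n)) 0 [])"
    by (rule exec_mv1) (use K in \<open>auto simp: fun_eq_iff\<close>)
  show ?thesis unfolding lenF_def
    by (rule exec_mono[OF exec_seqF[OF 1 exec_seqF[OF 2 3]]]) simp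
qed

lemma exec_finF:
  assumes "read_tape R = bit_symbol b"
  shows "exec finF ((c, 0) # R # Ts) 3 (((c(0 := bit_symbol b))(1 := 0), 1) # R # Ts)"
proof -
  have 1: "exec (ifF (\<lambda>ss. sy 1 ss = 2) (actAt 0 (\<lambda>_. (2, Go_Right))) (actAt 0 (\<lambda>_. (1, Go_Right))))
     ((c, 0) # R # Ts) (Suc 1) ((c(0 := bit_symbol b), 1) # R # Ts)"
    by (rule exec_ifF; rule exec_actAt) (use assms in \<open>auto simp: sy_def bit_symbol_def act_tape_def split: if_splits\<close>)
  have 2: "exec (actAt 0 (\<lambda>_. (0, Stay))) ((c(0 := bit_symbol b), 1) # R # Ts) 1 (((c(0 := bit_symbol b))(1 := 0), 1) # R # Ts)"
    by (rule exec_actAt) (auto simp: act_tape_def)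
  show ?thesis unfolding finF_def by (rule exec_mono[OF exec_seqF[OF 1 2]]) simp
qed

text \<open>Of the answer of \<open>M\<close> only the first bit is kept, which for an integer
  program is feasibility; so the answer need not be determined by the input. The length of the
  reduced instance is bounded as well, because the time of \<open>M\<close> is measured in
  it.\<close>

theorem machine_for_reduction:
  assumes M: "wf_tm M"
  obtains M' g where "wf_tm M'" "pb g"
    "\<And>inp. length (sem inp c ((\<lambda>_. 0)(0 := length inp))) \<le> g (length inp)"
    "\<And>inp v T. tm_outputs M (sem inp c ((\<lambda>_. 0)(0 := length inp))) v T \<Longrightarrow> v \<noteq> [] \<Longrightarrow>
       tm_outputs M' inp [hd v] (real (g (length inp)) + T)"
proof -
  define N where "N = max 1 (vbs c)"
  define K where "K = N + wds c + 1"
  define kM where "kM = tm_tapes M"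
  define M' where "M' = \<lparr>tm_tapes = 3 + K + kM, tm_states = fst (mainF M c N K), tm_symbols = tm_symbols M,
    tm_delta = snd (mainF M c N K)\<rparr>"
  define g where "g = (\<lambda>m. (1 + (11 * m + 3) + scost c m + (2 * scost c m + 3)) + 3)"
  have K2: "K \<ge> 2" and N: "N \<ge> 1" unfolding K_def N_def by auto
  have kM: "kM \<ge> 1" using M by (simp add: kM_def wf_tm_def)
  have wf: "wf_tm M'"
  proof -
    have "3 \<le> tm_symbols M" using M by (simp add: wf_tm_def)
    moreover have "2 \<le> fst (mainF M c N K)" by (simp add: mainF_def seqF_def)
    ultimately show ?thesis using wfF_mainF[OF M, of K c N] unfolding wf_tm_def wfF_def M'_def kM_def
      by (auto split: prod.splits)
  qed
  have pb: "pb g" unfolding g_def by (intro pb_intros pb_scost)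
  have le: "length (sem inp c ((\<lambda>_. 0)(0 := length inp))) \<le> scost c (length inp)" for inp
    by (rule length_sem_le[of N]) (auto simp: N_def)
  have len: "length (sem inp c ((\<lambda>_. 0)(0 := length inp))) \<le> g (length inp)" for inp
    using le[of inp] unfolding g_def by simp
  have main: "tm_outputs M' inp [hd v] (real (g (length inp)) + T)"
    if o: "tm_outputs M (sem inp c ((\<lambda>_. 0)(0 := length inp))) v T" and v: "v \<noteq> []" for inp v T
  proof -
    interpret machine inp K kM .
    let ?s = "(\<lambda>_. 0)(0 := length inp) :: nat \<Rightarrow> nat"
    let ?w = "sem inp c ?s"
    let ?m = "length inp"
    let ?Cs = "map (\<lambda>v. ctr (?s v)) [0..<K]"
    let ?Ms = "input_tape ?w # replicate (kM - 1) (\<lambda>_. 0, 0)"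
    obtain n Ms' where n: "real n \<le> T" "(tm_step M ^^ n) (0, ?Ms) = (1, Ms')" and h: "tape_holds (hd Ms') v"
    proof -
      obtain n where n: "real n \<le> T" "case (tm_step M ^^ n) (0, ?Ms) of (q, Ts) \<Rightarrow> q = 1 \<and> tape_holds (hd Ts) v"
        using o unfolding tm_outputs_def tm_init_def kM_def[symmetric] by (elim exE conjE) (rule that)
      obtain q Ms' where r: "(tm_step M ^^ n) (0, ?Ms) = (q, Ms')" by (rule prod.exhaust)
      show thesis by (rule that[OF n(1), of Ms']) (use n(2) in \<open>simp_all only: r prod.case\<close>)
    qed
    obtain n' where n': "n' \<le> n" "run (tm_delta M) 0 ?Ms n' Ms'" using tm_step_run[OF n(2)] by blast
    \<comment> \<open>The initial state is not the halting state; this provides the first step that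
      \<open>run_simM\<close> relies on.\<close>
    have n'0: "n' > 0" using n'(2) by (cases rule: run.cases) auto
    have G3: "3 \<le> tm_symbols M" using M by (simp add: wf_tm_def)
    have "\<exists>R'. read_tape R' = fst (hd Ms') 0 \<and>
      run (snd (simM M K)) 0 (input_tape inp # (\<lambda>_. 0, 0) # (mk, snd (hd ?Ms)) # ?Cs @ ?Ms) n'
       (input_tape inp # R' # (mk, snd (hd Ms')) # ?Cs @ Ms')"
    proof (rule run_simM[OF n'(2) M])
      show "0 < tm_states M" using M by (simp add: wf_tm_def)
      show "length ?Ms = tm_tapes M" using kM by (simp add: kM_def)
      show "fst T i < tm_symbols M" if "T \<in> set ?Ms" for T i
        using that G3 by (auto simp: input_tape_def bit_symbol_def)
      show "length ?Cs = K" by simp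
      show "read_tape (\<lambda>_. 0, 0) = fst (hd ?Ms) 0 \<or> (0 < n' \<and> snd (hd ?Ms) = 0)"
        using n'0 by (simp add: input_tape_def)
    qed
    then obtain R' where R': "read_tape R' = fst (hd Ms') 0" and
      r: "exec (simM M K) (input_tape inp # (\<lambda>_. 0, 0) # (mk, snd (hd ?Ms)) # ?Cs @ ?Ms) n
       (input_tape inp # R' # (mk, snd (hd Ms')) # ?Cs @ Ms')"
      using n'(1) unfolding exec_def by blast
    have rb: "read_tape R' = bit_symbol (hd v)"
      
    proof -
      have "fst (hd Ms') (int 0) = bit_symbol (v ! 0)" using h v unfolding tape_holds_def by blast
      then show ?thesis using v by (simp add: R' hd_conv_nth)
    qed
    have 1: "exec (initF K) (snd (tm_init M' inp)) 1 (Tp (\<lambda>_. 0) 0 [])"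
      using exec_initF[OF kM] by (simp add: tm_init_def M'_def)
    have 2: "exec lenF (Tp (\<lambda>_. 0) 0 []) (11 * ?m + 3) (Tp ?s 0 [])" by (rule exec_lenF[OF K2])
    have 3: "exec (cstm K c N) (Tp ?s 0 []) (scost c ?m) (Tp ?s 0 ([] @ ?w))"
      by (rule exec_cstm[of N]) (use N in \<open>auto simp: N_def K_def\<close>)
    have 4: "exec (rewF (3 + K)) (Tp ?s 0 ?w) (2 * length ?w + 3) ((Tp ?s 0 ?w)[3 + K := input_tape ?w])"
      by (rule exec_rewF) (simp_all add: Tp_out)
    have e: "(Tp ?s 0 ?w)[3 + K := input_tape ?w] = input_tape inp # (\<lambda>_. 0, 0) # (mk, snd (hd ?Ms)) # ?Cs @ ?Ms"
    proof -
      let ?L = "[(fst (input_tape inp), int 0), (\<lambda>_. 0, 0), ctr 0] @ ?Cs"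
      have 1: "Tp ?s 0 ?w = ?L @ (fst (input_tape ?w), int (length ?w)) # replicate (kM - 1) (\<lambda>_. 0, 0)"
        unfolding Tp_def append_assoc ..
      have 2: "3 + K = length ?L" by simp
      have 3: "(fst (input_tape inp), int 0) = input_tape inp" "ctr 0 = (mk, snd (hd ?Ms))"
        by (simp_all add: input_tape_def ctr_def mk_def)
      show ?thesis unfolding 1 2 list_update_length 3 by (simp only: append_Cons append_Nil append_assoc)
    qed
    obtain i0 where i0: "input_tape inp = (i0, 0)" by (simp add: input_tape_def)
    have 5: "exec finF (input_tape inp # R' # (mk, snd (hd Ms')) # ?Cs @ Ms') 3
      (((i0(0 := bit_symbol (hd v)))(1 := 0), 1) # R' # (mk, snd (hd Ms')) # ?Cs @ Ms')"
      unfolding i0 by (rule exec_finF[OF rb])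
    have M'd: "tm_delta M' = snd (mainF M c N K)" by (simp add: M'_def)
    have "exec (mainF M c N K) (snd (tm_init M' inp))
       (1 + ((11 * ?m + 3) + (scost c ?m + ((2 * length ?w + 3) + (n + 3)))))
       (((i0(0 := bit_symbol (hd v)))(1 := 0), 1) # R' # (mk, snd (hd Ms')) # ?Cs @ Ms')"
      unfolding mainF_def
      by (rule exec_seqF[OF 1 exec_seqF[OF 2 exec_seqF[OF 3[unfolded append_Nil] exec_seqF[OF 4[unfolded e] exec_seqF[OF r 5]]]]])
    then obtain k where k: "k \<le> 1 + ((11 * ?m + 3) + (scost c ?m + ((2 * length ?w + 3) + (n + 3))))"
      and rk: "run (tm_delta M') 0 (snd (tm_init M' inp)) k
       (((i0(0 := bit_symbol (hd v)))(1 := 0), 1) # R' # (mk, snd (hd Ms')) # ?Cs @ Ms')"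
      unfolding exec_def M'd[symmetric] by (elim exE conjE) (rule that)
    have "k \<le> g ?m + n" using k le[of inp] unfolding g_def by linarith
    then have "real k \<le> real (g ?m) + T" using n(1) by linarith
    moreover have st: "(tm_step M' ^^ k) (tm_init M' inp) =
        (1, ((i0(0 := bit_symbol (hd v)))(1 := 0), 1) # R' # (mk, snd (hd Ms')) # ?Cs @ Ms')"
    proof -
      have "tm_init M' inp = (0, snd (tm_init M' inp))" by (simp add: tm_init_def)
      then show ?thesis using run_tm_step[OF rk] by argo
    qed
    moreover have "tape_holds ((i0(0 := bit_symbol (hd v)))(1 := 0), 1) [hd v]"
      by (simp add: tape_holds_def)
    ultimately show ?thesis unfolding tm_outputs_def
      by (intro exI[of _ k]) (simp only: st prod.case list.sel simp_thms)
  qed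
  show ?thesis by (rule that[OF wf pb len main])
qed

section \<open>Polynomially many small primes\<close>

lemma Lcm_atLeastAtMost_Suc: "Lcm {1..Suc n} = lcm (Suc n) (Lcm {1..n :: nat})"
  by (simp add: atLeastAtMostSuc_conv)

lemma Lcm_pos: "Lcm {1..n :: nat} > 0"
  by (simp add: Lcm_0_iff_nat neq0_conv[symmetric] del: neq0_conv)

text \<open>The addition rule of Leibniz's harmonic triangle, whose entries are the reciprocals of
  \<open>(m + 1) * (m choose k)\<close>.\<close>

lemma leibniz_triangle:
  assumes "k \<le> m"
  shows "1 / (real (m + 2) * real (Suc m choose k)) + 1 / (real (m + 2) * real (Suc m choose Suc k))
    = 1 / (real (m + 1) * real (m choose k))"
proof -
  let ?b = "real (m choose k)"
  have b: "?b > 0" using assms by simp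
  have "(Suc m - k) * (Suc m choose k) = Suc m * (m choose k)"
    using binomial_absorb_comp[of "Suc m" k] by simp
  then have 1: "real (Suc m - k) * real (Suc m choose k) = real (m + 1) * ?b"
    by (metis Suc_eq_plus1 of_nat_mult)
  have "Suc k * (Suc m choose Suc k) = Suc m * (m choose k)" by (rule Suc_times_binomial)
  then have 2: "real (k + 1) * real (Suc m choose Suc k) = real (m + 1) * ?b"
    by (metis Suc_eq_plus1 of_nat_mult)
  have p: "real (Suc m - k) > 0" "real (k + 1) > 0" "real (m + 1) > 0" using assms by auto
  have e1: "real (Suc m choose k) = real (m + 1) * ?b / real (Suc m - k)" using 1 p by (simp add: field_simps)
  have e2: "real (Suc m choose Suc k) = real (m + 1) * ?b / real (k + 1)" using 2 p by (simp add: field_simps)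
  have s: "real (Suc m - k) + real (k + 1) = real (m + 2)" using assms by simp
  have "1 / (real (m + 2) * real (Suc m choose k)) + 1 / (real (m + 2) * real (Suc m choose Suc k))
    = (real (Suc m - k) + real (k + 1)) / (real (m + 2) * (real (m + 1) * ?b))"
    unfolding e1 e2 by (simp add: add_divide_distrib)
  also have "\<dots> = 1 / (real (m + 1) * ?b)" unfolding s by simp
  finally show ?thesis .
qed

text \<open>The border of the harmonic triangle consists of the \<open>1 / (n + 1)\<close>, and the
  addition rule turns every inner entry into a difference of two entries of the column before. So
  the least common multiple, which clears the denominators on the border, clears them
  everywhere.\<close>

lemma binomial_div_Lcm: "k \<le> n \<Longrightarrow> real (Lcm {1..Suc n}) / (real (Suc n) * real (n choose k)) \<in> \<int>"
proof (induction k arbitrary: n)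
  case 0
  have "Suc n dvd Lcm {1..Suc n}" by (rule dvd_Lcm) simp
  then obtain c where "Lcm {1..Suc n} = Suc n * c" by (elim dvdE)
  then have c: "real (Lcm {1..Suc n}) = real (Suc n) * real c" by (simp only: of_nat_mult)
  have "real (Lcm {1..Suc n}) / (real (Suc n) * real (n choose 0)) = of_nat c"
    unfolding c by (simp del: of_nat_Suc)
  then show ?case by (metis Ints_of_nat)
next
  case (Suc k)
  then obtain m where n: "n = Suc m" and k: "k \<le> m" by (cases n) auto
  let ?L = "real (Lcm {1..Suc n})"
  have 1: "?L / (real (Suc n) * real (n choose k)) \<in> \<int>" using Suc.IH[of n] n k by simp
  have 2: "?L / (real (Suc m) * real (m choose k)) \<in> \<int>"
  proof -
    have "Lcm {1..Suc m} dvd Lcm {1..Suc n}" unfolding n Lcm_atLeastAtMost_Suc[of "Suc m"] by simp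
    then obtain c where "Lcm {1..Suc n} = Lcm {1..Suc m} * c" by (elim dvdE)
    then have "?L / (real (Suc m) * real (m choose k)) = of_nat c * (real (Lcm {1..Suc m}) / (real (Suc m) * real (m choose k)))"
      by simp
    then show ?thesis using Suc.IH[OF k] by (metis Ints_mult Ints_of_nat)
  qed
  have "?L / (real (Suc n) * real (n choose Suc k)) = ?L / (real (Suc m) * real (m choose k)) - ?L / (real (Suc n) * real (n choose k))"
  proof -
    have a: "1 / (real (Suc n) * real (n choose k)) + 1 / (real (Suc n) * real (n choose Suc k)) = 1 / (real (Suc m) * real (m choose k))"
      using leibniz_triangle[OF k] unfolding n by (simp add: add.commute)
    have "?L * (1 / (real (Suc n) * real (n choose Suc k))) =
      ?L * (1 / (real (Suc m) * real (m choose k)) - 1 / (real (Suc n) * real (n choose k)))"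
      using a by (metis add_diff_cancel_left')
    then show ?thesis by (simp only: right_diff_distrib times_divide_eq_right mult_1_right)
  qed
  then show ?case using 1 2 by simp
qed

text \<open>By the central entry of the triangle, \<open>(2 * n + 1) * (2 * n choose n)\<close>
  divides the least common multiple, and the central binomial coefficient is at least
  \<open>4 ^ n / (2 * n)\<close>.\<close>

lemma four_power_le_Lcm:
  assumes "n > 0" shows "4 ^ n \<le> Lcm {1..Suc (2 * n)}"
proof -
  let ?L = "Lcm {1..Suc (2 * n)}" and ?b = "Suc (2 * n) * (2 * n choose n)"
  have b: "?b > 0" by simp
  obtain z where z: "real ?L / (real (Suc (2 * n)) * real (2 * n choose n)) = of_int z"
    using binomial_div_Lcm[of n "2 * n"] by (auto elim: Ints_cases)
  have "real (Suc (2 * n)) * real (2 * n choose n) \<noteq> 0" by simp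
  then have e: "real ?L = of_int z * real ?b" using z unfolding of_nat_mult by (metis nonzero_divide_eq_eq)
  have "z \<ge> 1"
  proof (rule ccontr)
    assume "\<not> z \<ge> 1"
    then have "of_int z * real ?b \<le> 0" by (intro mult_nonpos_nonneg) auto
    then show False using e Lcm_pos[of "Suc (2 * n)"] by linarith
  qed
  then have "1 * real ?b \<le> of_int z * real ?b" by (intro mult_right_mono) auto
  then have "real ?b \<le> real ?L" using e by simp
  then have "?b \<le> ?L" by (simp only: of_nat_le_iff)
  moreover have "4 ^ n \<le> (2 * n choose n) * (2 * n)"
  proof -
    have "real (4 ^ n) / (2 * real n) \<le> real (2 * n choose n)"
      using central_binomial_lower_bound[OF assms] by simp
    then have "real (4 ^ n) \<le> real ((2 * n choose n) * (2 * n))" using assms by (simp add: field_simps)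
    then show ?thesis by (simp only: of_nat_le_iff)
  qed
  ultimately show ?thesis by (simp add: algebra_simps)
qed

section \<open>Counting and enumerating primes\<close>

definition pcount :: "nat \<Rightarrow> nat" where
  "pcount n = (\<Sum>q<n. of_bool (prime q))"

lemma pcount_card: "pcount n = card {p. prime p \<and> p < n}"
proof -
  have "{p. prime p \<and> p < n} = {..<n} \<inter> Collect prime" by auto
  then show ?thesis unfolding pcount_def by (simp add: sum.If_cases of_bool_def)
qed

text \<open>The multiplicity of a prime in a least common multiple is attained by one of the numbers
  up to \<open>n\<close>.\<close>

lemma prime_power_Lcm_le:
  fixes p :: nat
  assumes "prime p"
  shows "n \<ge> 1 \<Longrightarrow> p ^ multiplicity p (Lcm {1..n}) \<le> n"
proof (induction n)
  case (Suc n)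
  show ?case
  proof (cases "n = 0")
    case False
    have a: "p ^ multiplicity p (Suc n) \<le> Suc n"
      by (rule dvd_imp_le[OF multiplicity_dvd]) simp
    have "multiplicity p (Lcm {1..Suc n}) = max (multiplicity p (Suc n)) (multiplicity p (Lcm {1..n}))"
      unfolding Lcm_atLeastAtMost_Suc
      using multiplicity_lcm[of "Suc n" "Lcm {1..n}" p] Lcm_pos[of n] assms by auto
    then show ?thesis using a Suc.IH False by (auto simp: max_def)
  qed simp
qed simp

lemma Lcm_le_power_pcount:
  assumes "n \<ge> 1"
  shows "Lcm {1..n} \<le> n ^ pcount (Suc n)"
proof -
  let ?L = "Lcm {1..n}"
  have "?L = (\<Prod>p\<in>prime_factors ?L. p ^ multiplicity p ?L)"
    using Lcm_pos[of n] prime_factorization_nat by blast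
  also have "\<dots> \<le> (\<Prod>p\<in>prime_factors ?L. n)"
    by (rule prod_mono) (use prime_power_Lcm_le[OF _ assms] in \<open>auto intro: in_prime_factors_imp_prime\<close>)
  also have "\<dots> = n ^ card (prime_factors ?L)" by simp
  also have "\<dots> \<le> n ^ pcount (Suc n)"
  proof (rule power_increasing)
    have "prime_factors ?L \<subseteq> {p. prime p \<and> p < Suc n}"
    proof
      fix p assume p: "p \<in> prime_factors ?L"
      then have pp: "prime p" by (rule in_prime_factors_imp_prime)
      have "multiplicity p ?L > 0" using p by (simp add: prime_factors_multiplicity)
      then have "p ^ 1 \<le> p ^ multiplicity p ?L"
        using prime_gt_0_nat[OF pp] by (intro power_increasing) auto
      then show "p \<in> {p. prime p \<and> p < Suc n}" using prime_power_Lcm_le[OF pp assms] pp by simp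
    qed
    then show "card (prime_factors ?L) \<le> pcount (Suc n)" unfolding pcount_card
      by (intro card_mono) auto
  qed (use assms in simp)
  finally show ?thesis .
qed

lemma two_square_le: "a \<ge> 1 \<Longrightarrow> 2 * a * a + 1 \<le> (4::nat) ^ a"
proof (induction a rule: nat_induct_at_least)
  case (Suc n)
  have "2 * Suc n * Suc n + 1 \<le> 4 * (2 * n * n + 1)"
  proof -
    define q where "q = n * n"
    have "n \<le> q" using Suc.hyps by (simp add: q_def)
    moreover have e: "2 * Suc n * Suc n + 1 = 2 * q + 4 * n + 3" by (simp add: algebra_simps q_def)
    moreover have e': "4 * (2 * n * n + 1) = 8 * q + 4" by (simp add: algebra_simps q_def)
    ultimately show ?thesis using Suc.hyps unfolding e e' by simp
  qed
  also have "\<dots> \<le> 4 ^ Suc n" using Suc.IH by simp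
  finally show ?case .
qed simp

text \<open>With \<open>a = n + 1\<close> and \<open>k\<close> primes up to
  \<open>Yb n = 2 * (a * a) + 1\<close>, the least common multiple is at least
  \<open>4 ^ (a * a)\<close> and at most \<open>Yb n ^ k\<close>, hence at most
  \<open>(4 ^ a) ^ k\<close>. So \<open>k\<close> is at least \<open>a\<close>; a quadratic bound
  makes logarithms avoidable.\<close>

definition Yb :: "nat \<Rightarrow> nat" where
  "Yb n = 2 * (n + 1) * (n + 1) + 1"

lemma pcount_Yb: "n < pcount (Suc (Yb n))"
proof -
  define a where "a = n + 1"
  have a: "a \<ge> 1" unfolding a_def by simp
  have Y: "Yb n = Suc (2 * (a * a))" by (simp add: Yb_def a_def)
  have "(4::nat) ^ (a * a) \<le> Lcm {1..Yb n}" unfolding Y by (rule four_power_le_Lcm) (use a in simp)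
  also have "\<dots> \<le> Yb n ^ pcount (Suc (Yb n))" by (rule Lcm_le_power_pcount) (simp add: Y)
  also have "\<dots> \<le> (4 ^ a) ^ pcount (Suc (Yb n))"
    by (rule power_mono) (use two_square_le[OF a] Y in \<open>simp_all add: mult.assoc\<close>)
  finally have "a * a \<le> a * pcount (Suc (Yb n))" by (simp flip: power_mult)
  then have "a \<le> pcount (Suc (Yb n))" using a by simp
  then show ?thesis unfolding a_def by simp
qed

lemma pcount_mono: "m \<le> n \<Longrightarrow> pcount m \<le> pcount n"
  unfolding pcount_def by (rule sum_mono2) auto

lemma pcount_Suc: "pcount (Suc n) = pcount n + of_bool (prime n)"
  by (simp add: pcount_def)

text \<open>The \<open>k\<close>-th prime, counted from 0: the numbers \<open>i\<close> with at most
  \<open>k\<close> primes up to \<open>i\<close> are exactly those below it. Counting replaces a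
  search because bounded sums are available to the expressions.\<close>

definition nthp :: "nat \<Rightarrow> nat \<Rightarrow> nat" where
  "nthp Y k = (\<Sum>i<Y. of_bool (pcount (Suc i) \<le> k))"

lemma nthp:
  assumes "k < pcount (Suc Y)"
  shows "prime (nthp Y k)" "nthp Y k \<le> Y" "pcount (nthp Y k) = k"
proof -
  define n0 where "n0 = (LEAST i. k < pcount (Suc i))"
  have n0: "k < pcount (Suc n0)" unfolding n0_def by (rule LeastI[of _ Y]) (rule assms)
  have le: "n0 \<le> Y" unfolding n0_def by (rule Least_le) (rule assms)
  have iff: "pcount (Suc i) \<le> k \<longleftrightarrow> i < n0" for i
  proof
    assume "pcount (Suc i) \<le> k"
    show "i < n0"
    proof (rule ccontr)
      assume "\<not> i < n0"
      then have "pcount (Suc n0) \<le> pcount (Suc i)" by (intro pcount_mono) simp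
      then show False using \<open>pcount (Suc i) \<le> k\<close> n0 by simp
    qed
  next
    assume "i < n0"
    then show "pcount (Suc i) \<le> k" unfolding n0_def using not_less_Least[of i "\<lambda>i. k < pcount (Suc i)"] by simp
  qed
  have "{..<Y} \<inter> {i. i < n0} = {..<n0}" using le by auto
  then have e: "nthp Y k = n0" unfolding nthp_def iff by (simp add: of_bool_def sum.If_cases)
  have le_k: "pcount n0 \<le> k"
  proof (cases n0)
    case 0
    then show ?thesis by (simp add: pcount_def)
  next
    case (Suc i)
    then show ?thesis using iff[of i] by simp
  qed
  then have "prime n0" "pcount n0 = k" using n0 by (auto simp: pcount_Suc of_bool_def split: if_splits)
  then show "prime (nthp Y k)" "nthp Y k \<le> Y" "pcount (nthp Y k) = k" using e le by auto
qed

section \<open>Preorder positions in a perfect binary tree\<close>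

text \<open>The nodes of the perfect binary tree of height \<open>h\<close> are \<open>1, \<dots>, 2^h - 1\<close> in inorder; \<open>pre h i\<close> is
  the preorder position of node \<open>i\<close>. On the way down to \<open>i\<close> one passes, for each \<open>P = 2^d\<close> not dividing
  \<open>i\<close>, an ancestor with left subtree of size \<open>P - 1\<close>, which precedes \<open>i\<close> iff bit \<open>d\<close> of \<open>i\<close> is set.\<close>

definition pre :: "nat \<Rightarrow> nat \<Rightarrow> nat" where
  "pre h i = (\<Sum>P<2^h. if 2^h mod P = 0 \<and> i mod P \<noteq> 0 then (if odd (i div P) then P else 1) else 0)"

lemma one_less_two_power: "h \<ge> 1 \<Longrightarrow> (1::nat) < 2 ^ h"
  using one_less_power[of "2::nat" h] by simp

text \<open>The divisors of \<open>2^h\<close> below \<open>2^h\<close> are the smaller powers of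
  two. \<open>pre\<close> selects them by divisibility because the program has \<open>2^h\<close> in
  a variable and can form remainders, while powers would have to be computed anew.\<close>

lemma pre_alt: "pre h i = (\<Sum>d<h. if i mod 2^d \<noteq> 0 then (if odd (i div 2^d) then 2^d else 1) else 0)"
proof -
  let ?f = "\<lambda>P. if i mod P \<noteq> 0 then (if odd (i div P) then P else 1) else (0::nat)"
  have S: "{P. P < 2^h \<and> P dvd (2::nat)^h} = (\<lambda>d. 2^d) ` {..<h}"
  proof (intro equalityI subsetI)
    fix P assume "P \<in> {P. P < 2^h \<and> P dvd (2::nat)^h}"
    then have "P < 2^h" "P dvd 2^h" by auto
    have "prime (2::nat)" by simp
    then obtain d where d: "d \<le> h" "normalize P = 2^d"
      using \<open>P dvd 2^h\<close> by (rule divides_primepow)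
    then have P: "P = 2^d" by simp
    then have "d \<noteq> h" using \<open>P < 2^h\<close> by blast
    then have "d \<in> {..<h}" using d by simp
    then show "P \<in> (\<lambda>d. 2^d) ` {..<h}" unfolding P by (rule imageI)
  qed (auto simp: le_imp_power_dvd)
  have "pre h i = (\<Sum>P\<in>{..<2^h}. if P dvd 2^h then ?f P else 0)"
    unfolding pre_def by (rule sum.cong) (auto simp: mod_eq_0_iff_dvd)
  also have "\<dots> = (\<Sum>P\<in>{P. P < 2^h \<and> P dvd (2::nat)^h}. ?f P)"
    using sum.inter_filter[of "{..<2^h}" ?f "\<lambda>P. P dvd 2^h"] by simp
  also have "\<dots> = (\<Sum>d<h. ?f (2^d))" unfolding S by (subst sum.reindex) (auto simp: inj_on_def)
  finally show ?thesis .
qed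

text \<open>This and the next two lemmas are the recursion of preorder: the root comes at 0, the
  left subtree from 1 on, and the right subtree after the root and the \<open>2^h - 1\<close> nodes
  on the left.\<close>

lemma pre_left: "1 \<le> i \<Longrightarrow> i < 2^h \<Longrightarrow> pre (Suc h) i = Suc (pre h i)"
  unfolding pre_alt by simp

lemma pre_root: "pre (Suc h) (2^h) = 0"
  unfolding pre_alt by (auto simp: le_imp_power_dvd)

lemma pre_right:
  assumes "1 \<le> i" "i < 2^h" shows "pre (Suc h) (2^h + i) = 2^h + pre h i"
proof -
  have "(\<Sum>d<h. if (2^h + i) mod 2^d \<noteq> 0 then (if odd ((2^h + i) div 2^d) then 2^d else 1) else (0::nat))
      = (\<Sum>d<h. if i mod 2^d \<noteq> 0 then (if odd (i div 2^d) then 2^d else 1) else 0)"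
  proof (rule sum.cong[OF refl])
    fix d assume "d \<in> {..<h}"
    then have h: "(2::nat)^h = 2^d * 2^(h - d)" "h - d > 0" by (simp_all flip: power_add)
    have "(2^h + i) mod 2^d = i mod 2^d" unfolding h(1) by simp
    moreover have "(2^h + i) div 2^d = 2^(h-d) + i div 2^d" unfolding h(1) by simp
    moreover have "even ((2::nat)^(h-d))" using h(2) by simp
    ultimately show "(if (2^h + i) mod 2^d \<noteq> 0 then (if odd ((2^h + i) div 2^d) then 2^d else 1) else (0::nat))
        = (if i mod 2^d \<noteq> 0 then (if odd (i div 2^d) then 2^d else 1) else 0)" by simp
  qed
  moreover have "(2^h + i) div 2^h = Suc 0" "(2^h + i) mod 2^h = i" using assms by simp_all
  ultimately show ?thesis unfolding pre_alt using assms by simp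
qed

lemma nat_tree_cases:
  fixes i h :: nat
  assumes "1 \<le> i" "i < 2^Suc h"
  obtains "1 \<le> i" "i < 2^h" | "i = 2^h" | i' where "i = 2^h + i'" "1 \<le> i'" "i' < 2^h"
proof -
  consider "i < 2^h" | "i = 2^h" | "2^h < i" by linarith
  then show ?thesis
  proof cases
    case 3
    then show ?thesis using assms by (intro that(3)[of "i - 2^h"]) auto
  qed (use assms that in auto)
qed

lemma pre_less: "1 \<le> i \<Longrightarrow> i < 2^h \<Longrightarrow> Suc (pre h i) < 2^h"
proof (induction h arbitrary: i)
  case (Suc h)
  from Suc.prems show ?case
  proof (cases rule: nat_tree_cases)
    case 1
    then show ?thesis using Suc.IH[of i] by (simp add: pre_left)
  next
    case 2
    then show ?thesis using pre_root[of h] one_less_two_power[of "Suc h"] by simp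
  next
    case (3 i')
    then show ?thesis using Suc.IH[of i'] by (simp add: pre_right)
  qed
qed simp

lemma pre_inj: "1 \<le> i \<Longrightarrow> i < 2^h \<Longrightarrow> 1 \<le> i' \<Longrightarrow> i' < 2^h \<Longrightarrow> pre h i = pre h i' \<Longrightarrow> i = i'"
proof (induction h arbitrary: i i')
  case (Suc h)
  note b = pre_less[of _ h]
  from Suc.prems(1,2) show ?case
  proof (cases rule: nat_tree_cases)
    case 1
    note i = 1
    from Suc.prems(3,4) show ?thesis
    proof (cases rule: nat_tree_cases)
      case 1
      then show ?thesis using i Suc.prems(5) Suc.IH by (simp add: pre_left)
    next
      case 2
      then show ?thesis using i Suc.prems(5) by (simp add: pre_left pre_root)
    next
      case (3 k)
      then show ?thesis using i Suc.prems(5) b[of i] by (simp add: pre_left pre_right)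
    qed
  next
    case 2
    note i = 2
    from Suc.prems(3,4) show ?thesis
    proof (cases rule: nat_tree_cases)
      case 1
      then show ?thesis using i Suc.prems(5) by (simp add: pre_left pre_root)
    next
      case 2
      then show ?thesis using i by simp
    next
      case (3 k)
      then show ?thesis using i Suc.prems(5) by (simp add: pre_root pre_right)
    qed
  next
    case (3 k')
    note i = 3
    from Suc.prems(3,4) show ?thesis
    proof (cases rule: nat_tree_cases)
      case 1
      then show ?thesis using i Suc.prems(5) b[of i'] by (simp add: pre_left pre_right)
    next
      case 2
      then show ?thesis using i Suc.prems(5) by (simp add: pre_root pre_right)
    next
      case (3 k)
      then show ?thesis using i Suc.prems(5) Suc.IH[of k' k] by (simp add: pre_right)
    qed
  qed
qed simp

lemma pre_bij: "bij_betw (pre h) {1..<2^h} {..<2^h - 1}"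
proof -
  have inj: "inj_on (pre h) {1..<2^h}" by (rule inj_onI) (auto intro: pre_inj)
  have "pre h ` {1..<2^h} \<subseteq> {..<2^h - 1}" using pre_less[of _ h] by force
  moreover have "card (pre h ` {1..<2^h}) = card {..<(2::nat)^h - 1}" using card_image[OF inj] by simp
  ultimately have "pre h ` {1..<2^h} = {..<2^h - 1}" by (intro card_subset_eq) auto
  then show ?thesis using inj by (simp add: bij_betw_def)
qed

section \<open>Block-diagonal matrices with blocks of equal size\<close>

lemma diag_block_mat_equal_blocks:
  assumes "\<And>k. k < n \<Longrightarrow> B k \<in> carrier_mat r c" "r > 0" "c > 0"
  shows "diag_block_mat (map B [0..<n]) = mat (n * r) (n * c)
    (\<lambda>(i, j). if i div r = j div c then B (i div r) $$ (i mod r, j mod c) else 0)"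
  using assms(1)
proof (induction n)
  case 0
  then show ?case by (intro eq_matI) auto
next
  case (Suc n)
  let ?M = "mat (n * r) (n * c) (\<lambda>(i, j). if i div r = j div c then B (i div r) $$ (i mod r, j mod c) else 0)"
  have IH: "diag_block_mat (map B [0..<n]) = ?M" using Suc by simp
  have Bn: "B n \<in> carrier_mat r c" using Suc.prems by simp
  have "diag_block_mat (map B [0..<Suc n]) =
     four_block_mat ?M (0\<^sub>m (n * r) c) (0\<^sub>m r (n * c)) (B n)"
    using Bn by (simp add: diag_block_mat_last IH Let_def)
  also have "\<dots> = mat (Suc n * r) (Suc n * c)
    (\<lambda>(i, j). if i div r = j div c then B (i div r) $$ (i mod r, j mod c) else 0)" (is "?l = ?r")
  proof (rule eq_matI)
    show "dim_row ?l = dim_row ?r" "dim_col ?l = dim_col ?r" using Bn by auto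
    fix i j assume "i < dim_row ?r" "j < dim_col ?r"
    then have ij: "i < r + n * r" "j < c + n * c" by auto
    have d: "i div r < n" if "i < n * r" for i using that by (simp add: less_mult_imp_div_less)
    have dc: "j div c < n" if "j < n * c" for j using that by (simp add: less_mult_imp_div_less)
    have e: "i div r = n \<and> i mod r = i - n * r" if "\<not> i < n * r"
    proof -
      have "i = n * r + (i - n * r)" "i - n * r < r" using that ij by auto
      then show ?thesis by (metis add_diff_cancel_left' assms(2) div_less div_mult_self3 mod_div_mult_eq mod_less mod_mult_self3 mult.commute add.commute add_0 less_not_refl)
    qed
    have ec: "j div c = n \<and> j mod c = j - n * c" if "\<not> j < n * c"
    proof -
      have "j = n * c + (j - n * c)" "j - n * c < c" using that ij by auto
      then show ?thesis by (metis add_diff_cancel_left' assms(3) div_less div_mult_self3 mod_div_mult_eq mod_less mod_mult_self3 mult.commute add.commute add_0 less_not_refl)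
    qed
    show "?l $$ (i, j) = ?r $$ (i, j)"
      using ij Bn d[of i] dc[of j] e ec by (cases "i < n * r"; cases "j < n * c") auto
  qed
  finally show ?case .
qed


section \<open>The matrix of a chain, eliminated along a balanced tree\<close>

text \<open>There are no nodes 0 and \<open>2^h\<close>, and they are never hit; so the equations at
  the two ends of the chain lose a neighbour without a case distinction.\<close>

definition hit :: "nat \<Rightarrow> nat \<Rightarrow> nat \<Rightarrow> bool" where
  "hit h pos i \<longleftrightarrow> 1 \<le> i \<and> i < 2^h \<and> pos = pre h i"

lemma div_mod_eq_iff: "q < w \<Longrightarrow> x mod w = q \<and> x div w = k \<longleftrightarrow> x = k * w + (q :: nat)"
  by (metis add.commute add.right_neutral div_less div_mult_mod_eq div_mult_self3 less_nat_zero_code mod_less mod_mult_self3)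

text \<open>Once the root at position 0 is removed, the quotient by \<open>2^h - 1\<close> tells the
  subtree and the remainder the position in it. The root itself reduces to node 0 of the right half,
  which is never hit.\<close>

lemma hit_Suc:
  assumes "i < 2^Suc h"
  shows "hit (Suc h) (Suc p) i \<longleftrightarrow> hit h (p mod (2^h - 1)) (i mod 2^h) \<and> p div (2^h - 1) = i div 2^h"
proof (cases "i = 0")
  case False
  then have "1 \<le> i" by simp
  from this assms show ?thesis
  proof (cases rule: nat_tree_cases)
    case 1
    then show ?thesis using pre_less[of i h] div_mod_eq_iff[of "pre h i" "2^h - 1" p 0]
      by (auto simp: hit_def pre_left)
  next
    case 2
    then show ?thesis by (simp add: hit_def pre_root)
  next
    case (3 k)
    then have i: "i mod 2^h = k" "i div 2^h = 1" by simp_all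
    have l: "pre h k < 2^h - 1" using pre_less[of k h] 3 by simp
    have "hit (Suc h) (Suc p) i \<longleftrightarrow> p = 1 * (2^h - 1) + pre h k"
      using 3 l by (auto simp: hit_def pre_right)
    then show ?thesis using div_mod_eq_iff[OF l, of p 1] 3 unfolding i by (auto simp: hit_def)
  qed
qed (simp add: hit_def)

lemma digit_div: "k < w \<Longrightarrow> (x * w + k) div w = (x :: nat)"
  and digit_mod: "k < w \<Longrightarrow> (x * w + k) mod w = (k :: nat)"
  by simp_all

text \<open>Already transposed: rows are variables, two for each node in preorder, and columns are
  equations, two for each edge \<open>e\<close> joining the nodes \<open>e\<close> and
  \<open>e + 1\<close>. \<open>FA\<close> gives the coefficients of the left end of an edge and
  \<open>FB\<close> those of the right end. The offset \<open>lo\<close> lets a subtree refer to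
  edges by their number in the whole chain.\<close>

definition tblock :: "(nat \<Rightarrow> nat \<Rightarrow> nat \<Rightarrow> int) \<Rightarrow> (nat \<Rightarrow> nat \<Rightarrow> nat \<Rightarrow> int) \<Rightarrow> nat \<Rightarrow> nat \<Rightarrow> int mat" where
  "tblock FA FB h lo = mat ((2^h - 1) * 2) (2^h * 2) (\<lambda>(c, r).
     if hit h (c div 2) (r div 2) then FA (lo + r div 2) (r mod 2) (c mod 2)
     else if hit h (c div 2) (Suc (r div 2)) then FB (lo + r div 2) (r mod 2) (c mod 2) else 0)"

text \<open>For the right end of an edge, \<open>e + 1\<close> may leave the subtree of
  \<open>e\<close>. It is then the deleted root or the end of the chain, and on the other side the
  nonexistent node \<open>2^h\<close>.\<close>

lemma hit_Suc_Suc: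
  assumes "e < 2^Suc h"
  shows "hit (Suc h) (Suc p) (Suc e) \<longleftrightarrow>
    hit h (p mod (2^h - 1)) (Suc (e mod 2^h)) \<and> p div (2^h - 1) = e div 2^h"
proof (cases "Suc (e mod 2^h) < 2^h")
  case True
  then have m: "Suc e mod 2^h = Suc (e mod 2^h)" by (simp add: mod_Suc)
  have d: "Suc e div 2^h = e div 2^h" using True by (simp add: div_Suc mod_Suc)
  have "e div 2^h < 2" using assms by (simp add: less_mult_imp_div_less)
  then have "e div 2^h * 2^h + 2^h \<le> 2^Suc h"
    by (metis Suc_leI add.commute mult_Suc mult_le_mono1 power_Suc)
  then have "Suc e < 2^Suc h" using True by (metis (no_types) add_Suc_right add_less_cancel_left div_mult_mod_eq less_le_trans)
  from hit_Suc[OF this, of p] show ?thesis unfolding m d .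
next
  case False
  have "e mod 2^h < 2^h" by simp
  then have "Suc (e mod 2^h) = 2^h" using False by linarith
  then have m: "Suc e mod 2^h = 0" by (simp add: mod_Suc)
  have "\<not> hit (Suc h) (Suc p) (Suc e)"
  proof (cases "Suc e < 2^Suc h")
    case True
    from hit_Suc[OF this, of p] show ?thesis unfolding m by (simp add: hit_def)
  qed (simp add: hit_def)
  then show ?thesis using False by (simp add: hit_def)
qed

text \<open>The first two rows belong to the middle node. Without it the edges below
  \<open>2^h\<close> meet only nodes on the left and the others only nodes on the right.\<close>

lemma tree_fold_tblock: "h \<ge> 1 \<Longrightarrow> tree_fold (replicate h 2) (tblock FA FB h lo)"
proof (induction h arbitrary: lo)
  case (Suc h)
  show ?case
  proof (cases "h = 0")
    case True
    then show ?thesis by (simp add: tblock_def)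
  next
    case False
    then obtain h' where h': "h = Suc h'" by (cases h) auto
    have H: "(2::nat)^h > 1" using False one_less_two_power[of h] by simp
    let ?r = "(2^h - 1) * 2 :: nat" and ?c = "2^h * 2 :: nat"
    let ?B = "\<lambda>k. tblock FA FB h (lo + k * 2^h)"
    have car: "?B k \<in> carrier_mat ?r ?c" for k by (simp add: tblock_def)
    have "delete_rows 2 (tblock FA FB (Suc h) lo) = diag_block_mat (map ?B [0..<2])" (is "?l = _")
    proof -
      have "diag_block_mat (map ?B [0..<2]) = mat (2 * ?r) (2 * ?c)
        (\<lambda>(i, j). if i div ?r = j div ?c then ?B (i div ?r) $$ (i mod ?r, j mod ?c) else 0)" (is "_ = ?m")
        by (rule diag_block_mat_equal_blocks) (use car H in auto)
      moreover have "?l = ?m"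
      proof (rule eq_matI)
        show "dim_row ?l = dim_row ?m" "dim_col ?l = dim_col ?m"
          by (simp_all add: delete_rows_def tblock_def)
        fix i j assume "i < dim_row ?m" "j < dim_col ?m"
        then have ij: "i < 2 * ?r" "j < 2 * ?c" by auto
        let ?p = "i div 2" and ?e = "j div 2"
        have e: "?e < 2^Suc h" using ij by auto
        have di: "i div ?r = ?p div (2^h - 1)" "j div ?c = ?e div 2^h"
          by (metis div_mult2_eq mult.commute)+
        have mi: "i mod ?r div 2 = ?p mod (2^h - 1)" "i mod ?r mod 2 = i mod 2"
          "j mod ?c div 2 = ?e mod 2^h" "j mod ?c mod 2 = j mod 2"
          by (simp_all add: mod_mult2_eq mult.commute[of _ 2])
        have lt: "i mod ?r < ?r" "j mod ?c < ?c" using H by simp_all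
        have loe: "lo + ?e div 2^h * 2^h + ?e mod 2^h = lo + ?e" by (simp only: add.assoc div_mult_mod_eq)
        have "?l $$ (i, j) = (if hit (Suc h) (Suc ?p) ?e then FA (lo + ?e) (j mod 2) (i mod 2)
          else if hit (Suc h) (Suc ?p) (Suc ?e) then FB (lo + ?e) (j mod 2) (i mod 2) else 0)"
          using ij by (simp add: delete_rows_def tblock_def)
        also have "\<dots> = ?m $$ (i, j)"
          unfolding hit_Suc[OF e] hit_Suc_Suc[OF e]
          using ij lt by (simp add: di tblock_def mi loe del: One_nat_def)
        finally show "?l $$ (i, j) = ?m $$ (i, j)" .
      qed
      ultimately show ?thesis by simp
    qed
    moreover have "\<forall>B\<in>set (map ?B [0..<2]). tree_fold (2 # replicate h' 2) B"
      using Suc.IH h' by auto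
    moreover have "2 \<le> dim_row (tblock FA FB (Suc h) lo)" using H by (simp add: tblock_def)
    moreover have "map ?B [0..<2] \<noteq> []" by simp
    ultimately have "tree_fold (2 # 2 # replicate h' 2) (tblock FA FB (Suc h) lo)"
      unfolding tree_fold.simps by (intro conjI exI[of _ "map ?B [0..<2]"]) simp_all
    then show ?thesis by (simp add: h')
  qed
qed simp

section \<open>The integer program for simultaneous incongruences\<close>

text \<open>Node \<open>e\<close> as left end of its edge: the equations are
  \<open>y' - 2 * y = 0\<close> for \<open>k = 0\<close> and \<open>z' - z - digit * y = 0\<close>
  for \<open>k = 1\<close>, where \<open>a = 0\<close> stands for \<open>y\<close>,
  \<open>a = 1\<close> for \<open>z\<close>, and the digit of the modulus is number
  \<open>e - 1\<close>. The last edge has no \<open>y'\<close>; keeping its doubling equation would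
  force \<open>y = 0\<close>.\<close>

definition cA :: "nat \<Rightarrow> (nat \<Rightarrow> nat) \<Rightarrow> nat \<Rightarrow> nat \<Rightarrow> nat \<Rightarrow> nat \<Rightarrow> int" where
  "cA h md j e k a = (if k = 0 then (if a = 0 \<and> Suc e < 2^h then -2 else 0)
     else if a = 0 then - int (md j div 2^(e - 1) mod 2) else -1)"

text \<open>Edge 0 has no left end; its equations are emptied, so that the chain starts with free
  values at node 1.\<close>

definition cB :: "nat \<Rightarrow> nat \<Rightarrow> nat \<Rightarrow> int" where
  "cB e k a = (if 1 \<le> e \<and> a = k then 1 else 0)"

definition cell :: "nat \<Rightarrow> (nat \<Rightarrow> nat) \<Rightarrow> nat \<Rightarrow> nat \<Rightarrow> nat \<Rightarrow> nat \<Rightarrow> nat \<Rightarrow> int" where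
  "cell h md j e k pos a = (if hit h pos e then cA h md j e k a
     else if hit h pos (Suc e) then cB e k a else 0)"

text \<open>In the last equation for \<open>z\<close> the common variable \<open>x\<close> takes the
  place of the missing \<open>z'\<close>.\<close>

definition glob :: "nat \<Rightarrow> nat \<Rightarrow> nat \<Rightarrow> int" where
  "glob h e k = (if k = 1 \<and> Suc e = 2^h then 1 else 0)"

definition Aentry :: "nat \<Rightarrow> (nat \<Rightarrow> nat) \<Rightarrow> nat \<Rightarrow> nat \<Rightarrow> int" where
  "Aentry h md r c = (if c = 0 then glob h (r div 2 mod 2^h) (r mod 2)
     else if r div 2 div 2^h = (c - 1) div 2 div (2^h - 1)
     then cell h md (r div 2 div 2^h) (r div 2 mod 2^h) (r mod 2) ((c - 1) div 2 mod (2^h - 1)) ((c - 1) mod 2)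
     else 0)"

definition Amat :: "nat \<Rightarrow> nat \<Rightarrow> (nat \<Rightarrow> nat) \<Rightarrow> int mat" where
  "Amat h J md = mat (J * (2^h * 2)) (1 + J * ((2^h - 1) * 2)) (\<lambda>(r, c). Aentry h md r c)"

text \<open>The first row of the transpose is that of \<open>x\<close>, the only variable shared by
  the blocks.\<close>

lemma multi_stage_Amat:
  assumes h: "h \<ge> 1" and J: "J \<ge> 1"
  shows "multi_stage (1 # replicate h 2) (Amat h J md)"
proof -
  obtain h' where h': "h = Suc h'" using h by (cases h) auto
  have H: "(2::nat)^h > 1" using one_less_two_power[OF h] .
  let ?r = "(2^h - 1) * 2 :: nat" and ?c = "2^h * 2 :: nat"
  let ?B = "\<lambda>j. tblock (cA h md j) cB h 0"
  let ?AT = "transpose_mat (Amat h J md)"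
  have car: "?B k \<in> carrier_mat ?r ?c" for k by (simp add: tblock_def)
  have D: "diag_block_mat (map ?B [0..<J]) = mat (J * ?r) (J * ?c)
        (\<lambda>(i, j). if i div ?r = j div ?c then ?B (i div ?r) $$ (i mod ?r, j mod ?c) else 0)" (is "_ = ?m")
    by (rule diag_block_mat_equal_blocks) (use car H in auto)
  have "delete_rows 1 ?AT = ?m" (is "?l = _")
  proof (rule eq_matI)
    show "dim_row ?l = dim_row ?m" "dim_col ?l = dim_col ?m"
      by (simp_all add: delete_rows_def Amat_def)
    fix i j assume "i < dim_row ?m" "j < dim_col ?m"
    then have ij: "i < J * ?r" "j < J * ?c" by auto
    let ?p = "i div 2" and ?e = "j div 2"
    have di: "i div ?r = ?p div (2^h - 1)" "j div ?c = ?e div 2^h"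
      by (metis div_mult2_eq mult.commute)+
    have mi: "i mod ?r div 2 = ?p mod (2^h - 1)" "i mod ?r mod 2 = i mod 2"
      "j mod ?c div 2 = ?e mod 2^h" "j mod ?c mod 2 = j mod 2"
      by (simp_all add: mod_mult2_eq mult.commute[of _ 2])
    have lt: "i mod ?r < ?r" "j mod ?c < ?c" using H by simp_all
    have "?l $$ (i, j) = Aentry h md j (Suc i)"
      using ij by (simp add: delete_rows_def Amat_def)
    also have "\<dots> = ?m $$ (i, j)"
      using ij lt by (simp add: di tblock_def mi Aentry_def cell_def del: One_nat_def)
    finally show "?l $$ (i, j) = ?m $$ (i, j)" .
  qed
  then have "delete_rows 1 ?AT = diag_block_mat (map ?B [0..<J])" using D by simp
  moreover have "\<forall>B\<in>set (map ?B [0..<J]). tree_fold (2 # replicate h' 2) B"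
    using tree_fold_tblock[OF h] h' by auto
  moreover have "map ?B [0..<J] \<noteq> []" using J by simp
  moreover have "1 \<le> dim_row ?AT" by (simp add: Amat_def)
  ultimately have "tree_fold (1 # 2 # replicate h' 2) ?AT"
    unfolding tree_fold.simps by (intro conjI exI[of _ "map ?B [0..<J]"]) simp_all
  then show ?thesis by (simp add: multi_stage_def h')
qed

lemma sum_lessThan_mult: "(\<Sum>c<a * b. f c) = (\<Sum>i<a. \<Sum>k<b. f (i * b + k :: nat) :: 'a :: comm_monoid_add)"
proof (induction a)
  case (Suc a)
  have "(\<Sum>c<Suc a * b. f c) = (\<Sum>c<a * b. f c) + (\<Sum>c\<in>{a * b..<a * b + b}. f c)"
    by (subst sum.union_disjoint[symmetric]) (auto intro!: sum.cong)
  also have "(\<Sum>c\<in>{a * b..<a * b + b}. f c) = (\<Sum>k<b. f (a * b + k))"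
    by (rule sum.reindex_bij_witness[of _ "\<lambda>k. a * b + k" "\<lambda>c. c - a * b"]) auto
  finally show ?case using Suc by simp
qed simp

definition cpos :: "nat \<Rightarrow> nat \<Rightarrow> nat \<Rightarrow> nat \<Rightarrow> nat" where
  "cpos h j i a = Suc ((j * (2^h - 1) + pre h i) * 2 + a)"

lemma sum_hit:
  assumes "h \<ge> 1"
  shows "(\<Sum>pos<2^h - 1. if hit h pos i then f pos else 0) = (if 1 \<le> i \<and> i < 2^h then f (pre h i) else (0::int))"
proof (cases "1 \<le> i \<and> i < 2^h")
  case True
  then have "pre h i < 2^h - 1" using pre_less[of i h] by simp
  moreover have "hit h pos i \<longleftrightarrow> pos = pre h i" for pos using True by (simp add: hit_def)
  ultimately show ?thesis using True by (simp add: sum.delta)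
next
  case False
  then show ?thesis by (auto simp: hit_def)
qed

lemma hit_unique: "hit h pos i \<Longrightarrow> hit h pos i' \<Longrightarrow> i = i'"
  unfolding hit_def using pre_inj by metis

text \<open>The sum over a row collapses: inside block \<open>j\<close> only the positions of the
  nodes \<open>e\<close> and \<open>e + 1\<close> are hit, and these differ because
  \<open>pre\<close> is injective.\<close>

lemma Amat_mult_vec:
  assumes h: "h \<ge> 1" and x: "x \<in> carrier_vec (1 + J * ((2^h - 1) * 2))"
    and j: "j < J" and e: "e < 2^h" and k: "k < 2"
  shows "(Amat h J md *\<^sub>v x) $ ((j * 2^h + e) * 2 + k) = glob h e k * x $ 0 +
     (if 1 \<le> e then \<Sum>a<2. cA h md j e k a * x $ cpos h j e a else 0) +
     (if Suc e < 2^h then \<Sum>a<2. cB e k a * x $ cpos h j (Suc e) a else 0)"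
proof -
  let ?r = "(j * 2^h + e) * 2 + k" and ?W = "2^h - 1 :: nat"
  let ?x = "\<lambda>j pos a. x $ Suc ((j * ?W + pos) * 2 + a)"
  have H: "(2::nat)^h > 1" using one_less_two_power[OF h] .
  then have W: "?W > 0" by simp
  have r: "?r div 2 mod 2^h = e" "?r div 2 div 2^h = j" "?r mod 2 = k" using e k by (simp_all only: digit_div digit_mod)
  have "j * 2^h + e < J * 2^h"
  proof -
    have "j * 2^h + e < Suc j * 2^h" using e by simp
    also have "\<dots> \<le> J * 2^h" using j by (intro mult_le_mono1) simp
    finally show ?thesis .
  qed
  then have rlt: "?r < J * (2^h * 2)" using k by simp
  have "(Amat h J md *\<^sub>v x) $ ?r = (\<Sum>c<Suc (J * (?W * 2)). Aentry h md ?r c * x $ c)"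
    using rlt x by (simp add: Amat_def scalar_prod_def atLeast0LessThan del: sum.lessThan_Suc)
  also have "\<dots> = glob h e k * x $ 0 + (\<Sum>c<J * (?W * 2). Aentry h md ?r (Suc c) * x $ Suc c)"
  proof -
    have "Aentry h md ?r 0 = glob h e k" unfolding Aentry_def r by simp
    then show ?thesis unfolding sum.lessThan_Suc_shift by simp
  qed
  also have "(\<Sum>c<J * (?W * 2). Aentry h md ?r (Suc c) * x $ Suc c)
    = (\<Sum>c<(J * ?W) * 2. Aentry h md ?r (Suc c) * x $ Suc c)" by (simp only: mult.assoc)
  also have "\<dots> = (\<Sum>j'<J. \<Sum>pos<?W. \<Sum>a<2. Aentry h md ?r (Suc ((j' * ?W + pos) * 2 + a)) * ?x j' pos a)"
    unfolding sum_lessThan_mult ..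
  also have "\<dots> = (\<Sum>j'<J. \<Sum>pos<?W. \<Sum>a<2. (if j = j' then cell h md j e k pos a else 0) * ?x j' pos a)"
  proof (intro sum.cong refl)
    fix j' pos a assume "pos \<in> {..<?W}" "a \<in> {..<2::nat}"
    then have "((j' * ?W + pos) * 2 + a) div 2 mod ?W = pos" "((j' * ?W + pos) * 2 + a) div 2 div ?W = j'"
      "((j' * ?W + pos) * 2 + a) mod 2 = a" by (simp_all only: digit_div digit_mod lessThan_iff)
    then show "Aentry h md ?r (Suc ((j' * ?W + pos) * 2 + a)) * ?x j' pos a
      = (if j = j' then cell h md j e k pos a else 0) * ?x j' pos a"
      unfolding Aentry_def r by simp
  qed
  also have "\<dots> = (\<Sum>j'<J. if j = j' then \<Sum>pos<?W. \<Sum>a<2. cell h md j e k pos a * ?x j' pos a else 0)"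
    by (intro sum.cong refl) simp
  also have "\<dots> = (\<Sum>pos<?W. \<Sum>a<2. cell h md j e k pos a * ?x j pos a)"
    using j by (simp add: sum.delta)
  also have "\<dots> = (\<Sum>pos<?W. (if hit h pos e then \<Sum>a<2. cA h md j e k a * ?x j pos a else 0) +
      (if hit h pos (Suc e) then \<Sum>a<2. cB e k a * ?x j pos a else 0))"
  proof (rule sum.cong[OF refl])
    fix pos
    have "\<not> (hit h pos e \<and> hit h pos (Suc e))" using hit_unique[of h pos e "Suc e"] by auto
    then show "(\<Sum>a<2. cell h md j e k pos a * ?x j pos a) = (if hit h pos e then \<Sum>a<2. cA h md j e k a * ?x j pos a else 0) +
      (if hit h pos (Suc e) then \<Sum>a<2. cB e k a * ?x j pos a else 0)"
      unfolding cell_def by auto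
  qed
  also have "\<dots> = (if 1 \<le> e \<and> e < 2^h then \<Sum>a<2. cA h md j e k a * ?x j (pre h e) a else 0) +
      (if 1 \<le> Suc e \<and> Suc e < 2^h then \<Sum>a<2. cB e k a * ?x j (pre h (Suc e)) a else 0)"
    unfolding sum.distrib sum_hit[OF h] ..
  finally show ?thesis using e by (simp add: cpos_def)
qed

lemma sum_lessThan_2: "(\<Sum>a<2. f a) = f 0 + f (1::nat)"
  by (simp add: numeral_2_eq_2)

text \<open>Edge 0 contributes only \<open>0 = 0\<close>, hence the range
  \<open>1 \<le> e\<close>.\<close>

lemma Amat_solution_iff:
  assumes h: "h \<ge> 1" and x: "x \<in> carrier_vec (1 + J * ((2^h - 1) * 2))"
  shows "Amat h J md *\<^sub>v x = 0\<^sub>v (J * (2^h * 2)) \<longleftrightarrow>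
    (\<forall>j<J. \<forall>e. 1 \<le> e \<and> e < 2^h \<longrightarrow>
      (Suc e < 2^h \<longrightarrow> x $ cpos h j (Suc e) 0 = 2 * x $ cpos h j e 0) \<and>
      (if Suc e < 2^h then x $ cpos h j (Suc e) 1 else x $ 0)
        = x $ cpos h j e 1 + int (md j div 2^(e - 1) mod 2) * x $ cpos h j e 0)" (is "?L \<longleftrightarrow> ?R")
proof -
  let ?v = "Amat h J md *\<^sub>v x"
  have "?L \<longleftrightarrow> (\<forall>r<J * (2^h * 2). ?v $ r = 0)"
    by (auto simp: vec_eq_iff Amat_def)
  also have "\<dots> \<longleftrightarrow> (\<forall>j<J. \<forall>e<2^h. \<forall>k<2. ?v $ ((j * 2^h + e) * 2 + k) = 0)"
  proof (intro iffI allI impI)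
    fix j e k :: nat assume *: "\<forall>r<J * (2^h * 2). ?v $ r = 0" and "j < J" "e < 2^h" "k < (2::nat)"
    have "j * 2^h + e < Suc j * 2^h" using \<open>e < 2^h\<close> by simp
    also have "\<dots> \<le> J * 2^h" using \<open>j < J\<close> by (intro mult_le_mono1) simp
    finally have "(j * 2^h + e) * 2 + k < J * (2^h * 2)" using \<open>k < 2\<close> by simp
    then show "?v $ ((j * 2^h + e) * 2 + k) = 0" using * by blast
  next
    fix r assume *: "\<forall>j<J. \<forall>e<2^h. \<forall>k<2. ?v $ ((j * 2^h + e) * 2 + k) = 0" and r: "r < J * (2^h * 2)"
    have "r div 2 div 2^h < J" using r by (simp add: less_mult_imp_div_less mult.commute mult.left_commute flip: div_mult2_eq)
    moreover have "r div 2 mod 2^h < 2^h" "r mod 2 < 2" by simp_all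
    ultimately have "?v $ ((r div 2 div 2^h * 2^h + r div 2 mod 2^h) * 2 + r mod 2) = 0" using * by blast
    then show "?v $ r = 0" by (simp only: div_mult_mod_eq)
  qed
  also have "\<dots> \<longleftrightarrow> (\<forall>j<J. \<forall>e<2^h. ?v $ ((j * 2^h + e) * 2 + 0) = 0 \<and> ?v $ ((j * 2^h + e) * 2 + 1) = 0)"
  proof -
    have "(\<forall>k<2. P k) \<longleftrightarrow> P 0 \<and> P (1::nat)" for P by (auto simp: less_2_cases_iff)
    then show ?thesis by simp
  qed
  also have "\<dots> \<longleftrightarrow> ?R"
  proof (intro all_cong)
    fix j assume j: "j < J"
    have 0: "?v $ ((j * 2^h + (e::nat)) * 2 + 0) = (if 1 \<le> e \<and> Suc e < 2^h then x $ cpos h j (Suc e) 0 - 2 * x $ cpos h j e 0 else 0)"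
      if "e < 2^h" for e
      unfolding Amat_mult_vec[OF h x j that zero_less_numeral] sum_lessThan_2
      by (simp add: glob_def cA_def cB_def)
    have 1: "?v $ ((j * 2^h + (e::nat)) * 2 + 1) = (if 1 \<le> e then (if Suc e < 2^h then x $ cpos h j (Suc e) 1 else x $ 0)
        - x $ cpos h j e 1 - int (md j div 2^(e - 1) mod 2) * x $ cpos h j e 0 else 0)"
      if e: "e < 2^h" for e
    proof -
      have "(1::nat) < 2" by simp
      \<comment> \<open>An edge cannot be first and last at once, since \<open>h \<ge> 1\<close>
        provides a node.\<close>
      have "Suc 0 \<noteq> 2^h" using one_less_two_power[OF h] by simp
      moreover have "Suc e = 2^h \<or> Suc e < 2^h" using e by linarith
      ultimately consider "Suc e = 2^h" "1 \<le> e" "\<not> Suc e < 2^h" | "Suc e < 2^h" "1 \<le> e" | "Suc e < 2^h" "e = 0" by force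
      then show ?thesis
        unfolding Amat_mult_vec[OF h x j e \<open>1 < 2\<close>] sum_lessThan_2
        by cases (simp_all add: glob_def cA_def cB_def)
    qed
    have "(\<forall>e<2^h. ?v $ ((j * 2^h + e) * 2 + 0) = 0 \<and> ?v $ ((j * 2^h + e) * 2 + 1) = 0) \<longleftrightarrow>
      (\<forall>e<2^h. (1 \<le> e \<and> Suc e < 2^h \<longrightarrow> x $ cpos h j (Suc e) 0 - 2 * x $ cpos h j e 0 = 0) \<and>
        (1 \<le> e \<longrightarrow> (if Suc e < 2^h then x $ cpos h j (Suc e) 1 else x $ 0)
        - x $ cpos h j e 1 - int (md j div 2^(e - 1) mod 2) * x $ cpos h j e 0 = 0))"
    proof (intro all_cong)
      fix e :: nat assume e: "e < 2^h"
      have z: "(if c then A else (0::int)) = 0 \<longleftrightarrow> (c \<longrightarrow> A = 0)" for c A by simp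
      show "?v $ ((j * 2^h + e) * 2 + 0) = 0 \<and> ?v $ ((j * 2^h + e) * 2 + 1) = 0 \<longleftrightarrow>
        (1 \<le> e \<and> Suc e < 2^h \<longrightarrow> x $ cpos h j (Suc e) 0 - 2 * x $ cpos h j e 0 = 0) \<and>
        (1 \<le> e \<longrightarrow> (if Suc e < 2^h then x $ cpos h j (Suc e) 1 else x $ 0)
        - x $ cpos h j e 1 - int (md j div 2^(e - 1) mod 2) * x $ cpos h j e 0 = 0)"
        unfolding 0[OF e] 1[OF e] z ..
    qed
    also have "\<dots> \<longleftrightarrow> (\<forall>e. 1 \<le> e \<and> e < 2^h \<longrightarrow>
      (Suc e < 2^h \<longrightarrow> x $ cpos h j (Suc e) 0 = 2 * x $ cpos h j e 0) \<and>
      (if Suc e < 2^h then x $ cpos h j (Suc e) 1 else x $ 0)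
        = x $ cpos h j e 1 + int (md j div 2^(e - 1) mod 2) * x $ cpos h j e 0)"
    proof (intro iff_allI)
      fix e
      have d: "a - b - c = 0 \<longleftrightarrow> a = b + c" "a - b = 0 \<longleftrightarrow> a = b" for a b c :: int by linarith+
      have p: "(P \<longrightarrow> (Q \<and> R \<longrightarrow> A) \<and> (Q \<longrightarrow> B)) = (Q \<and> P \<longrightarrow> (R \<longrightarrow> A) \<and> B)" for P Q R A B by blast
      show "(e < 2^h \<longrightarrow> (1 \<le> e \<and> Suc e < 2^h \<longrightarrow> x $ cpos h j (Suc e) 0 - 2 * x $ cpos h j e 0 = 0) \<and>
        (1 \<le> e \<longrightarrow> (if Suc e < 2^h then x $ cpos h j (Suc e) 1 else x $ 0)
        - x $ cpos h j e 1 - int (md j div 2^(e - 1) mod 2) * x $ cpos h j e 0 = 0)) \<longleftrightarrow>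
       (1 \<le> e \<and> e < 2^h \<longrightarrow>
      (Suc e < 2^h \<longrightarrow> x $ cpos h j (Suc e) 0 = 2 * x $ cpos h j e 0) \<and>
      (if Suc e < 2^h then x $ cpos h j (Suc e) 1 else x $ 0)
        = x $ cpos h j e 1 + int (md j div 2^(e - 1) mod 2) * x $ cpos h j e 0)"
        unfolding d(1) unfolding d(2) by (rule p)
    qed
    finally show "(\<forall>e<2^h. ?v $ ((j * 2^h + e) * 2 + 0) = 0 \<and> ?v $ ((j * 2^h + e) * 2 + 1) = 0) \<longleftrightarrow>
      (\<forall>e. 1 \<le> e \<and> e < 2^h \<longrightarrow>
      (Suc e < 2^h \<longrightarrow> x $ cpos h j (Suc e) 0 = 2 * x $ cpos h j e 0) \<and>
      (if Suc e < 2^h then x $ cpos h j (Suc e) 1 else x $ 0)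
        = x $ cpos h j e 1 + int (md j div 2^(e - 1) mod 2) * x $ cpos h j e 0)" .
  qed
  finally show ?thesis .
qed


section \<open>Bounds and feasibility\<close>

text \<open>The variable \<open>z\<close> of node 1, where the chain starts, is the \<open>z\<close>
  of \<open>x = q * m + z\<close>; it alone receives the interval that excludes the residue.\<close>

definition special :: "nat \<Rightarrow> (nat \<Rightarrow> bool) \<Rightarrow> nat \<Rightarrow> nat \<Rightarrow> nat \<Rightarrow> bool" where
  "special h fl j pos a \<longleftrightarrow> fl j \<and> a = 1 \<and> pos = pre h 1"

definition lowb :: "nat \<Rightarrow> (nat \<Rightarrow> nat) \<Rightarrow> (nat \<Rightarrow> bool) \<Rightarrow> nat \<Rightarrow> nat" where
  "lowb h rr fl c = (if c = 0 then 0
     else if special h fl ((c - 1) div 2 div (2^h - 1)) ((c - 1) div 2 mod (2^h - 1)) ((c - 1) mod 2)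
     then rr ((c - 1) div 2 div (2^h - 1)) + 1 else 0)"

definition upb :: "nat \<Rightarrow> (nat \<Rightarrow> nat) \<Rightarrow> (nat \<Rightarrow> nat) \<Rightarrow> (nat \<Rightarrow> bool) \<Rightarrow> nat \<Rightarrow> nat \<Rightarrow> nat" where
  "upb h md rr fl U c = (if c = 0 then U
     else if special h fl ((c - 1) div 2 div (2^h - 1)) ((c - 1) div 2 mod (2^h - 1)) ((c - 1) mod 2)
     then rr ((c - 1) div 2 div (2^h - 1)) + md ((c - 1) div 2 div (2^h - 1)) - 1 else U)"

text \<open>Block \<open>j\<close> expresses \<open>x = q * md j + z\<close>, where \<open>z\<close> lies between \<open>rr j + 1\<close> and
  \<open>rr j + md j - 1\<close> if \<open>fl j\<close>, that is, \<open>x\<close> is not congruent to \<open>rr j\<close> modulo \<open>md j\<close>. The product is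
  computed by doubling along the nodes, so that all coefficients are bounded; the chain of nodes is
  arranged as a balanced tree of height \<open>h\<close>.\<close>

definition gip :: "nat \<Rightarrow> nat \<Rightarrow> (nat \<Rightarrow> nat) \<Rightarrow> (nat \<Rightarrow> nat) \<Rightarrow> (nat \<Rightarrow> bool) \<Rightarrow> nat \<Rightarrow> ip" where
  "gip h J md rr fl U = \<lparr>ip_A = Amat h J md, ip_b = 0\<^sub>v (J * (2^h * 2)),
     ip_c = 0\<^sub>v (1 + J * ((2^h - 1) * 2)),
     ip_l = vec (1 + J * ((2^h - 1) * 2)) (\<lambda>c. int (lowb h rr fl c)),
     ip_u = vec (1 + J * ((2^h - 1) * 2)) (\<lambda>c. int (upb h md rr fl U c))\<rparr>"

lemma wf_gip: "wf_ip (gip h J md rr fl U)"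
  by (simp add: wf_ip_def gip_def Amat_def)

lemma elements_Amat: "a \<in> elements_mat (Amat h J md) \<Longrightarrow> \<bar>a\<bar> \<le> 2"
proof -
  have b: "\<bar>- int (n mod 2)\<bar> \<le> 2" for n by simp
  have "\<bar>cA h md j e k a\<bar> \<le> 2" for j e k a
    unfolding cA_def using b[of "md j div 2^(e - 1)"] by (simp del: abs_minus_cancel)
  moreover have "\<bar>cB e k a\<bar> \<le> 2" "\<bar>glob h e k\<bar> \<le> 2" for e k a by (simp_all add: cB_def glob_def)
  ultimately have "\<bar>Aentry h md r c\<bar> \<le> 2" for r c
    by (simp add: Aentry_def cell_def)
  then show "a \<in> elements_mat (Amat h J md) \<Longrightarrow> \<bar>a\<bar> \<le> 2"
    by (auto simp: elements_mat_def Amat_def)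
qed

lemma pair_less: "p < q \<Longrightarrow> a < 2 \<Longrightarrow> p * 2 + a < q * (2 :: nat)"
  by linarith

lemma cpos_less:
  assumes "j < J" "1 \<le> i" "i < 2^h" "a < 2"
  shows "cpos h j i a < 1 + J * ((2^h - 1) * 2)"
proof -
  have "pre h i < 2^h - 1" using pre_less[of i h] assms by simp
  then have "j * (2^h - 1) + pre h i < Suc j * (2^h - 1)" by simp
  also have "\<dots> \<le> J * (2^h - 1)" using assms(1) by (intro mult_le_mono1) simp
  finally have "(j * (2^h - 1) + pre h i) * 2 + a < J * (2^h - 1) * 2"
    using assms(4) by (rule pair_less)
  then show ?thesis by (simp add: cpos_def mult.assoc)
qed

lemma cpos_decode:
  assumes "1 \<le> i" "i < 2^h" "a < 2"
  shows "(cpos h j i a - 1) div 2 div (2^h - 1) = j" "(cpos h j i a - 1) div 2 mod (2^h - 1) = pre h i"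
    "(cpos h j i a - 1) mod 2 = a" "cpos h j i a \<noteq> 0"
proof -
  have p: "pre h i < 2^h - 1" using pre_less[of i h] assms by simp
  have c: "cpos h j i a - 1 = (j * (2^h - 1) + pre h i) * 2 + a" by (simp add: cpos_def)
  show "(cpos h j i a - 1) div 2 div (2^h - 1) = j" "(cpos h j i a - 1) div 2 mod (2^h - 1) = pre h i"
    "(cpos h j i a - 1) mod 2 = a" unfolding c using p assms(3) by (simp_all only: digit_div digit_mod)
qed (simp add: cpos_def)

lemma cpos_cases:
  assumes h: "h \<ge> 1" and c: "c < 1 + J * ((2^h - 1) * 2)"
  obtains "c = 0" | j i a where "c = cpos h j i a" "j < J" "1 \<le> i" "i < 2^h" "a < 2"
proof (cases "c = 0")
  case False
  let ?W = "2^h - 1 :: nat"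
  have W: "?W > 0" using one_less_two_power[OF h] by simp
  let ?j = "(c - 1) div 2 div ?W" and ?p = "(c - 1) div 2 mod ?W" and ?a = "(c - 1) mod 2"
  have "?p < ?W" using W by (rule mod_less_divisor)
  then have "?p \<in> pre h ` {1..<2^h}" using pre_bij[of h] by (simp add: bij_betw_def)
  then obtain i where i: "1 \<le> i" "i < 2^h" "?p = pre h i" by auto
  have "c - 1 < J * ?W * 2" using c False unfolding mult.assoc by linarith
  then have "(c - 1) div 2 < J * ?W" by (rule less_mult_imp_div_less)
  then have j: "?j < J" by (rule less_mult_imp_div_less)
  have "c = Suc ((c - 1) div 2 * 2 + ?a)" using False by (simp only: div_mult_mod_eq)
  also have "\<dots> = cpos h ?j i ?a" unfolding cpos_def i(3)[symmetric] div_mult_mod_eq ..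
  finally show ?thesis by (rule that(2)) (use j i in simp_all)
qed (rule that)

lemma mod_two_power_Suc: "m mod 2^Suc k = m mod 2^k + 2^k * (m div 2^k mod 2)" for m :: nat
  using mod_mult2_eq[of m "2^k" 2] by (simp add: mult.commute add.commute)

text \<open>Node \<open>k + 1\<close> carries \<open>2^k * y 1\<close> and
  \<open>z 1 + y 1 * (m mod 2^k)\<close>: the chain adds up the binary digits of \<open>m\<close>.
  There are \<open>2^h - 1\<close> nodes, whence the bound on \<open>m\<close>.\<close>

lemma chain_solution:
  assumes h: "h \<ge> 1"
    and y: "\<And>e. 1 \<le> e \<Longrightarrow> Suc e < 2^h \<Longrightarrow> y (Suc e) = 2 * (y e :: int)"
    and z: "\<And>e. 1 \<le> e \<Longrightarrow> e < 2^h \<Longrightarrow> (if Suc e < 2^h then z (Suc e) else x) = z e + int (m div 2^(e - 1) mod 2) * y e"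
    and m: "m < 2^(2^h - 1)"
  shows "x = z 1 + y 1 * int m"
proof -
  have *: "y (Suc k) = 2^k * y 1 \<and> z (Suc k) = z 1 + y 1 * int (m mod 2^k)" if "Suc k < 2^h" for k
    using that
  proof (induction k)
    case (Suc k)
    then have IH: "y (Suc k) = 2^k * y 1" "z (Suc k) = z 1 + y 1 * int (m mod 2^k)" by auto
    have "y (Suc (Suc k)) = 2 * y (Suc k)" using y[of "Suc k"] Suc.prems by simp
    moreover have "z (Suc (Suc k)) = z (Suc k) + int (m div 2^k mod 2) * y (Suc k)"
      using z[of "Suc k"] Suc.prems by simp
    ultimately show ?case using IH unfolding mod_two_power_Suc by (simp add: algebra_simps)
  qed simp
  have "2^h \<ge> (2::nat)" using one_less_two_power[OF h] by simp
  then obtain k where k: "(2::nat)^h = Suc (Suc k)" by (metis add_2_eq_Suc le_Suc_ex)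
  have "x = z (Suc k) + int (m div 2^k mod 2) * y (Suc k)" using z[of "Suc k"] k by simp
  also have "\<dots> = z 1 + y 1 * int (m mod 2^Suc k)" using *[of k] k unfolding mod_two_power_Suc
    by (simp add: algebra_simps)
  also have "m mod 2^Suc k = m" using m k by simp
  finally show ?thesis .
qed

lemma gip_feasible_iff:
  "x \<in> ip_feasible (gip h J md rr fl U) \<longleftrightarrow> x \<in> carrier_vec (1 + J * ((2^h - 1) * 2)) \<and>
     Amat h J md *\<^sub>v x = 0\<^sub>v (J * (2^h * 2)) \<and>
     (\<forall>c<1 + J * ((2^h - 1) * 2). int (lowb h rr fl c) \<le> x $ c \<and> x $ c \<le> int (upb h md rr fl U c))"
proof -
  have d: "dim_col (Amat h J md) = 1 + J * ((2^h - 1) * 2)" by (simp add: Amat_def)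
  define n where "n = 1 + J * ((2^h - 1) * 2 :: nat)"
  have l: "vec n f \<le> x \<and> x \<le> vec n g \<longleftrightarrow> (\<forall>c<n. f c \<le> x $ c \<and> x $ c \<le> g c)"
    if "x \<in> carrier_vec n" for f g
    using that by (auto simp: less_eq_vec_def)
  show ?thesis unfolding ip_feasible_def gip_def ip.simps mem_Collect_eq d n_def[symmetric]
    using l[of "\<lambda>c. int (lowb h rr fl c)" "\<lambda>c. int (upb h md rr fl U c)"] by argo
qed

lemma gip_feasible_imp:
  assumes h: "h \<ge> 1" and x: "x \<in> ip_feasible (gip h J md rr fl U)"
    and m: "\<And>j. j < J \<Longrightarrow> fl j \<Longrightarrow> 0 < md j \<and> md j < 2^(2^h - 1)"
  obtains X :: nat where "\<And>j. j < J \<Longrightarrow> fl j \<Longrightarrow> X mod md j \<noteq> rr j mod md j"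
proof -
  let ?n = "1 + J * ((2^h - 1) * 2)"
  have xc: "x \<in> carrier_vec ?n" and A: "Amat h J md *\<^sub>v x = 0\<^sub>v (J * (2^h * 2))"
    and lo: "\<And>c. c < ?n \<Longrightarrow> int (lowb h rr fl c) \<le> x $ c" and up: "\<And>c. c < ?n \<Longrightarrow> x $ c \<le> int (upb h md rr fl U c)"
    using gip_feasible_iff[of x] x by blast+
  note R = A[unfolded Amat_solution_iff[OF h xc], THEN spec, THEN mp, THEN spec, THEN mp]
  have eqs1: "x $ cpos h j (Suc e) 0 = 2 * x $ cpos h j e 0" if "j < J" "1 \<le> e" "Suc e < 2^h" for j e
    by (rule R[THEN conjunct1, THEN mp]) (use that in simp_all)
  have eqs2: "(if Suc e < 2^h then x $ cpos h j (Suc e) 1 else x $ 0)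
        = x $ cpos h j e 1 + int (md j div 2^(e - 1) mod 2) * x $ cpos h j e 0" if "j < J" "1 \<le> e" "e < 2^h" for j e
    by (rule R[THEN conjunct2]) (use that in simp_all)
  have x0: "x $ 0 \<ge> 0" using lo[of 0] by simp
  show ?thesis
  proof (rule that[of "nat (x $ 0)"])
    fix j assume j: "j < J" "fl j"
    let ?z = "x $ cpos h j 1 1" and ?y = "x $ cpos h j 1 0"
    have xx: "x $ 0 = ?z + ?y * int (md j)"
    proof (rule chain_solution[OF h, where y = "\<lambda>e. x $ cpos h j e 0" and z = "\<lambda>e. x $ cpos h j e 1"])
      show "md j < 2^(2^h - 1)" using m[OF j] by blast
    qed (fact eqs1[OF j(1)], fact eqs2[OF j(1)])
    have T: "(1::nat) < 2^h" by (rule one_less_two_power[OF h])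
    have l: "cpos h j 1 1 < ?n" by (rule cpos_less) (use j T in auto)
    have lu: "lowb h rr fl (cpos h j 1 1) = rr j + 1" "upb h md rr fl U (cpos h j 1 1) = rr j + md j - 1"
      using cpos_decode[of 1 h 1 j, OF order_refl T] j unfolding lowb_def upb_def special_def by simp_all
    have b: "int (rr j) < ?z" "?z < int (rr j) + int (md j)"
      using lo[OF l] up[OF l] m[OF j] unfolding lu by simp_all
    show "nat (x $ 0) mod md j \<noteq> rr j mod md j"
    proof
      assume "nat (x $ 0) mod md j = rr j mod md j"
      then have "x $ 0 mod int (md j) = int (rr j) mod int (md j)"
        using x0 by (metis int_nat_eq of_nat_mod)
      then have "?z mod int (md j) = int (rr j) mod int (md j)" unfolding xx by simp
      \<comment> \<open>A multiple of \<open>md j\<close> strictly between 0 and \<open>md j\<close>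
        is impossible.\<close>
      then have "int (md j) dvd ?z - int (rr j)" by (simp add: mod_eq_dvd_iff)
      then have "int (md j) \<le> ?z - int (rr j)" by (rule zdvd_imp_le) (use b in simp)
      then show False using b by simp
    qed
  qed
qed

text \<open>\<open>rr j < X\<close> keeps the quotients nonnegative, as the lower bounds demand, and
  \<open>U\<close> leaves room for the quotients after all doublings.\<close>

lemma gip_feasibleI:
  assumes h: "h \<ge> 1"
    and m: "\<And>j. j < J \<Longrightarrow> fl j \<Longrightarrow> 0 < md j \<and> md j < 2^(2^h - 1)"
    and X: "\<And>j. j < J \<Longrightarrow> fl j \<Longrightarrow> rr j < X \<and> X mod md j \<noteq> rr j mod md j"
    and U: "2^(2^h) * X \<le> U"
  shows "ip_feasible (gip h J md rr fl U) \<noteq> {}"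
proof -
  let ?n = "1 + J * ((2^h - 1) * 2)" and ?W = "2^h - 1 :: nat"
  \<comment> \<open>In a flagged block \<open>X - rr j - 1\<close> is divided, so that the part
    \<open>g j\<close> left for \<open>z\<close> starts at \<open>rr j + 1\<close>. All other blocks
    take \<open>q = 0\<close> and \<open>z = x\<close>, which fits any value of
    \<open>md j\<close>.\<close>
  define q where "q j = (if fl j then (X - rr j - 1) div md j else 0)" for j
  define g where "g j = X - q j * md j" for j
  have qm: "q j * md j \<le> X" if "j < J" for j
  proof (cases "fl j")
    case True
    then have "q j * md j \<le> X - rr j - 1" by (simp add: q_def)
    then show ?thesis by simp
  qed (simp add: q_def)
  have g: "rr j < g j" "g j < rr j + md j" if j: "j < J" "fl j" for j
  proof -
    have r: "rr j < X" "X mod md j \<noteq> rr j mod md j" "0 < md j" using X m j by auto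
    have q: "q j = (X - rr j - 1) div md j" using j by (simp add: q_def)
    have e: "q j * md j + (X - rr j - 1) mod md j = X - rr j - 1" unfolding q by (rule div_mult_mod_eq)
    then have ge: "g j = rr j + 1 + (X - rr j - 1) mod md j" using r qm[OF j(1)] unfolding g_def by linarith
    have "(X - rr j - 1) mod md j < md j" using r by simp
    \<comment> \<open>The largest remainder would put \<open>X\<close> into the forbidden
      class.\<close>
    moreover have "(X - rr j - 1) mod md j \<noteq> md j - 1"
    proof
      assume "(X - rr j - 1) mod md j = md j - 1"
      then have "X = rr j + (q j * md j + md j)" using e r by linarith
      then have "X = rr j + Suc (q j) * md j" by simp
      then have "X mod md j = rr j mod md j" by (simp only: mod_mult_self1)
      then show False using r by simp
    qed
    ultimately show "rr j < g j" "g j < rr j + md j" using ge r by linarith+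
  qed
  \<comment> \<open>The intermediate values of the chain, as in \<open>chain_solution\<close>; the
    node is recovered from its preorder position by \<open>inv_into\<close>.\<close>
  define x where "x = vec ?n (\<lambda>c. if c = 0 then int X else
    (let j = (c - 1) div 2 div ?W; i = inv_into {1..<2^h} (pre h) ((c - 1) div 2 mod ?W) in
     if (c - 1) mod 2 = 0 then 2^(i - 1) * int (q j) else int (g j) + int (q j) * int (md j mod 2^(i - 1))))"
  have xc: "x \<in> carrier_vec ?n" by (simp add: x_def)
  have x0: "x $ 0 = int X" by (simp add: x_def)
  have inj: "inj_on (pre h) {1..<2^h}" using pre_bij[of h] by (simp add: bij_betw_def)
  have xp: "x $ cpos h j i 0 = 2^(i - 1) * int (q j)" "x $ cpos h j i 1 = int (g j) + int (q j) * int (md j mod 2^(i - 1))"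
    if "j < J" "1 \<le> i" "i < 2^h" for j i
  proof -
    have "inv_into {1..<2^h} (pre h) (pre h i) = i" by (rule inv_into_f_f[OF inj]) (use that in simp)
    then show "x $ cpos h j i 0 = 2^(i - 1) * int (q j)" "x $ cpos h j i 1 = int (g j) + int (q j) * int (md j mod 2^(i - 1))"
      using cpos_decode[of i h 0 j] cpos_decode[of i h 1 j] cpos_less[of j J i h 0] cpos_less[of j J i h 1] that
      by (simp_all add: x_def Let_def)
  qed
  have A: "Amat h J md *\<^sub>v x = 0\<^sub>v (J * (2^h * 2))"
    unfolding Amat_solution_iff[OF h xc]
  proof (intro allI impI conjI)
    fix j e :: nat assume j: "j < J" and e: "1 \<le> e \<and> e < 2^h"
    then obtain k where k: "e = Suc k" by (cases e) auto
    show "x $ cpos h j (Suc e) 0 = 2 * x $ cpos h j e 0" if "Suc e < 2^h"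
      using xp(1)[of j e] xp(1)[of j "Suc e"] j e that k by simp
    show "(if Suc e < 2^h then x $ cpos h j (Suc e) 1 else x $ 0)
        = x $ cpos h j e 1 + int (md j div 2^(e - 1) mod 2) * x $ cpos h j e 0"
    proof -
      have r: "x $ cpos h j e 1 + int (md j div 2^(e - 1) mod 2) * x $ cpos h j e 0
        = int (g j) + int (q j) * int (md j mod 2^e)"
        using xp[of j e] j e unfolding k mod_two_power_Suc by (simp add: algebra_simps)
      show ?thesis
      proof (cases "Suc e < 2^h")
        case True
        then show ?thesis using xp(2)[of j "Suc e"] j unfolding r by simp
      next
        case False
        then have eT: "e = 2^h - 1" using e False by linarith
        have "int (g j) + int (q j) * int (md j mod 2^e) = int X"
        proof (cases "fl j")
          case True
          then have "md j mod 2^e = md j" using m[OF j True] eT by simp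
          then show ?thesis using qm[OF j] unfolding g_def by (simp add: of_nat_diff)
        qed (simp add: g_def q_def)
        then show ?thesis using False x0 unfolding r by simp
      qed
    qed
  qed
  have XU: "X \<le> U"
  proof -
    have "X \<le> 2^(2^h) * X" by simp
    also have "\<dots> \<le> U" by (rule U)
    finally show ?thesis .
  qed
  have bounds: "int (lowb h rr fl c) \<le> x $ c \<and> x $ c \<le> int (upb h md rr fl U c)" if "c < ?n" for c
    using h that
  proof (cases rule: cpos_cases)
    case 1
    then show ?thesis using x0 XU by (simp add: lowb_def upb_def)
  next
    case (2 j i a)
    note dec = cpos_decode[OF 2(3,4,5), of j]
    have "a = 0 \<or> a = 1" using 2 by auto
    then show ?thesis
    proof
      assume a: "a = 0"
      have "2^(i-1) * q j \<le> U"
      proof (cases "fl j")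
        case True
        have "q j \<le> q j * md j" using m[OF 2(2) True] by simp
        also have "\<dots> \<le> X" by (rule qm[OF 2(2)])
        finally have "q j \<le> X" .
        moreover have "(2::nat)^(i-1) \<le> 2^(2^h)" using 2(4) by (intro power_increasing) auto
        ultimately have "2^(i-1) * q j \<le> 2^(2^h) * X" by (rule mult_le_mono[rotated])
        then show ?thesis using U by simp
      qed (simp add: q_def)
      then have "int (2^(i-1) * q j) \<le> int U" by (simp only: of_nat_le_iff)
      then show ?thesis using xp(1)[OF 2(2,3,4)] dec unfolding 2(1) a lowb_def upb_def special_def by simp
    next
      assume a: "a = 1"
      have v: "x $ c = int (g j) + int (q j) * int (md j mod 2^(i-1))" using xp(2)[OF 2(2,3,4)] 2(1) a by simp
      have "g j + q j * (md j mod 2^(i-1)) \<le> g j + q j * md j" by simp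
      also have "\<dots> = X" using qm[OF 2(2)] by (simp add: g_def)
      finally have "g j + q j * (md j mod 2^(i-1)) \<le> U" using XU by simp
      then have vU: "x $ c \<le> int U" unfolding v by (metis of_nat_add of_nat_le_iff of_nat_mult)
      show ?thesis
      proof (cases "fl j \<and> pre h i = pre h 1")
        case True
        then have "i = 1" using pre_inj[of i h 1] 2 one_less_two_power[OF h] by auto
        then have "x $ c = int (g j)" using v by simp
        then show ?thesis using g[of j] 2(2) True dec unfolding 2(1) a lowb_def upb_def special_def by auto
      next
        case False
        then show ?thesis using vU v dec unfolding 2(1) a lowb_def upb_def special_def by auto
      qed
    qed
  qed
  have "x \<in> ip_feasible (gip h J md rr fl U)"
    unfolding gip_feasible_iff using xc A bounds by blast
  then show ?thesis by blast
qed

section \<open>Encodings as nested concatenations\<close>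

lemma concat_upt_mult: "concat (map f [0..<a * b]) = concat (map (\<lambda>i. concat (map (\<lambda>k. f (i * b + k)) [0..<b])) [0..<a])"
proof (induction a)
  case (Suc a)
  have "[0..<Suc a * b] = [0..<a * b] @ map (\<lambda>k. a * b + k) [0..<b]"
    by (rule nth_equalityI) (auto simp: nth_append)
  then show ?case using Suc by (simp add: comp_def)
qed simp

lemma enc_vec_vec: "enc_vec (vec n f) = concat (map (\<lambda>i. enc_int (f i)) [0..<n])"
proof -
  have "list_of_vec (vec n f) = map f [0..<n]"
    by (rule nth_equalityI) (auto simp: list_of_vec_index)
  then show ?thesis unfolding enc_vec_def by (simp add: comp_def)
qed

lemma enc_mat_mat: "enc_mat (mat nr nc f) = concat (map (\<lambda>r. concat (map (\<lambda>c. enc_int (f (r, c))) [0..<nc])) [0..<nr])"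
proof -
  have "enc_vec (row (mat nr nc f) r) = concat (map (\<lambda>c. enc_int (f (r, c))) [0..<nc])" if "r < nr" for r
    using that by (simp add: enc_vec_vec)
  then show ?thesis unfolding enc_mat_def rows_def map_map comp_def dim_row_mat(1)
    by (intro arg_cong[where f = concat] map_cong refl) simp
qed

lemma concat_cols:
  assumes "\<And>j pos a. j < J \<Longrightarrow> pos < W \<Longrightarrow> a < 2 \<Longrightarrow> f (Suc ((j * W + pos) * 2 + a)) = g j pos a"
  shows "concat (map f [0..<1 + J * (W * 2)]) = f 0 @
    concat (map (\<lambda>j. concat (map (\<lambda>pos. concat (map (\<lambda>a. g j pos a) [0..<2])) [0..<W])) [0..<J])"
proof -
  have "concat (map f [0..<1 + J * (W * 2)]) = f 0 @ concat (map (\<lambda>c. f (Suc c)) [0..<(J * W) * 2])"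
    by (simp add: upt_conv_Cons map_Suc_upt[symmetric] comp_def mult.assoc del: upt_Suc)
  also have "concat (map (\<lambda>c. f (Suc c)) [0..<(J * W) * 2]) =
    concat (map (\<lambda>j. concat (map (\<lambda>pos. concat (map (\<lambda>a. f (Suc ((j * W + pos) * 2 + a))) [0..<2])) [0..<W])) [0..<J])"
    unfolding concat_upt_mult ..
  also have "\<dots> = concat (map (\<lambda>j. concat (map (\<lambda>pos. concat (map (\<lambda>a. g j pos a) [0..<2])) [0..<W])) [0..<J])"
    using assms by (intro arg_cong[where f = concat] map_cong refl) auto
  finally show ?thesis .
qed

text \<open>Column and row numbers are split into block, node and variable, which gives the nested
  loops that the program will print.\<close>

lemma enc_gip:
  "enc_ip (gip h J md rr fl U) =
    enc_nat (J * (2^h * 2)) @ enc_nat (1 + J * ((2^h - 1) * 2)) @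
    concat (map (\<lambda>j. concat (map (\<lambda>e. concat (map (\<lambda>k. enc_int (glob h e k) @
      concat (map (\<lambda>j'. concat (map (\<lambda>pos. concat (map (\<lambda>a.
        enc_int (if j = j' then cell h md j e k pos a else 0)) [0..<2])) [0..<2^h - 1])) [0..<J])) [0..<2])) [0..<2^h])) [0..<J]) @
    concat (map (\<lambda>_. enc_int 0) [0..<J * (2^h * 2)]) @
    concat (map (\<lambda>_. enc_int 0) [0..<1 + J * ((2^h - 1) * 2)]) @
    (enc_int 0 @ concat (map (\<lambda>j. concat (map (\<lambda>pos. concat (map (\<lambda>a.
        enc_int (int (if special h fl j pos a then rr j + 1 else 0))) [0..<2])) [0..<2^h - 1])) [0..<J])) @
    (enc_int (int U) @ concat (map (\<lambda>j. concat (map (\<lambda>pos. concat (map (\<lambda>a.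
        enc_int (int (if special h fl j pos a then rr j + md j - 1 else U))) [0..<2])) [0..<2^h - 1])) [0..<J]))"
proof -
  let ?W = "2^h - 1 :: nat"
  have dc: "(Suc ((j * ?W + pos) * 2 + a) - 1) div 2 div ?W = j" "(Suc ((j * ?W + pos) * 2 + a) - 1) div 2 mod ?W = pos"
    "(Suc ((j * ?W + pos) * 2 + a) - 1) mod 2 = a" if "pos < ?W" "a < 2" for j pos a
    using that by (simp_all only: diff_Suc_1 digit_div digit_mod)
  have 1: "enc_mat (Amat h J md) = concat (map (\<lambda>j. concat (map (\<lambda>e. concat (map (\<lambda>k. enc_int (glob h e k) @
      concat (map (\<lambda>j'. concat (map (\<lambda>pos. concat (map (\<lambda>a.
        enc_int (if j = j' then cell h md j e k pos a else 0)) [0..<2])) [0..<?W])) [0..<J])) [0..<2])) [0..<2^h])) [0..<J])"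
  proof -
    have rows: "concat (map (\<lambda>c. enc_int (Aentry h md ((j * 2^h + e) * 2 + k) c)) [0..<1 + J * (?W * 2)])
      = enc_int (glob h e k) @ concat (map (\<lambda>j'. concat (map (\<lambda>pos. concat (map (\<lambda>a.
        enc_int (if j = j' then cell h md j e k pos a else 0)) [0..<2])) [0..<?W])) [0..<J])"
      if "e < 2^h" "k < 2" for j e k
    proof -
      have r: "((j * 2^h + e) * 2 + k) div 2 mod 2^h = e" "((j * 2^h + e) * 2 + k) div 2 div 2^h = j"
        "((j * 2^h + e) * 2 + k) mod 2 = k" using that by (simp_all only: digit_div digit_mod)
      have g: "enc_int (glob h e k) = enc_int (Aentry h md ((j * 2^h + e) * 2 + k) 0)"
        unfolding Aentry_def r by simp
      show ?thesis unfolding g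
      proof (rule concat_cols)
        fix j' pos a assume *: "pos < ?W" "a < (2::nat)"
        show "enc_int (Aentry h md ((j * 2^h + e) * 2 + k) (Suc ((j' * ?W + pos) * 2 + a))) =
          enc_int (if j = j' then cell h md j e k pos a else 0)"
          unfolding Aentry_def r dc[OF *] by simp
      qed
    qed
    have "enc_mat (Amat h J md) = concat (map (\<lambda>r. concat (map (\<lambda>c. enc_int (Aentry h md r c)) [0..<1 + J * (?W * 2)])) [0..<(J * 2^h) * 2])"
      unfolding Amat_def enc_mat_mat by (simp only: split mult.assoc)
    also have "\<dots> = concat (map (\<lambda>j. concat (map (\<lambda>e. concat (map (\<lambda>k.
        concat (map (\<lambda>c. enc_int (Aentry h md ((j * 2^h + e) * 2 + k) c)) [0..<1 + J * (?W * 2)])) [0..<2])) [0..<2^h])) [0..<J])"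
      unfolding concat_upt_mult ..
    also have "\<dots> = concat (map (\<lambda>j. concat (map (\<lambda>e. concat (map (\<lambda>k. enc_int (glob h e k) @
      concat (map (\<lambda>j'. concat (map (\<lambda>pos. concat (map (\<lambda>a.
        enc_int (if j = j' then cell h md j e k pos a else 0)) [0..<2])) [0..<?W])) [0..<J])) [0..<2])) [0..<2^h])) [0..<J])"
      by (intro arg_cong[where f = concat] map_cong refl rows) auto
    finally show ?thesis .
  qed
  have zero: "enc_vec (0\<^sub>v n) = concat (map (\<lambda>_. enc_int 0) [0..<n])" for n
    unfolding zero_vec_def enc_vec_vec ..
  have 2: "concat (map (\<lambda>c. enc_int (int (lowb h rr fl c))) [0..<1 + J * (?W * 2)]) =
    enc_int (int (lowb h rr fl 0)) @ concat (map (\<lambda>j. concat (map (\<lambda>pos. concat (map (\<lambda>a.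
        enc_int (int (if special h fl j pos a then rr j + 1 else 0))) [0..<2])) [0..<?W])) [0..<J])"
  proof (rule concat_cols)
    fix j pos a assume *: "pos < ?W" "a < (2::nat)"
    show "enc_int (int (lowb h rr fl (Suc ((j * ?W + pos) * 2 + a)))) = enc_int (int (if special h fl j pos a then rr j + 1 else 0))"
      unfolding lowb_def dc[OF *] by simp
  qed
  have 3: "concat (map (\<lambda>c. enc_int (int (upb h md rr fl U c))) [0..<1 + J * (?W * 2)]) =
    enc_int (int (upb h md rr fl U 0)) @ concat (map (\<lambda>j. concat (map (\<lambda>pos. concat (map (\<lambda>a.
        enc_int (int (if special h fl j pos a then rr j + md j - 1 else U))) [0..<2])) [0..<?W])) [0..<J])"
  proof (rule concat_cols)
    fix j pos a assume *: "pos < ?W" "a < (2::nat)"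
    show "enc_int (int (upb h md rr fl U (Suc ((j * ?W + pos) * 2 + a)))) = enc_int (int (if special h fl j pos a then rr j + md j - 1 else U))"
      unfolding upb_def dc[OF *] by simp
  qed
  have 4: "lowb h rr fl 0 = 0" "upb h md rr fl U 0 = U" by (simp_all add: lowb_def upb_def)
  have dims: "dim_row (Amat h J md) = J * (2^h * 2)" "dim_col (Amat h J md) = 1 + J * (?W * 2)"
    by (simp_all add: Amat_def)
  show ?thesis unfolding enc_ip_def gip_def ip.simps dims 1 zero enc_vec_vec 2 3 4 of_nat_0 ..
qed

section \<open>Parsing the encoding of a formula\<close>

text \<open>The position behind a number code that starts at \<open>p\<close>: pairs are skipped
  until the closing \<open>False\<close>, where the iteration stands still, so
  \<open>length w\<close> rounds always suffice.\<close>

definition tskip :: "bool list \<Rightarrow> nat \<Rightarrow> nat" where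
  "tskip w p = ((\<lambda>v. min (if bit w v then v + 2 else v) (length w)) ^^ length w) p + 1"

text \<open>The start of literal \<open>t\<close>: two header numbers are skipped, then a sign and a
  number for each literal. Behind the last literal the cap makes the value stay at
  \<open>length w\<close>, which marks the end.\<close>

definition lpos :: "bool list \<Rightarrow> nat \<Rightarrow> nat" where
  "lpos w t = ((\<lambda>v. min (tskip w (v + 1)) (length w)) ^^ t) (tskip w (tskip w 0))"

text \<open>Only the bits of the code of variable \<open>t\<close> are compared; since the code is
  prefix-free, agreement on them already means equality.\<close>

definition same :: "bool list \<Rightarrow> nat \<Rightarrow> nat \<Rightarrow> bool" where
  "same w t s \<longleftrightarrow> (\<forall>k < lpos w (t + 1) - lpos w t - 1. bit w (lpos w t + 1 + k) = bit w (lpos w s + 1 + k))"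

text \<open>The \<open>i\<close> without a match among the positions up to \<open>i\<close> are
  those before the first match, so counting them finds it.\<close>

definition vid :: "bool list \<Rightarrow> nat \<Rightarrow> nat" where
  "vid w t = (\<Sum>i<t. of_bool (\<forall>s<i + 1. \<not> same w t s))"

text \<open>Variables are identified by the index of their first occurrence, so that primes polynomial in the
  input length suffice: a variable itself may be exponential in the length of its encoding.\<close>

definition pr :: "bool list \<Rightarrow> nat \<Rightarrow> nat" where
  "pr w t = nthp (Yb (length w)) (vid w t)"

text \<open>Bounds a product of three primes, and so also the residues to be considered for a
  clause.\<close>

definition Bb :: "nat \<Rightarrow> nat" where
  "Bb n = Yb n * (Yb n * Yb n)"

definition bl :: "nat \<Rightarrow> nat" where
  "bl m = (\<Sum>k<m. of_bool (2^k \<le> m))"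

text \<open>A modulus has at most \<open>bl (Bb n)\<close> digits, and a tree of this height has at
  least that many nodes.\<close>

definition hh :: "nat \<Rightarrow> nat" where
  "hh n = bl (bl (Bb n))"

definition JJ :: "nat \<Rightarrow> nat" where
  "JJ n = n * Bb n"

text \<open>With \<open>T = 2^hh n\<close>, the witness is at most
  \<open>Bb n + 1 \<le> 2^(T - 1)\<close> times a product of at most \<open>n\<close> primes, each
  at most \<open>2^T\<close>; the doublings cost another factor \<open>2^T\<close>.\<close>

definition Ue :: "nat \<Rightarrow> nat" where
  "Ue n = 2^hh n * (n + 2)"

text \<open>Block \<open>j\<close> treats clause \<open>j div Bb\<close> and residue
  \<open>j mod Bb\<close>. A variable occurring twice in the clause contributes its prime twice,
  which is harmless: the residue still determines divisibility by each prime.\<close>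

definition mdj :: "bool list \<Rightarrow> nat \<Rightarrow> nat" where
  "mdj w j = (let t = 3 * (j div Bb (length w)) in pr w t * (pr w (t + 1) * pr w (t + 2)))"

definition rrj :: "bool list \<Rightarrow> nat \<Rightarrow> nat" where
  "rrj w j = j mod Bb (length w)"

text \<open>The clause exists, and the residue falsifies each of its three literals.\<close>

definition flj :: "bool list \<Rightarrow> nat \<Rightarrow> bool" where
  "flj w j \<longleftrightarrow> (let t = 3 * (j div Bb (length w)) in lpos w t < length w \<and>
     (\<forall>k<3. bit w (lpos w (t + k)) \<noteq> (rrj w j mod pr w (t + k) \<noteq> 0)))"

text \<open>The bound \<open>2^Ue - 1\<close> has only ones as binary digits, so it can be printed
  although no counter could hold it in polynomial time.\<close>

definition red :: "bool list \<Rightarrow> ip" where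
  "red w = gip (hh (length w)) (JJ (length w)) (mdj w) (rrj w) (flj w) (2^Ue (length w) - 1)"

lemma bl_eq:
  assumes "2^k \<le> m" "m < 2^Suc k" shows "bl m = Suc k"
proof -
  have iff: "2^i \<le> m \<longleftrightarrow> i \<le> k" for i
  proof
    assume "2^i \<le> m"
    then have "(2::nat)^i < 2^Suc k" using assms(2) by linarith
    then have "i < Suc k" using power_less_imp_less_exp[of "2::nat" i "Suc k"] by simp
    then show "i \<le> k" by simp
  next
    assume "i \<le> k"
    then have "(2::nat)^i \<le> 2^k" by (intro power_increasing) auto
    then show "2^i \<le> m" using assms(1) by linarith
  qed
  have "k < 2^k" by simp
  then have "k < m" using assms(1) by linarith
  then have "{..<m} \<inter> {i. i \<le> k} = {..k}" by auto
  then show ?thesis unfolding bl_def iff by (simp add: of_bool_def sum.If_cases)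
qed

lemma bl_ex:
  assumes "m > 0" obtains k where "bl m = Suc k" "2^k \<le> m" "m < 2^Suc k"
proof -
  define k where "k = (LEAST k. m < 2^Suc k)"
  have "m < 2^m" by simp
  also have "(2::nat)^m \<le> 2^Suc m" by (intro power_increasing) auto
  finally have 1: "m < 2^Suc k" unfolding k_def by (rule LeastI)
  have 2: "2^k \<le> m"
  proof (cases k)
    case 0
    then show ?thesis using assms by simp
  next
    case (Suc i)
    then have "\<not> m < 2^Suc i" using not_less_Least[of i "\<lambda>k. m < 2^Suc k"] unfolding k_def by simp
    then show ?thesis using Suc by simp
  qed
  show ?thesis by (rule that[OF bl_eq[OF 2 1] 2 1])
qed

lemma bl_less: "m < 2^bl m"
proof (cases "m = 0")
  case False
  then have "m > 0" by simp
  then obtain k where "bl m = Suc k" "2^k \<le> m" "m < 2^Suc k" by (rule bl_ex)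
  then show ?thesis by simp
qed simp

lemma bl_le: assumes "m > 0" shows "2^bl m \<le> 2 * m"
proof -
  obtain k where "bl m = Suc k" "2^k \<le> m" using assms by (rule bl_ex)
  then show ?thesis by simp
qed

lemma bl_pos: assumes "m > 0" shows "bl m > 0"
proof -
  obtain k where "bl m = Suc k" using assms by (rule bl_ex)
  then show ?thesis by simp
qed

lemma Bb_pos: "Bb n > 0"
  by (simp add: Bb_def Yb_def)

lemma hh_pos: "hh n \<ge> 1"
proof -
  have "bl (bl (Bb n)) > 0" by (intro bl_pos Bb_pos)
  then show ?thesis by (simp add: hh_def)
qed

lemma Bb_less: "Bb n < 2^(2^hh n - 1)"
proof -
  have "Bb n < 2^bl (Bb n)" by (rule bl_less)
  also have "bl (Bb n) < 2^hh n" unfolding hh_def by (rule bl_less)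
  then have "(2::nat)^bl (Bb n) \<le> 2^(2^hh n - 1)" by (intro power_increasing) auto
  finally show ?thesis .
qed

abbreviation pairs :: "bool list \<Rightarrow> bool list" where
  "pairs bs \<equiv> concat (map (\<lambda>b. [True, b]) bs)"

lemma length_pairs: "length (pairs bs) = 2 * length bs"
  by (induction bs) auto

lemma iter_pairs:
  assumes "w = xs @ pairs bs @ False # ys" "length bs \<le> j"
  shows "((\<lambda>v. min (if bit w v then v + 2 else v) (length w)) ^^ j) (length xs) = length xs + 2 * length bs"
  using assms
proof (induction bs arbitrary: xs j)
  case Nil
  have "\<not> bit w (length xs)" using Nil by (simp add: bit_def)
  then have f: "(\<lambda>v. min (if bit w v then v + 2 else v) (length w)) (length xs) = length xs" using Nil by simp
  have "((\<lambda>v. min (if bit w v then v + 2 else v) (length w)) ^^ j) (length xs) = length xs"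
    by (induction j) (simp_all only: funpow.simps o_apply f id_apply)
  then show ?case by simp
next
  case (Cons b bs)
  then obtain j' where j: "j = Suc j'" by (cases j) auto
  have "bit w (length xs)" using Cons.prems by (simp add: bit_def)
  then have f: "(\<lambda>v. min (if bit w v then v + 2 else v) (length w)) (length xs) = length (xs @ [True, b])"
    using Cons.prems(1) by simp
  have "((\<lambda>v. min (if bit w v then v + 2 else v) (length w)) ^^ j') (length (xs @ [True, b])) =
     length (xs @ [True, b]) + 2 * length bs"
    by (rule Cons.IH) (use Cons.prems j in auto)
  then show ?case unfolding j funpow_Suc_right o_apply f by simp
qed

lemma enc_nat_pairs: "enc_nat n = pairs (binary n) @ [False]"
  by (simp add: enc_nat_def)

lemma tskip:
  assumes "w = xs @ enc_nat n @ ys"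
  shows "tskip w (length xs) = length xs + length (enc_nat n)"
proof -
  have w: "w = xs @ pairs (binary n) @ False # ys" using assms by (simp add: enc_nat_pairs)
  have "length w = length xs + 2 * length (binary n) + 1 + length ys" by (simp add: w length_pairs)
  then have "length (binary n) \<le> length w" by linarith
  from iter_pairs[OF w this] show ?thesis by (simp add: tskip_def enc_nat_pairs length_pairs)
qed

lemma tskip_beyond:
  assumes "length w \<le> v" shows "length w \<le> tskip w v"
proof -
  have "length w \<le> ((\<lambda>v. min (if bit w v then v + 2 else v) (length w)) ^^ j) v" for j
    by (induction j) (use assms in \<open>auto simp: bit_def\<close>)
  then show ?thesis unfolding tskip_def by (simp add: le_SucI)
qed

lemma lpos_Suc: "lpos w (Suc t) = min (tskip w (lpos w t + 1)) (length w)"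
  by (simp add: lpos_def)

lemma binary_0: "binary 0 = []" and binary_pos: "n \<noteq> 0 \<Longrightarrow> binary n = odd n # binary (n div 2)"
  by (subst binary.simps, simp)+

lemma binary_eq_Nil: "binary k = [] \<longleftrightarrow> k = 0"
  by (cases "k = 0") (simp_all add: binary_0 binary_pos)

lemma binary_inj: "binary m = binary n \<Longrightarrow> m = n"
proof (induction m arbitrary: n rule: less_induct)
  case (less m)
  show ?case
  proof (cases "m = 0 \<or> n = 0")
    case True
    then show ?thesis using less.prems by (metis binary_eq_Nil)
  next
    case False
    then have "odd m # binary (m div 2) = odd n # binary (n div 2)"
      using less.prems binary_pos[of m] binary_pos[of n] by argo
    then have e: "odd m = odd n" "binary (m div 2) = binary (n div 2)" by simp_all
    have "m div 2 < m" using False by simp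
    then have "m div 2 = n div 2" using less.IH e(2) by blast
    then show ?thesis using e(1) by presburger
  qed
qed

lemma pairs_prefix_free: "pairs bs @ False # x = pairs bs' @ False # y \<Longrightarrow> bs = bs'"
proof (induction bs arbitrary: bs')
  case Nil
  then show ?case by (cases bs') auto
next
  case (Cons b bs)
  then show ?case by (cases bs') auto
qed

text \<open>Agreement on the common length makes the shorter code a prefix of the longer
  one.\<close>

lemma enc_nat_prefix_free:
  assumes "\<And>k. k < length (enc_nat m) \<Longrightarrow> k < length (enc_nat n) \<Longrightarrow> enc_nat m ! k = enc_nat n ! k"
  shows "m = n"
proof -
  have aux: "a = b" if le: "length (enc_nat a) \<le> length (enc_nat b)"
    and eq: "\<And>k. k < length (enc_nat a) \<Longrightarrow> enc_nat a ! k = enc_nat b ! k" for a b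
  proof -
    define L where "L = length (enc_nat a)"
    have e: "enc_nat a = take L (enc_nat b)"
      by (rule nth_equalityI) (use le eq in \<open>auto simp: L_def\<close>)
    have "enc_nat a @ drop L (enc_nat b) = enc_nat b" unfolding e by (rule append_take_drop_id)
    then have "pairs (binary a) @ False # drop L (enc_nat b) = pairs (binary b) @ False # []"
      by (simp add: enc_nat_pairs)
    then show ?thesis by (intro binary_inj) (rule pairs_prefix_free)
  qed
  show ?thesis
  proof (cases "length (enc_nat m) \<le> length (enc_nat n)")
    case True
    then show ?thesis by (rule aux) (use assms True in auto)
  next
    case False
    then have "n = m" by (intro aux) (use assms in auto)
    then show ?thesis by simp
  qed
qed

section \<open>A well-formed formula, its primes and the correctness of the reduction\<close>

locale formula =
  fixes \<phi> :: cnf3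
  assumes wf: "wf_cnf3 \<phi>"
begin

definition "w = enc_cnf3 \<phi>"
definition "ls = concat (map clause_lits (snd \<phi>))"
definition "hdr = enc_nat (fst \<phi>) @ enc_nat (length (snd \<phi>))"

lemma w_eq: "w = hdr @ concat (map enc_literal ls)"
proof -
  have "concat (map (\<lambda>cl. concat (map enc_literal (clause_lits cl))) cs) =
    concat (map enc_literal (concat (map clause_lits cs)))" for cs
    by (induction cs) auto
  then show ?thesis by (simp add: w_def enc_cnf3_def hdr_def ls_def)
qed

definition st :: "nat \<Rightarrow> nat" where
  "st t = length (hdr @ concat (map enc_literal (take t ls)))"

lemma w_split:
  assumes "t < length ls"
  shows "w = ((hdr @ concat (map enc_literal (take t ls))) @ [fst (ls ! t)]) @ enc_nat (snd (ls ! t)) @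
    concat (map enc_literal (drop (Suc t) ls))"
proof -
  have "ls = take t ls @ ls ! t # drop (Suc t) ls" using assms by (rule id_take_nth_drop)
  then have "concat (map enc_literal ls) = concat (map enc_literal (take t ls @ ls ! t # drop (Suc t) ls))" by simp
  also have "\<dots> = concat (map enc_literal (take t ls)) @ enc_literal (ls ! t) @ concat (map enc_literal (drop (Suc t) ls))"
    by simp
  finally show ?thesis unfolding w_eq by (simp add: enc_literal_def)
qed

lemma st_Suc: "t < length ls \<Longrightarrow> st (Suc t) = st t + 1 + length (enc_nat (snd (ls ! t)))"
  by (simp add: st_def take_Suc_conv_app_nth enc_literal_def)

lemma st_le: "st t \<le> length w"
proof -
  have "concat (map enc_literal ls) = concat (map enc_literal (take t ls)) @ concat (map enc_literal (drop t ls))"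
    by (metis append_take_drop_id concat_append map_append)
  then show ?thesis by (simp add: st_def w_eq)
qed

lemma lpos_st: "t \<le> length ls \<Longrightarrow> lpos w t = st t"
proof (induction t)
  case 0
  have "tskip w 0 = length (enc_nat (fst \<phi>))"
    using tskip[of w "[]" "fst \<phi>" "enc_nat (length (snd \<phi>)) @ concat (map enc_literal ls)"] by (simp add: w_eq hdr_def)
  moreover have "tskip w (length (enc_nat (fst \<phi>))) = length (enc_nat (fst \<phi>)) + length (enc_nat (length (snd \<phi>)))"
    by (rule tskip[where ys = "concat (map enc_literal ls)"]) (simp add: w_eq hdr_def)
  ultimately show ?case by (simp add: lpos_def st_def hdr_def)
next
  case (Suc t)
  then have t: "t < length ls" by simp
  have "tskip w (st t + 1) = st t + 1 + length (enc_nat (snd (ls ! t)))"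
    using tskip[OF w_split[OF t]] by (simp add: st_def)
  then show ?case using Suc st_Suc[OF t] st_le[of "Suc t"] by (simp add: lpos_Suc)
qed

lemma lpos_beyond: "length ls \<le> t \<Longrightarrow> lpos w t = length w"
proof (induction t rule: dec_induct)
  case base
  have "lpos w (length ls) = st (length ls)" by (rule lpos_st) simp
  then show ?case by (simp add: st_def w_eq)
next
  case (step t)
  have "length w \<le> tskip w (length w + 1)" by (rule tskip_beyond) simp
  then show ?case using step by (simp add: lpos_Suc)
qed

lemma lpos_less_iff: "lpos w t < length w \<longleftrightarrow> t < length ls"
proof
  assume "t < length ls"
  then show "lpos w t < length w" using lpos_st[of t] st_Suc[of t] st_le[of "Suc t"] by simp
next
  assume "lpos w t < length w"
  then show "t < length ls" using lpos_beyond[of t] by (cases "t < length ls") auto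
qed

lemma bit_append: "bit (xs @ ys) (length xs + k) = bit ys k"
  by (simp add: bit_def nth_append)

lemma bit_sign: assumes "t < length ls" shows "bit w (lpos w t) = fst (ls ! t)"
proof -
  have "w = (hdr @ concat (map enc_literal (take t ls))) @ fst (ls ! t) # enc_nat (snd (ls ! t)) @
    concat (map enc_literal (drop (Suc t) ls))" using w_split[OF assms] by simp
  then have "bit w (length (hdr @ concat (map enc_literal (take t ls))) + 0) = fst (ls ! t)"
    using bit_append by (metis bit_def length_greater_0_conv list.distinct(1) nth_Cons_0)
  then show ?thesis using lpos_st[of t] assms by (simp add: st_def)
qed

lemma bit_var:
  assumes "t < length ls" "k < length (enc_nat (snd (ls ! t)))"
  shows "bit w (lpos w t + 1 + k) = enc_nat (snd (ls ! t)) ! k"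
proof -
  let ?xs = "(hdr @ concat (map enc_literal (take t ls))) @ [fst (ls ! t)]"
  let ?ys = "enc_nat (snd (ls ! t)) @ concat (map enc_literal (drop (Suc t) ls))"
  have "bit w (length ?xs + k) = bit ?ys k" unfolding w_split[OF assms(1)] by (rule bit_append)
  moreover have "length ?xs = lpos w t + 1" using lpos_st[of t] assms(1) by (simp add: st_def)
  ultimately show ?thesis using assms(2) by (simp add: bit_def nth_append)
qed

lemma same_iff:
  assumes t: "t < length ls" and s: "s < length ls"
  shows "same w t s \<longleftrightarrow> snd (ls ! t) = snd (ls ! s)"
proof -
  have l: "lpos w (t + 1) - lpos w t - 1 = length (enc_nat (snd (ls ! t)))"
    using lpos_st[of t] lpos_st[of "Suc t"] st_Suc[OF t] t by simp
  show ?thesis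
  proof
    assume eq: "same w t s"
    show "snd (ls ! t) = snd (ls ! s)"
    proof (rule enc_nat_prefix_free)
      fix k assume k: "k < length (enc_nat (snd (ls ! t)))" "k < length (enc_nat (snd (ls ! s)))"
      show "enc_nat (snd (ls ! t)) ! k = enc_nat (snd (ls ! s)) ! k"
        using eq k bit_var[OF t k(1)] bit_var[OF s k(2)] unfolding same_def l by blast
    qed
  next
    assume eq: "snd (ls ! t) = snd (ls ! s)"
    show "same w t s" unfolding same_def l
    proof (intro allI impI)
      fix k assume k: "k < length (enc_nat (snd (ls ! t)))"
      show "bit w (lpos w t + 1 + k) = bit w (lpos w s + 1 + k)"
        using bit_var[OF t k] bit_var[OF s, of k] k unfolding eq by blast
    qed
  qed
qed

definition idx :: "nat \<Rightarrow> nat" where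
  "idx v = (LEAST s. s < length ls \<and> snd (ls ! s) = v)"

lemma idx:
  assumes "v \<in> snd ` set ls" shows "idx v < length ls" "snd (ls ! idx v) = v"
proof -
  obtain l where l: "l \<in> set ls" "v = snd l" using assms by blast
  then obtain s where "s < length ls" "ls ! s = l" by (meson in_set_conv_nth)
  then have "s < length ls \<and> snd (ls ! s) = v" using l by simp
  then have "idx v < length ls \<and> snd (ls ! idx v) = v" unfolding idx_def by (rule LeastI)
  then show "idx v < length ls" "snd (ls ! idx v) = v" by auto
qed

lemma idx_le: "t < length ls \<Longrightarrow> idx (snd (ls ! t)) \<le> t"
  unfolding idx_def by (rule Least_le) simp

lemma vid_idx:
  assumes t: "t < length ls" shows "vid w t = idx (snd (ls ! t))"
proof -
  let ?v = "snd (ls ! t)"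
  have v: "?v \<in> snd ` set ls" using t by simp
  have "(\<forall>s<i + 1. \<not> same w t s) \<longleftrightarrow> i < idx ?v" if i: "i < t" for i
  proof
    assume *: "\<forall>s<i + 1. \<not> same w t s"
    show "i < idx ?v"
    proof (rule ccontr)
      assume "\<not> i < idx ?v"
      then have "\<not> same w t (idx ?v)" using * by simp
      then show False using same_iff[OF t idx(1)[OF v]] idx(2)[OF v] by simp
    qed
  next
    assume *: "i < idx ?v"
    show "\<forall>s<i + 1. \<not> same w t s"
    proof (intro allI impI)
      fix s assume s: "s < i + 1"
      then have sl: "s < length ls" using i t by simp
      have "\<not> (s < length ls \<and> snd (ls ! s) = ?v)" using s * unfolding idx_def by (intro not_less_Least) simp
      then show "\<not> same w t s" using same_iff[OF t sl] sl by auto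
    qed
  qed
  then have "vid w t = (\<Sum>i<t. of_bool (i < idx ?v))" unfolding vid_def by (intro sum.cong) auto
  also have "\<dots> = card ({..<t} \<inter> {i. i < idx ?v})" by (simp add: of_bool_def sum.If_cases)
  also have "{..<t} \<inter> {i. i < idx ?v} = {..<idx ?v}" using idx_le[OF t] by auto
  finally show ?thesis by simp
qed

abbreviation "n \<equiv> length w"

definition m :: "nat \<Rightarrow> nat" where
  "m v = nthp (Yb n) (idx v)"

lemma pr_m: "t < length ls \<Longrightarrow> pr w t = m (snd (ls ! t))"
  by (simp add: pr_def m_def vid_idx)

lemma length_ls_le: "length ls \<le> n"
proof -
  have "length xs \<le> length (concat (map enc_literal xs))" for xs
    by (induction xs) (auto simp: enc_literal_def)
  from this[of ls] show ?thesis by (simp add: w_eq)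
qed

text \<open>A formula has at most \<open>n\<close> literal occurrences, and there are more than
  \<open>n\<close> primes up to \<open>Yb n\<close>.\<close>

lemma m:
  assumes "v \<in> snd ` set ls"
  shows "prime (m v)" "m v \<le> Yb n" "pcount (m v) = idx v"
proof -
  have "idx v < pcount (Suc (Yb n))" using idx(1)[OF assms] length_ls_le pcount_Yb[of n] by linarith
  from nthp[OF this] show "prime (m v)" "m v \<le> Yb n" "pcount (m v) = idx v" by (simp_all add: m_def)
qed

lemma m_coprime:
  assumes "v \<in> snd ` set ls" "v' \<in> snd ` set ls" "v \<noteq> v'"
  shows "coprime (m v) (m v')"
proof -
  have "idx v \<noteq> idx v'" using idx(2)[OF assms(1)] idx(2)[OF assms(2)] assms(3) by metis
  then have "m v \<noteq> m v'" using m(3)[OF assms(1)] m(3)[OF assms(2)] by auto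
  then show ?thesis using m(1) assms by (simp add: primes_coprime)
qed

lemma concat_triples:
  "length (concat (map clause_lits cs)) = 3 * length cs \<and>
   (\<forall>i<length cs. \<forall>k<3. concat (map clause_lits cs) ! (3 * i + k) = clause_lits (cs ! i) ! k)"
proof (induction cs)
  case (Cons c cs)
  have l: "length (clause_lits c) = 3" by (cases c) simp
  show ?case
  proof (intro conjI allI impI)
    show "length (concat (map clause_lits (c # cs))) = 3 * length (c # cs)" using Cons l by simp
    fix i k :: nat assume i: "i < length (c # cs)" and k: "k < 3"
    show "concat (map clause_lits (c # cs)) ! (3 * i + k) = clause_lits ((c # cs) ! i) ! k"
    proof (cases i)
      case 0
      then show ?thesis using k l by (simp add: nth_append)
    next
      case (Suc i')
      then have "3 * i + k - 3 = 3 * i' + k" by simp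
      then show ?thesis using Cons i k l Suc by (simp add: nth_append)
    qed
  qed
qed simp

lemma length_ls: "length ls = 3 * length (snd \<phi>)"
  using concat_triples by (simp add: ls_def)

lemma sat_iff: "satisfiable \<phi> \<longleftrightarrow> (\<exists>a. \<forall>i<length (snd \<phi>). \<exists>k<3. a (snd (ls ! (3 * i + k))) = fst (ls ! (3 * i + k)))"
proof -
  have "(\<exists>lit \<in> set (clause_lits (snd \<phi> ! i)). a (snd lit) = fst lit) \<longleftrightarrow>
    (\<exists>k<3. a (snd (ls ! (3 * i + k))) = fst (ls ! (3 * i + k)))" if "i < length (snd \<phi>)" for a i
  proof -
    have l: "length (clause_lits (snd \<phi> ! i)) = 3" by (cases "snd \<phi> ! i") simp
    have "(\<exists>lit \<in> set (clause_lits (snd \<phi> ! i)). a (snd lit) = fst lit) \<longleftrightarrow>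
      (\<exists>k<3. a (snd (clause_lits (snd \<phi> ! i) ! k)) = fst (clause_lits (snd \<phi> ! i) ! k))"
      unfolding in_set_conv_nth Bex_def l by blast
    then show ?thesis using concat_triples[of "snd \<phi>"] that unfolding ls_def by auto
  qed
  moreover have "(\<forall>cl \<in> set (snd \<phi>). P cl) \<longleftrightarrow> (\<forall>i<length (snd \<phi>). P (snd \<phi> ! i))" for P
    by (simp add: all_set_conv_all_nth)
  ultimately show ?thesis unfolding satisfiable_def by simp
qed

lemma flj_clause:
  assumes "flj w j"
  obtains i where "i = j div Bb n" "i < length (snd \<phi>)" "mdj w j = m (snd (ls ! (3 * i))) * (m (snd (ls ! (3 * i + 1))) * m (snd (ls ! (3 * i + 2))))"
    "\<forall>k<3. fst (ls ! (3 * i + k)) \<noteq> (rrj w j mod m (snd (ls ! (3 * i + k))) \<noteq> 0)"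
proof -
  define i where "i = j div Bb n"
  have "lpos w (3 * i) < n" and k: "\<forall>k<3. bit w (lpos w (3 * i + k)) \<noteq> (rrj w j mod pr w (3 * i + k) \<noteq> 0)"
    using assms unfolding flj_def Let_def i_def by auto
  then have i: "i < length (snd \<phi>)" unfolding lpos_less_iff length_ls by simp
  have l: "3 * i + k < length ls" if "k < 3" for k using i that unfolding length_ls by simp
  show ?thesis
  proof (rule that[OF i_def i])
    show "mdj w j = m (snd (ls ! (3 * i))) * (m (snd (ls ! (3 * i + 1))) * m (snd (ls ! (3 * i + 2))))"
      unfolding mdj_def Let_def i_def[symmetric] using l[of 0] l[of 1] l[of 2] by (simp add: pr_m)
    show "\<forall>k<3. fst (ls ! (3 * i + k)) \<noteq> (rrj w j mod m (snd (ls ! (3 * i + k))) \<noteq> 0)"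
      using k bit_sign[OF l] pr_m[OF l] by simp
  qed
qed

lemma ls_var: "i < length (snd \<phi>) \<Longrightarrow> k < 3 \<Longrightarrow> snd (ls ! (3 * i + k)) \<in> snd ` set ls"
  using length_ls by simp

lemma prod3_le: "a \<le> Y \<Longrightarrow> b \<le> Y \<Longrightarrow> c \<le> Y \<Longrightarrow> a * (b * c) \<le> Y * (Y * (Y::nat))"
  by (intro mult_le_mono)

lemma mdj_bounds:
  assumes "flj w j" shows "0 < mdj w j" "mdj w j \<le> Bb n"
proof -
  obtain i where i: "i < length (snd \<phi>)" and md: "mdj w j = m (snd (ls ! (3 * i))) * (m (snd (ls ! (3 * i + 1))) * m (snd (ls ! (3 * i + 2))))"
    by (rule flj_clause[OF assms])
  have v: "snd (ls ! (3 * i)) \<in> snd ` set ls" "snd (ls ! (3 * i + 1)) \<in> snd ` set ls" "snd (ls ! (3 * i + 2)) \<in> snd ` set ls"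
    using ls_var[OF i, of 0] ls_var[OF i, of 1] ls_var[OF i, of 2] by auto
  show "0 < mdj w j" unfolding md using prime_gt_0_nat[OF m(1)[OF v(1)]] prime_gt_0_nat[OF m(1)[OF v(2)]]
    prime_gt_0_nat[OF m(1)[OF v(3)]] by simp
  show "mdj w j \<le> Bb n" unfolding md Bb_def using m(2)[OF v(1)] m(2)[OF v(2)] m(2)[OF v(3)] by (rule prod3_le)
qed

lemma mdj_dvd:
  assumes "mdj w j = m (snd (ls ! (3 * i))) * (m (snd (ls ! (3 * i + 1))) * m (snd (ls ! (3 * i + 2))))" "k < 3"
  shows "m (snd (ls ! (3 * i + k))) dvd mdj w j"
proof -
  have "k = 0 \<or> k = 1 \<or> k = 2" using assms(2) by auto
  then show ?thesis unfolding assms(1) by (auto intro: dvd_mult)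
qed

text \<open>If the assignment read off from \<open>X\<close> falsified a clause, then the residue of
  \<open>X\<close> modulo the three primes would itself be a forbidden one.\<close>

theorem red_feasible_imp_sat:
  assumes "ip_feasible (red w) \<noteq> {}" shows "satisfiable \<phi>"
proof -
  obtain x where x: "x \<in> ip_feasible (red w)" using assms by blast
  obtain X where X: "\<And>j. j < JJ n \<Longrightarrow> flj w j \<Longrightarrow> X mod mdj w j \<noteq> rrj w j mod mdj w j"
    by (rule gip_feasible_imp[OF hh_pos x[unfolded red_def]]) (use mdj_bounds Bb_less[of n] in force)+
  define a where "a v = (X mod m v \<noteq> 0)" for v
  have "\<exists>k<3. a (snd (ls ! (3 * i + k))) = fst (ls ! (3 * i + k))" if i: "i < length (snd \<phi>)" for i
  proof (rule ccontr)
    assume neg: "\<not> ?thesis"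
    let ?p = "\<lambda>k. m (snd (ls ! (3 * i + k)))"
    define M where "M = ?p 0 * (?p 1 * ?p 2)"
    \<comment> \<open>The block that excludes exactly the residue class of \<open>X\<close> for
      clause \<open>i\<close>.\<close>
    define j where "j = i * Bb n + X mod M"
    have v: "\<And>k. k < 3 \<Longrightarrow> snd (ls ! (3 * i + k)) \<in> snd ` set ls" by (rule ls_var[OF i])
    have p0: "0 < ?p k" if "k < 3" for k using prime_gt_0_nat[OF m(1)[OF v[OF that]]] .
    have M0: "0 < M" unfolding M_def using p0[of 0] p0[of 1] p0[of 2] by simp
    have "M \<le> Bb n" unfolding M_def Bb_def using m(2)[OF v[of 0]] m(2)[OF v[of 1]] m(2)[OF v[of 2]] by (intro prod3_le) auto
    moreover have "X mod M < M" using M0 by simp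
    ultimately have XB: "X mod M < Bb n" by linarith
    then have jd: "j div Bb n = i" "j mod Bb n = X mod M" unfolding j_def by (simp_all only: digit_div digit_mod)
    have "i < n" using i length_ls length_ls_le by simp
    then have "Suc i * Bb n \<le> n * Bb n" by (intro mult_le_mono1) simp
    then have jJ: "j < JJ n" using XB unfolding j_def JJ_def by simp
    have l: "3 * i + k < length ls" if "k < 3" for k using i that unfolding length_ls by simp
    have md: "mdj w j = M" unfolding mdj_def Let_def jd M_def using l[of 0] l[of 1] l[of 2] by (simp add: pr_m)
    have rr: "rrj w j = X mod M" by (simp add: rrj_def jd)
    have fl: "flj w j"
      unfolding flj_def Let_def jd
    proof (intro conjI allI impI)
      show "lpos w (3 * i) < length w" using l[of 0] by (simp add: lpos_less_iff)
      fix k :: nat assume k: "k < 3"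
      have "k = 0 \<or> k = 1 \<or> k = 2" using k by auto
      then have "?p k dvd M" unfolding M_def by (auto intro: dvd_mult)
      then have "rrj w j mod ?p k = X mod ?p k" unfolding rr by (rule mod_mod_cancel)
      moreover have "a (snd (ls ! (3 * i + k))) \<noteq> fst (ls ! (3 * i + k))" using neg k by blast
      ultimately show "bit w (lpos w (3 * i + k)) \<noteq> (rrj w j mod pr w (3 * i + k) \<noteq> 0)"
        unfolding bit_sign[OF l[OF k]] pr_m[OF l[OF k]] a_def by auto
    qed
    show False using X[OF jJ fl] unfolding md rr by simp
  qed
  then show ?thesis unfolding sat_iff by blast
qed

theorem sat_imp_red_feasible:
  assumes "satisfiable \<phi>" shows "ip_feasible (red w) \<noteq> {}"
proof -
  obtain a where a: "\<And>i. i < length (snd \<phi>) \<Longrightarrow> \<exists>k<3. a (snd (ls ! (3 * i + k))) = fst (ls ! (3 * i + k))"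
    using assms unfolding sat_iff by blast
  let ?V = "snd ` set ls"
  define P where "P = (\<Prod>v\<in>?V. m v)"
  obtain X0 where X0: "\<And>v. v \<in> ?V \<Longrightarrow> [X0 = of_bool (a v)] (mod m v)"
    using chinese_remainder_nat[of ?V m "\<lambda>v. of_bool (a v)"] m_coprime by auto
  \<comment> \<open>Adding a multiple of \<open>P\<close> keeps all residues and lifts
    \<open>X\<close> above every forbidden residue \<open>rrj w j < Bb n\<close>.\<close>
  define X where "X = Bb n * P + X0 mod P"
  have P0: "P > 0" unfolding P_def using prime_gt_0_nat[OF m(1)] by (intro prod_pos) auto
  have "P \<le> (\<Prod>v\<in>?V. Yb n)" unfolding P_def by (rule prod_mono) (use m(2) in auto)
  also have "\<dots> = Yb n ^ card ?V" by simp
  also have "\<dots> \<le> Yb n ^ n"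
  proof (rule power_increasing)
    have "card ?V \<le> card (set ls)" by (rule card_image_le) simp
    also have "\<dots> \<le> length ls" by (rule card_length)
    finally show "card ?V \<le> n" using length_ls_le by simp
  qed (simp add: Yb_def)
  finally have PY: "P \<le> Yb n ^ n" .
  have Xm: "X mod m v \<noteq> 0 \<longleftrightarrow> a v" if v: "v \<in> ?V" for v
  proof -
    have d: "m v dvd P" unfolding P_def by (rule dvd_prodI) (use v in auto)
    then have "X mod m v = X0 mod P mod m v" unfolding X_def by (metis dvd_mult mod_add_cong mod_mod_trivial dvd_imp_mod_0 add_0)
    also have "\<dots> = X0 mod m v" by (rule mod_mod_cancel[OF d])
    also have "\<dots> = of_bool (a v) mod m v" using X0[OF v] by (simp add: unique_euclidean_semiring_class.cong_def)
    finally show ?thesis using prime_gt_1_nat[OF m(1)[OF v]] by (auto simp: of_bool_def)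
  qed
  let ?h = "hh n" and ?T = "2^hh n :: nat"
  have "ip_feasible (gip ?h (JJ n) (mdj w) (rrj w) (flj w) (2^Ue n - 1)) \<noteq> {}"
  proof (rule gip_feasibleI[OF hh_pos, where X = X])
    fix j assume "j < JJ n" "flj w j"
    then show "0 < mdj w j \<and> mdj w j < 2^(?T - 1)" using mdj_bounds[of j] Bb_less[of n] by linarith
  next
    fix j assume j: "j < JJ n" "flj w j"
    have "rrj w j < Bb n" unfolding rrj_def using Bb_pos by simp
    also have "\<dots> \<le> Bb n * P" using P0 by simp
    also have "\<dots> \<le> X" unfolding X_def by simp
    finally have 1: "rrj w j < X" .
    have 2: "X mod mdj w j \<noteq> rrj w j mod mdj w j"
    proof
      assume eq: "X mod mdj w j = rrj w j mod mdj w j"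
      obtain i where "i = j div Bb n" and i: "i < length (snd \<phi>)" and md: "mdj w j = m (snd (ls ! (3 * i))) * (m (snd (ls ! (3 * i + 1))) * m (snd (ls ! (3 * i + 2))))"
        and f: "\<forall>k<3. fst (ls ! (3 * i + k)) \<noteq> (rrj w j mod m (snd (ls ! (3 * i + k))) \<noteq> 0)"
        by (rule flj_clause[OF j(2)])
      obtain k where k: "k < 3" "a (snd (ls ! (3 * i + k))) = fst (ls ! (3 * i + k))" using a[OF i] by blast
      have d: "m (snd (ls ! (3 * i + k))) dvd mdj w j" by (rule mdj_dvd[OF md k(1)])
      have "X mod m (snd (ls ! (3 * i + k))) = rrj w j mod m (snd (ls ! (3 * i + k)))"
        using eq mod_mod_cancel[OF d] by metis
      then show False using f[rule_format, OF k(1)] Xm[OF ls_var[OF i k(1)]] k(2) by auto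
    qed
    show "rrj w j < X \<and> X mod mdj w j \<noteq> rrj w j mod mdj w j" using 1 2 by blast
  next
    have T1: "bl (Bb n) < ?T" unfolding hh_def by (rule bl_less)
    have "Bb n < 2^bl (Bb n)" by (rule bl_less)
    then have B: "Bb n + 1 \<le> 2^bl (Bb n)" by simp
    also have "(2::nat)^bl (Bb n) \<le> 2^(?T - 1)" using T1 by (intro power_increasing) auto
    finally have B1: "Bb n + 1 \<le> 2^(?T - 1)" .
    have "Yb n \<le> Bb n" unfolding Bb_def by (simp add: Yb_def)
    also have "\<dots> \<le> 2^?T"
    proof -
      have "(2::nat)^(?T - 1) \<le> 2^?T" by (intro power_increasing) auto
      then show ?thesis using Bb_less[of n] by linarith
    qed
    finally have "Yb n ^ n \<le> (2^?T)^n" by (rule power_mono) simp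
    then have "P \<le> 2^(?T * n)" using PY by (simp add: power_mult)
    have "X0 mod P < P" using P0 by simp
    then have "X \<le> (Bb n + 1) * P" unfolding X_def by simp
    also have "\<dots> \<le> 2^(?T - 1) * 2^(?T * n)" by (rule mult_le_mono) fact+
    finally have "2^?T * X \<le> 2^?T * (2^(?T - 1) * 2^(?T * n))" by (rule mult_le_mono2)
    also have "\<dots> = 2^(?T + (?T - 1) + ?T * n)" by (simp only: power_add mult.assoc)
    also have "\<dots> < 2^Ue n"
    proof (rule power_strict_increasing)
      have "?T > 0" by simp
      then have "?T + (?T - 1) < ?T * 2" by linarith
      then show "?T + (?T - 1) + ?T * n < Ue n" unfolding Ue_def by (simp add: algebra_simps)
    qed simp
    finally show "2^?T * X \<le> 2^Ue n - 1" by simp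
  qed
  then show ?thesis by (simp add: red_def)
qed

end


section \<open>The reduction as a program\<close>

definition NOT :: "exp \<Rightarrow> exp" where "NOT a = COND a (Cn 0) (Cn 1)"
definition LESS :: "exp \<Rightarrow> exp \<Rightarrow> exp" where "LESS a b = COND (SUB b a) (Cn 1) (Cn 0)"
definition EQ :: "exp \<Rightarrow> exp \<Rightarrow> exp" where "EQ a b = NOT (ADD (SUB a b) (SUB b a))"

lemma eval_NOT [simp]: "eval w (NOT a) s = of_bool (eval w a s = 0)"
  by (simp add: NOT_def)
lemma eval_LESS [simp]: "eval w (LESS a b) s = of_bool (eval w a s < eval w b s)"
  by (simp add: LESS_def)
lemma eval_EQ [simp]: "eval w (EQ a b) s = of_bool (eval w a s = eval w b s)"
  by (auto simp: EQ_def)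

text \<open>The quotient counts the positive multiples of \<open>b\<close> up to \<open>a\<close>.
  The bound variable lies above all variables of both arguments, which prevents capture; the test of
  \<open>b\<close> yields the convention for division by zero.\<close>

definition DIV :: "exp \<Rightarrow> exp \<Rightarrow> exp" where
  "DIV a b = (let x = max (vb a) (vb b) in COND b
     (SIG x a (NOT (SUB (MUL (ADD (V x) (Cn 1)) b) a))) (Cn 0))"

lemma sum_div: "(\<Sum>i<a. of_bool ((i + 1) * b \<le> a)) = a div (b::nat)" if "b > 0"
proof -
  have "(i + 1) * b \<le> a \<longleftrightarrow> i < a div b" for i
    using that by (metis Suc_eq_plus1 Suc_le_eq less_eq_div_iff_mult_less_eq)
  moreover have "{..<a} \<inter> {i. i < a div b} = {..<a div b}"
    by (auto intro: less_le_trans[OF _ div_le_dividend])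
  ultimately show ?thesis by (simp add: of_bool_def sum.If_cases)
qed

lemma eval_DIV [simp]: "eval w (DIV a b) s = eval w a s div eval w b s"
proof (cases "eval w b s = 0")
  case True
  then show ?thesis by (simp add: DIV_def Let_def)
next
  case False
  let ?x = "max (vb a) (vb b)"
  have a: "eval w a (s(?x := i)) = eval w a s" for i by (rule eval_cong) auto
  have b: "eval w b (s(?x := i)) = eval w b s" for i by (rule eval_cong) auto
  have "eval w (DIV a b) s = (\<Sum>i<eval w a s. of_bool ((i + 1) * eval w b s \<le> eval w a s))"
    using False by (simp add: DIV_def Let_def a b)
  also have "\<dots> = eval w a s div eval w b s" using False by (intro sum_div) simp
  finally show ?thesis .
qed

definition MODE :: "exp \<Rightarrow> exp \<Rightarrow> exp" where "MODE a b = SUB a (MUL b (DIV a b))"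

lemma eval_MODE [simp]: "eval w (MODE a b) s = eval w a s mod eval w b s"
  by (simp add: MODE_def minus_mult_div_eq_mod)

lemma sum_of_bool_eq_0 [simp]: "(\<Sum>i<(n::nat). of_bool (P i)) = (0::nat) \<longleftrightarrow> (\<forall>i<n. \<not> P i)"
  by (auto simp del: sum_of_bool_eq)

declare sum_of_bool_eq [simp del] sum_mult_of_bool_eq [simp del] sum_of_bool_mult_eq [simp del] sum.lessThan_Suc [simp del]

text \<open>In every environment variable 0 holds the length of the input.\<close>

definition TSKIP :: exp where
  "TSKIP = ADD (ITER 2 (V 0) (V 1) (COND (INP (V 2)) (ADD (V 2) (Cn 2)) (V 2)) 0) (Cn 1)"

lemma eval_TSKIP [simp]: "s 0 = length w \<Longrightarrow> eval w TSKIP s = tskip w (s 1)"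
  by (simp add: TSKIP_def tskip_def cong: if_cong)

text \<open>Expressions act as procedures with fixed argument variables, filled by
  \<open>LETX\<close>: 1 for \<open>TSKIP\<close>, 3 for \<open>POS\<close>, 5 and 6 for
  \<open>SAME\<close>, 11 for \<open>VID\<close> and \<open>PR\<close>. Local variables are numbered
  so that a caller's live values are not overwritten.\<close>

definition POS :: exp where
  "POS = ITER 4 (V 3) (LETX 1 (LETX 1 (Cn 0) TSKIP) TSKIP) (LETX 1 (ADD (V 4) (Cn 1)) TSKIP) 0"

lemma eval_POS [simp]: "s 0 = length w \<Longrightarrow> eval w POS s = lpos w (s 3)"
  by (simp add: POS_def lpos_def)

definition SAME :: exp where
  "SAME = LETX 7 (LETX 3 (V 5) POS) (LETX 8 (LETX 3 (ADD (V 5) (Cn 1)) POS) (LETX 9 (LETX 3 (V 6) POS)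
     (NOT (SIG 10 (SUB (SUB (V 8) (V 7)) (Cn 1)) (NOT (EQ (INP (ADD (ADD (V 7) (Cn 1)) (V 10)))
       (INP (ADD (ADD (V 9) (Cn 1)) (V 10)))))))))"

lemma eval_SAME [simp]: "s 0 = length w \<Longrightarrow> eval w SAME s = of_bool (same w (s 5) (s 6))"
  by (auto simp: SAME_def same_def)

definition VID :: exp where
  "VID = SIG 12 (V 11) (NOT (SIG 6 (ADD (V 12) (Cn 1)) (LETX 5 (V 11) SAME)))"

lemma eval_VID [simp]: "s 0 = length w \<Longrightarrow> eval w VID s = vid w (s 11)"
  by (simp add: VID_def vid_def)

definition PRIME :: exp where
  "PRIME = MUL (LESS (Cn 1) (V 13)) (NOT (SIG 14 (V 13) (MUL (LESS (Cn 1) (V 14)) (NOT (MODE (V 13) (V 14))))))"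

lemma prime_iff_no_divisor: "prime (p::nat) \<longleftrightarrow> 1 < p \<and> (\<forall>d<p. 1 < d \<longrightarrow> p mod d \<noteq> 0)"
proof
  assume p: "prime p"
  then show "1 < p \<and> (\<forall>d<p. 1 < d \<longrightarrow> p mod d \<noteq> 0)"
    using prime_gt_1_nat[OF p] by (auto simp: prime_nat_iff mod_eq_0_iff_dvd)
next
  assume *: "1 < p \<and> (\<forall>d<p. 1 < d \<longrightarrow> p mod d \<noteq> 0)"
  show "prime p" unfolding prime_nat_iff
  proof (intro conjI allI impI)
    fix d assume d: "d dvd p"
    then have "d \<le> p" "d > 0" using * by (auto intro: dvd_imp_le dest: dvd_pos_nat)
    moreover have "\<not> (d < p \<and> 1 < d)" using * d by (auto simp: mod_eq_0_iff_dvd)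
    ultimately show "d = 1 \<or> d = p" by linarith
  qed (use * in simp)
qed

lemma eval_PRIME [simp]: "eval w PRIME s = of_bool (prime (s 13))"
  unfolding prime_iff_no_divisor by (simp add: PRIME_def flip: of_bool_conj)

definition PCOUNT :: exp where "PCOUNT = SIG 13 (V 15) PRIME"

lemma eval_PCOUNT [simp]: "eval w PCOUNT s = pcount (s 15)"
  by (simp add: PCOUNT_def pcount_def)

definition YB :: exp where
  "YB = ADD (MUL (MUL (Cn 2) (ADD (V 0) (Cn 1))) (ADD (V 0) (Cn 1))) (Cn 1)"

lemma eval_YB [simp]: "eval w YB s = Yb (s 0)"
  by (simp add: YB_def Yb_def)

definition PR :: exp where
  "PR = LETX 16 VID (SIG 17 YB (NOT (SUB (LETX 15 (ADD (V 17) (Cn 1)) PCOUNT) (V 16))))"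

lemma eval_PR [simp]: "s 0 = length w \<Longrightarrow> eval w PR s = pr w (s 11)"
  by (simp add: PR_def pr_def nthp_def)

definition BB :: exp where "BB = LETX 18 YB (MUL (V 18) (MUL (V 18) (V 18)))"

lemma eval_BB [simp]: "eval w BB s = Bb (s 0)"
  by (simp add: BB_def Bb_def)

text \<open>Values must stay polynomial, so powers are computed up to a cap in variable 20. A cap of
  \<open>m + 1\<close> is enough to compare a power with \<open>m\<close> or to divide
  \<open>m\<close> by it.\<close>

definition POW :: exp where "POW = ITER 21 (V 19) (Cn 1) (ADD (V 21) (V 21)) 20"

lemma eval_POW [simp]: "s 20 > 0 \<Longrightarrow> eval w POW s = min (2^s 19) (s 20)"
proof -
  assume c: "s 20 > 0"
  have "((\<lambda>v. min (v + v) (s 20)) ^^ k) 1 = min (2^k) (s 20)" for k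
    by (induction k) (use c in \<open>auto simp: min_def\<close>)
  then show ?thesis by (simp add: POW_def)
qed

definition BL :: exp where
  "BL = SIG 19 (V 22) (LETX 20 (ADD (V 22) (Cn 1)) (NOT (SUB POW (V 22))))"

lemma eval_BL [simp]: "eval w BL s = bl (s 22)"
  by (simp add: BL_def bl_def min_le_iff_disj)

text \<open>The cap \<open>2 * b + 1\<close> with \<open>b = bl (Bb n)\<close> exceeds
  \<open>2 ^ bl b\<close>, so the exact power is obtained.\<close>

definition TT :: exp where
  "TT = LETX 23 (LETX 22 BB BL) (LETX 19 (LETX 22 (V 23) BL)
     (LETX 20 (ADD (ADD (V 23) (V 23)) (Cn 1)) POW))"

lemma eval_TT [simp]: "eval w TT s = 2^hh (s 0)"
proof -
  let ?b = "bl (Bb (s 0))"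
  have "2^bl ?b \<le> 2 * ?b" by (rule bl_le[OF bl_pos[OF Bb_pos]])
  then have "min (2^bl ?b) (Suc (?b + ?b)) = 2^bl ?b" by simp
  then show ?thesis by (simp add: TT_def hh_def)
qed

text \<open>From here on, variables 24 and 25 hold the parameters \<open>2^hh n\<close> and \<open>Bb n\<close>.\<close>

definition good :: "bool list \<Rightarrow> (nat \<Rightarrow> nat) \<Rightarrow> bool" where
  "good w s \<longleftrightarrow> s 0 = length w \<and> s 24 = 2^hh (length w) \<and> s 25 = Bb (length w)"

lemma good_simps: "good w s \<Longrightarrow> s 0 = length w" "good w s \<Longrightarrow> s 24 = 2^hh (length w)" "good w s \<Longrightarrow> s 25 = Bb (length w)"
  by (simp_all add: good_def)

lemma good_upd [simp]: "x \<noteq> 0 \<Longrightarrow> x \<noteq> 24 \<Longrightarrow> x \<noteq> 25 \<Longrightarrow> good w (s(x := v)) \<longleftrightarrow> good w s"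
  by (simp add: good_def)

definition PRE :: exp where
  "PRE = SIG 27 (V 24) (COND (MUL (NOT (MODE (V 24) (V 27))) (MODE (V 26) (V 27)))
     (COND (MODE (DIV (V 26) (V 27)) (Cn 2)) (V 27) (Cn 1)) (Cn 0))"

lemma eval_PRE [simp]: "good w s \<Longrightarrow> eval w PRE s = pre (hh (length w)) (s 26)"
  unfolding PRE_def pre_def by (simp add: good_simps odd_iff_mod_2_eq_one cong: if_cong)

definition MD :: exp where
  "MD = LETX 29 (MUL (Cn 3) (DIV (V 28) (V 25))) (MUL (LETX 11 (V 29) PR)
     (MUL (LETX 11 (ADD (V 29) (Cn 1)) PR) (LETX 11 (ADD (V 29) (Cn 2)) PR)))"

lemma eval_MD [simp]: "good w s \<Longrightarrow> eval w MD s = mdj w (s 28)"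
  by (simp add: MD_def mdj_def good_simps Let_def)

definition RR :: exp where "RR = MODE (V 28) (V 25)"

lemma eval_RR [simp]: "good w s \<Longrightarrow> eval w RR s = rrj w (s 28)"
  by (simp add: RR_def rrj_def good_simps)

definition AGREE :: exp where
  "AGREE = EQ (INP (LETX 3 (V 11) POS)) (NOT (NOT (MODE (V 30) PR)))"

lemma eval_AGREE [simp]:
  "good w s \<Longrightarrow> eval w AGREE s = of_bool (bit w (lpos w (s 11)) = (s 30 mod pr w (s 11) \<noteq> 0))"
  by (simp add: AGREE_def good_simps)

definition FL :: exp where
  "FL = LETX 29 (MUL (Cn 3) (DIV (V 28) (V 25))) (LETX 30 RR (MUL (LESS (LETX 3 (V 29) POS) (V 0))
     (NOT (SIG 31 (Cn 3) (LETX 11 (ADD (V 29) (V 31)) AGREE)))))"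

lemma eval_FL [simp]: "good w s \<Longrightarrow> eval w FL s = of_bool (flj w (s 28))"
proof -
  assume g: "good w s"
  let ?t = "3 * (s 28 div Bb (length w))"
  have "eval w FL s = of_bool (lpos w ?t < length w) *
    of_bool (\<forall>k<3. \<not> (bit w (lpos w (?t + k)) = (rrj w (s 28) mod pr w (?t + k) \<noteq> 0)))"
    using g by (simp add: FL_def good_simps del: of_bool_eq_iff)
  then show ?thesis unfolding flj_def Let_def by (simp only: of_bool_conj)
qed

definition HIT :: exp where
  "HIT = MUL (MUL (LESS (Cn 0) (V 26)) (LESS (V 26) (V 24))) (EQ (V 35) PRE)"

lemma eval_HIT [simp]: "good w s \<Longrightarrow> eval w HIT s = of_bool (hit (hh (length w)) (s 35) (s 26))"
  by (simp add: HIT_def hit_def good_simps Suc_le_eq flip: of_bool_conj)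

definition SPEC :: exp where
  "SPEC = MUL FL (MUL (EQ (V 36) (Cn 1)) (EQ (V 35) (LETX 26 (Cn 1) PRE)))"

lemma eval_SPEC [simp]: "good w s \<Longrightarrow> eval w SPEC s = of_bool (special (hh (length w)) (flj w) (s 28) (s 35) (s 36))"
  by (simp add: SPEC_def special_def flip: of_bool_conj)

primrec outs :: "bool list \<Rightarrow> stm" where
  "outs [] = NOP"
| "outs (b # bs) = SEQ (OUT b) (outs bs)"

lemma sem_outs [simp]: "sem w (outs bs) s = bs"
  by (induction bs) simp_all

definition O0 :: stm where "O0 = outs [False, False]"
definition P1 :: stm where "P1 = outs [False, True, True, False]"
definition M1 :: stm where "M1 = outs [True, True, True, False]"
definition M2 :: stm where "M2 = outs [True, True, False, True, True, False]"

lemma enc_nat_0: "enc_nat 0 = [False]" and enc_nat_1: "enc_nat 1 = [True, True, False]"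
  and enc_nat_2: "enc_nat 2 = [True, False, True, True, False]"
  by (simp_all add: enc_nat_def binary_0 binary_pos)

lemma sem_ints [simp]: "sem w O0 s = enc_int 0" "sem w P1 s = enc_int 1" "sem w M1 s = enc_int (-1)"
  "sem w M2 s = enc_int (-2)"
  using enc_nat_0 enc_nat_1 enc_nat_2 by (simp_all add: O0_def P1_def M1_def M2_def enc_int_def)

text \<open>Any number \<open>k\<close> of candidate digits that is large enough gives the same
  list, because those above the leading digit are suppressed. This lets a loop of generous length
  print the digits.\<close>

lemma binary_bits: "n < 2^k \<Longrightarrow> binary n = concat (map (\<lambda>i. if 2^i \<le> n then [odd (n div 2^i)] else []) [0..<k])"
proof (induction k arbitrary: n)
  case 0
  then show ?case by (simp add: binary_0)
next
  case (Suc k)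
  show ?case
  proof (cases "n = 0")
    case False
    have IH: "binary (n div 2) = concat (map (\<lambda>i. if 2^i \<le> n div 2 then [odd (n div 2 div 2^i)] else []) [0..<k])"
      by (rule Suc.IH) (use Suc.prems in simp)
    have "2^i \<le> n div 2 \<longleftrightarrow> 2^Suc i \<le> n" for i
      by (simp add: less_eq_div_iff_mult_less_eq mult.commute)
    moreover have "n div 2 div 2^i = n div 2^Suc i" for i by (simp add: div_mult2_eq)
    ultimately have "binary (n div 2) = concat (map (\<lambda>i. if 2^Suc i \<le> n then [odd (n div 2^Suc i)] else []) [0..<k])"
      unfolding IH by presburger
    then show ?thesis using False unfolding binary_pos[OF False]
      by (simp add: upt_conv_Cons map_Suc_upt[symmetric] comp_def del: upt_Suc)
  qed (simp add: binary_0)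
qed

lemma concat_pairs:
  "concat (map (\<lambda>i. if P i then [True, f i] else []) xs) = pairs (concat (map (\<lambda>i. if P i then [f i] else []) xs))"
  by (induction xs) auto

text \<open>Running over all \<open>i < n\<close> covers every digit since \<open>n < 2^n\<close>.
  Variable 39 is \<open>2^i\<close> capped at \<open>n + 1\<close>, so it exceeds \<open>n\<close>
  exactly for the positions to be suppressed.\<close>

definition ENCN :: "exp \<Rightarrow> stm" where
  "ENCN e = LETS 37 e (SEQ (FOR 38 (V 37) (LETS 39 (LETX 19 (V 38) (LETX 20 (ADD (V 37) (Cn 1)) POW))
     (IFS (SUB (V 39) (V 37)) NOP (SEQ (OUT True) (IFS (MODE (DIV (V 37) (V 39)) (Cn 2)) (OUT True) (OUT False))))))
     (OUT False))"

lemma sem_ENCN [simp]: "sem w (ENCN e) s = enc_nat (eval w e s)"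
proof -
  define n where "n = eval w e s"
  have "sem w (ENCN e) s = concat (map (\<lambda>i. if 2^i \<le> n then [True, odd (n div 2^i)] else []) [0..<n]) @ [False]"
    unfolding ENCN_def n_def[symmetric]
    by (auto simp: n_def[symmetric] odd_iff_mod_2_eq_one min_def not_le intro!: arg_cong[where f = concat] map_cong)
  also have "concat (map (\<lambda>i. if 2^i \<le> n then [True, odd (n div 2^i)] else []) [0..<n])
    = concat (map (\<lambda>b. [True, b]) (concat (map (\<lambda>i. if 2^i \<le> n then [odd (n div 2^i)] else []) [0..<n])))"
    by (rule concat_pairs)
  also have "concat (map (\<lambda>i. if 2^i \<le> n then [odd (n div 2^i)] else []) [0..<n]) = binary n"
    by (rule binary_bits[symmetric]) simp
  finally show ?thesis by (simp add: enc_nat_def n_def)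
qed

definition ENCU :: stm where
  "ENCU = SEQ (OUT False) (SEQ (FOR 38 (MUL (V 24) (ADD (V 0) (Cn 2))) (SEQ (OUT True) (OUT True))) (OUT False))"

lemma binary_two_power: "binary (2^k - 1) = replicate k True"
proof (induction k)
  case (Suc k)
  have "(1::nat) \<le> 2^k" by simp
  then have "(2::nat)^Suc k - 1 = 2 * (2^k - 1) + 1" unfolding power_Suc by linarith
  then have "odd ((2::nat)^Suc k - 1)" "((2::nat)^Suc k - 1) div 2 = 2^k - 1" by simp_all
  then show ?case using Suc binary_pos[of "2^Suc k - 1"] by (metis even_zero replicate_Suc)
qed (simp add: binary_0)

lemma enc_int_nat: "enc_int (int n) = False # enc_nat n"
  by (simp add: enc_int_def)

lemma sem_ENCU [simp]: "good w s \<Longrightarrow> sem w ENCU s = enc_int (int (2^Ue (length w) - 1))"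
proof -
  assume g: "good w s"
  have "concat (map (\<lambda>i. [True, True]) [0..<k]) = concat (map (\<lambda>b. [True, b]) (replicate k True))" for k
    by (simp add: map_replicate_const)
  then show ?thesis unfolding enc_int_nat enc_nat_def binary_two_power Ue_def
    using g by (simp add: ENCU_def good_simps)
qed

definition GLOB :: stm where
  "GLOB = IFS (MUL (EQ (V 33) (Cn 1)) (EQ (ADD (V 32) (Cn 1)) (V 24))) P1 O0"

lemma sem_GLOB [simp]: "good w s \<Longrightarrow> sem w GLOB s = enc_int (glob (hh (length w)) (s 32) (s 33))"
  by (simp add: GLOB_def glob_def good_simps)

text \<open>The loops of \<open>RED\<close> set these variables: 28, 32, 33 are block, edge and
  equation of the row, and 34, 35, 36 are block, position and variable of the column.\<close>

definition CELL :: stm where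
  "CELL = IFS (EQ (V 28) (V 34))
     (IFS (LETX 26 (V 32) HIT)
       (IFS (V 33)
         (IFS (V 36) M1 (IFS (MODE (DIV MD (LETX 19 (SUB (V 32) (Cn 1)) (LETX 20 (ADD MD (Cn 1)) POW))) (Cn 2)) M1 O0))
         (IFS (MUL (NOT (V 36)) (LESS (ADD (V 32) (Cn 1)) (V 24))) M2 O0))
       (IFS (LETX 26 (ADD (V 32) (Cn 1)) HIT)
         (IFS (MUL (LESS (Cn 0) (V 32)) (EQ (V 36) (V 33))) P1 O0) O0)) O0"

lemma div_min_two_power: "(m::nat) div min (2^k) (Suc m) = m div 2^k"
  by (simp add: min_def)

lemma sem_CELL [simp]:
  assumes g: "good w s"
  shows "sem w CELL s = enc_int (if s 28 = s 34 then cell (hh (length w)) (mdj w) (s 28) (s 32) (s 33) (s 35) (s 36) else 0)"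
proof -
  have "int (m mod 2) = (if m mod 2 = 0 then 0 else 1)" for m by (cases "even m") (simp_all add: odd_iff_mod_2_eq_one)
  then show ?thesis using g
    by (simp add: CELL_def cell_def cA_def cB_def div_min_two_power good_simps Suc_le_eq)
qed

definition JE :: exp where "JE = MUL (V 0) (V 25)"
definition WE :: exp where "WE = SUB (V 24) (Cn 1)"
definition NR :: exp where "NR = MUL JE (MUL (V 24) (Cn 2))"
definition NC :: exp where "NC = ADD (Cn 1) (MUL JE (MUL WE (Cn 2)))"

lemma eval_dims [simp]:
  assumes "good w s"
  shows "eval w JE s = JJ (length w)" "eval w WE s = 2^hh (length w) - 1"
    "eval w NR s = JJ (length w) * (2^hh (length w) * 2)"
    "eval w NC s = 1 + JJ (length w) * ((2^hh (length w) - 1) * 2)"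
  using assms by (simp_all add: JE_def WE_def NR_def NC_def JJ_def good_simps)

definition RED :: stm where
  "RED = LETS 24 TT (LETS 25 BB (
     SEQ (ENCN NR) (SEQ (ENCN NC)
     (SEQ (FOR 28 JE (FOR 32 (V 24) (FOR 33 (Cn 2) (SEQ GLOB
        (FOR 34 JE (FOR 35 WE (FOR 36 (Cn 2) CELL)))))))
     (SEQ (FOR 28 NR O0) (SEQ (FOR 28 NC O0)
     (SEQ (SEQ O0 (FOR 28 JE (FOR 35 WE (FOR 36 (Cn 2)
        (IFS SPEC (SEQ (OUT False) (ENCN (ADD RR (Cn 1)))) O0)))))
       (SEQ ENCU (FOR 28 JE (FOR 35 WE (FOR 36 (Cn 2)
        (IFS SPEC (SEQ (OUT False) (ENCN (SUB (ADD RR MD) (Cn 1)))) ENCU))))))))))))"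

theorem sem_RED: "sem w RED ((\<lambda>_. 0)(0 := length w)) = enc_ip (red w)"
proof -
  let ?s = "((\<lambda>_. 0)(0 := length w))(24 := 2^hh (length w), 25 := Bb (length w)) :: nat \<Rightarrow> nat"
  have g: "good w ?s" by (simp add: good_def)
  have e24: "eval w TT ((\<lambda>_. 0)(0 := length w)) = 2^hh (length w)" by simp
  have e25: "eval w BB (((\<lambda>_. 0)(0 := length w))(24 := 2^hh (length w))) = Bb (length w)" by simp
  have i: "enc_int (int (if b then x else y)) = (if b then False # enc_nat x else enc_int (int y))" for b x y
    by (simp add: enc_int_nat)
  show ?thesis
    unfolding RED_def sem.simps(6) e24 e25 red_def enc_gip i
    using g by (simp add: good_simps cong: if_cong del: fun_upd_apply add: fun_upd_same fun_upd_other)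
qed

section \<open>Asymptotics\<close>

text \<open>With an exponent below 1 on the logarithm, \<open>2 powr (A * L powr (1/4))\<close> for
  \<open>L = log 2 (N + 2)\<close> grows slower than every power of \<open>N\<close>, so one more
  exponential stays below \<open>2 powr (\<delta> * N)\<close>.\<close>

lemma reduction_time_limit:
  fixes A \<delta> :: real
  assumes "A > 0" "\<delta> > 0"
  shows "(\<lambda>N. ((real N + 2) ^ D + 2 powr (2 powr (A * log 2 (real N + 2) powr (1/4))) * (real N + 2) ^ E)
     / 2 powr (\<delta> * real N)) \<longlonglongrightarrow> 0"
  using assms by real_asymp

text \<open>The constant has to serve every \<open>N\<close>, including small ones; a convergent
  sequence is bounded.\<close>

lemma reduction_time_bound:
  fixes A \<delta> :: real
  assumes "A > 0" "\<delta> > 0"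
  obtains K where "\<forall>N. (real N + 2) ^ D + 2 powr (2 powr (A * log 2 (real N + 2) powr (1/4))) * (real N + 2) ^ E
     \<le> K * 2 powr (\<delta> * real N)"
proof -
  let ?h = "\<lambda>N. ((real N + 2) ^ D + 2 powr (2 powr (A * log 2 (real N + 2) powr (1/4))) * (real N + 2) ^ E)
     / 2 powr (\<delta> * real N)"
  have "Bseq ?h" using reduction_time_limit[OF assms] by (intro convergent_imp_Bseq) (rule convergentI)
  then obtain K where K: "\<forall>N. norm (?h N) \<le> K" unfolding Bseq_def by blast
  show ?thesis
  proof (rule that[of K], rule allI)
    fix N
    have "?h N \<le> K" using K[rule_format, of N] by simp
    then show "(real N + 2) ^ D + 2 powr (2 powr (A * log 2 (real N + 2) powr (1/4))) * (real N + 2) ^ E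
      \<le> K * 2 powr (\<delta> * real N)" by (simp add: divide_le_eq)
  qed
qed

text \<open>Of sublinearity only a slope below 1 is used, since it becomes the exponent of
  \<open>log N\<close>; the constant \<open>c\<close> absorbs the finitely many exceptions.\<close>

lemma sublinear_bound:
  fixes f :: "nat \<Rightarrow> real"
  assumes "(\<lambda>t. f t / real t) \<longlonglongrightarrow> 0"
  obtains c where "c > 0" "\<And>t. f t \<le> real t / 4 + c"
proof -
  have "eventually (\<lambda>t. f t / real t < 1/4) sequentially"
    by (rule order_tendstoD(2)[OF assms]) simp
  then obtain t0 where t0: "\<And>t. t \<ge> t0 \<Longrightarrow> f t / real t < 1/4" by (auto simp: eventually_sequentially)
  define c where "c = 1 + (\<Sum>t\<le>t0. \<bar>f t\<bar>)"
  have c: "c > 0" unfolding c_def by (simp add: add_pos_nonneg sum_nonneg)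
  have "f t \<le> real t / 4 + c" for t
  proof (cases "t \<le> t0")
    case True
    have "\<bar>f t\<bar> \<le> (\<Sum>t\<le>t0. \<bar>f t\<bar>)" by (rule member_le_sum) (use True in auto)
    then show ?thesis unfolding c_def by simp
  next
    case False
    then have "f t / real t < 1/4" "real t > 0" using t0[of t] by auto
    then show ?thesis using c by (simp add: divide_less_eq)
  qed
  then show ?thesis using that c by blast
qed

section \<open>Sizes of encodings and the number of stages\<close>

lemma binary_length_lower: "n < 2 ^ length (binary n)"
proof (induction n rule: less_induct)
  case (less n)
  show ?case
  proof (cases "n = 0")
    case False
    then have "n div 2 < 2 ^ length (binary (n div 2))" using less.IH[of "n div 2"] by simp
    then show ?thesis using False binary_pos[of n] by simp
  qed simp
qed

lemma binary_length_upper: "length (binary n) \<le> n"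
proof (induction n rule: less_induct)
  case (less n)
  show ?case
  proof (cases "n = 0")
    case False
    then have "length (binary (n div 2)) \<le> n div 2" using less.IH[of "n div 2"] by simp
    then show ?thesis using False binary_pos[of n] by simp
  qed (simp add: binary_0)
qed

lemma enc_nat_length: "length (enc_nat n) = 2 * length (binary n) + 1"
  by (simp add: enc_nat_pairs length_pairs)

lemma length_concat_map_le:
  "(\<And>x. x \<in> set xs \<Longrightarrow> length (f x) \<le> b) \<Longrightarrow> length (concat (map f xs)) \<le> length xs * b"
  by (induction xs) (simp_all add: add_mono)

text \<open>Here the distinctness of the clauses enters: there are at most
  \<open>(2 * N) ^ 3\<close> of them.\<close>

lemma enc_cnf3_length:
  assumes wf: "wf_cnf3 (N, cs)"
  shows "length (enc_cnf3 (N, cs)) + 2 \<le> (N + 2) ^ 11"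
proof -
  let ?Lit = "(UNIV :: bool set) \<times> {..<N}"
  have "set cs \<subseteq> ?Lit \<times> (?Lit \<times> ?Lit)"
    using wf unfolding wf_cnf3_def by fastforce
  then have "card (set cs) \<le> card (?Lit \<times> (?Lit \<times> ?Lit))" by (intro card_mono) auto
  also have "\<dots> = (2 * N) * ((2 * N) * (2 * N))" by (simp add: card_cartesian_product)
  finally have "length cs \<le> 8 * N ^ 3"
    using wf by (simp add: wf_cnf3_def distinct_card power3_eq_cube)
  have lit: "length (enc_literal l) \<le> 2 * N + 2" if "snd l < N" for l
    using binary_length_upper[of "snd l"] that by (simp add: enc_literal_def enc_nat_length)
  have cl: "length (concat (map enc_literal (clause_lits c))) \<le> 3 * (2 * N + 2)" if "c \<in> set cs" for c
  proof -
    obtain l1 l2 l3 where c: "c = (l1, l2, l3)" by (cases c)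
    have "snd l1 < N" "snd l2 < N" "snd l3 < N" using wf that unfolding wf_cnf3_def c by auto
    then show ?thesis using lit[of l1] lit[of l2] lit[of l3] by (simp add: c)
  qed
  have "length (concat (map (\<lambda>c. concat (map enc_literal (clause_lits c))) cs)) \<le> length cs * (3 * (2 * N + 2))"
    using cl by (rule length_concat_map_le)
  then have "length (enc_cnf3 (N, cs)) \<le> (2 * N + 1) + (2 * length cs + 1) + length cs * (3 * (2 * N + 2))"
    using binary_length_upper[of N] binary_length_upper[of "length cs"]
    by (simp add: enc_cnf3_def enc_nat_length)
  also have "\<dots> = 2 * N + 2 + length cs * (6 * N + 8)" by (simp add: algebra_simps)
  finally have 1: "length (enc_cnf3 (N, cs)) \<le> 2 * N + 2 + length cs * (6 * N + 8)" .
  define a where "a = N + 2"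
  have a2: "2 \<le> a" by (simp add: a_def)
  have "N ^ 3 \<le> a ^ 3" by (rule power_mono) (auto simp: a_def)
  then have "length cs \<le> 8 * a ^ 3" using \<open>length cs \<le> 8 * N ^ 3\<close> by linarith
  then have "length cs * (6 * N + 8) \<le> (8 * a ^ 3) * (6 * a)" by (rule mult_le_mono) (simp add: a_def)
  also have "\<dots> = 48 * a ^ 4" by (simp add: power4_eq_xxxx power3_eq_cube)
  finally have "length (enc_cnf3 (N, cs)) + 2 \<le> 2 * a + 48 * a ^ 4" using 1 a_def by linarith
  also have "\<dots> \<le> 64 * a ^ 4"
  proof -
    have "a ^ 1 \<le> a ^ 4" by (rule power_increasing) (use a2 in auto)
    then show ?thesis unfolding power_one_right by linarith
  qed
  \<comment> \<open>Since \<open>2 \<le> a\<close>, the constant is traded for a higher power of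
    \<open>a\<close>.\<close>
  also have "\<dots> = 2 ^ 6 * a ^ 4" by simp
  also have "\<dots> \<le> a ^ 6 * a ^ 4" by (rule mult_le_mono1, rule power_mono[OF a2]) simp
  also have "\<dots> = a ^ (6 + 4)" by (rule power_add[symmetric])
  also have "\<dots> \<le> a ^ 11" by (rule power_increasing) (use a2 in auto)
  finally show ?thesis unfolding a_def .
qed

lemma Yb_le: "Yb n \<le> (n + 2) ^ 3"
  by (simp add: Yb_def power3_eq_cube algebra_simps)

text \<open>\<open>Bb n\<close> is at most \<open>(n + 2) ^ 9\<close>, thus at most the 99th power
  of \<open>N + 2\<close>; rounding up to a power of two makes this the 100th. The second rounding,
  in \<open>2 ^ hh n\<close>, doubles the factor.\<close>

lemma hh_upper:
  assumes "n + 2 \<le> (N + 2) ^ 11"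
  shows "2 ^ hh n \<le> 200 * log 2 (real N + 2)"
proof -
  define a where "a = N + 2"
  have "Bb n \<le> (n + 2) ^ 3 * ((n + 2) ^ 3 * (n + 2) ^ 3)"
    unfolding Bb_def by (intro mult_le_mono Yb_le)
  also have "\<dots> = (n + 2) ^ (3 + (3 + 3))" by (simp only: power_add)
  also have "\<dots> \<le> (a ^ 11) ^ (3 + (3 + 3))" using assms unfolding a_def by (rule power_mono) simp
  also have "\<dots> = a ^ (11 * (3 + (3 + 3)))" by (rule power_mult[symmetric])
  finally have "Bb n \<le> a ^ 99" by simp
  then have "2 * Bb n \<le> a * a ^ 99" by (rule mult_le_mono[rotated]) (simp add: a_def)
  also have "\<dots> = a ^ Suc 99" by (rule power_Suc[symmetric])
  finally have "2 * Bb n \<le> a ^ 100" by simp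
  then have "2 ^ bl (Bb n) \<le> a ^ 100"
    using bl_le[OF Bb_pos, of n] by (rule le_trans[rotated])
  then have "real (2 ^ bl (Bb n)) \<le> real (a ^ 100)" by (simp only: of_nat_le_iff)
  then have le: "2 ^ bl (Bb n) \<le> real a ^ 100" by (simp only: of_nat_power of_nat_numeral)
  have "log 2 (2 ^ bl (Bb n)) \<le> log 2 (real a ^ 100)"
    by (rule log_mono[OF _ _ le]) simp_all
  then have b: "real (bl (Bb n)) \<le> 100 * log 2 (real N + 2)"
    by (simp add: log_nat_power a_def add.commute)
  have "2 ^ hh n \<le> 2 * bl (Bb n)" unfolding hh_def by (rule bl_le[OF bl_pos[OF Bb_pos]])
  then have "real (2 ^ hh n) \<le> real (2 * bl (Bb n))" by (simp only: of_nat_le_iff)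
  then show ?thesis using b by simp
qed

lemma hh_lower:
  assumes "2 ^ (2 ^ k) \<le> n" shows "k < hh n"
proof -
  have "n \<le> Bb n"
  proof -
    have "n * 1 \<le> Yb n * (Yb n * Yb n)" by (intro mult_le_mono) (auto simp: Yb_def)
    then show ?thesis by (simp add: Bb_def)
  qed
  then have "(2::nat) ^ (2 ^ k) < 2 ^ bl (Bb n)" using assms bl_less[of "Bb n"] by linarith
  then have "2 ^ k < bl (Bb n)" by (rule power_less_imp_less_exp[rotated]) simp
  also have "\<dots> < 2 ^ hh n" unfolding hh_def by (rule bl_less)
  finally show ?thesis by (rule power_less_imp_less_exp[rotated]) simp
qed

lemma tm_outputs_mono: "tm_outputs M w v T \<Longrightarrow> T \<le> T' \<Longrightarrow> tm_outputs M w v T'"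
  unfolding tm_outputs_def by (meson order_trans)

lemma triple_exp_mono:
  fixes x y :: real
  assumes "x \<le> y" shows "2 powr (2 powr x) \<le> 2 powr (2 powr (y::real))"
  using assms by (intro powr_mono) auto

text \<open>Whatever optimal solution is returned, the first bit of the answer reports feasibility,
  which is satisfiability.\<close>

lemma solves_ip_decides:
  assumes wf: "wf_cnf3 \<phi>" and s: "solves_ip_in M (red (enc_cnf3 \<phi>)) T"
  obtains v where "v \<noteq> []" "hd v = satisfiable \<phi>"
    "tm_outputs M (sem (enc_cnf3 \<phi>) RED ((\<lambda>_. 0)(0 := length (enc_cnf3 \<phi>)))) v T"
proof -
  interpret formula \<phi> by (rule formula.intro[OF wf])
  obtain v where v: "ip_answer (red w) v" "tm_outputs M (enc_ip (red w)) v T"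
    using s unfolding solves_ip_in_def w_def by blast
  have "v \<noteq> [] \<and> hd v = satisfiable \<phi>"
  proof (cases "ip_feasible (red w) = {}")
    case True
    then have "v = [False]" using v(1) by (simp add: ip_answer_def)
    then show ?thesis using True sat_imp_red_feasible by auto
  next
    case False
    then obtain x where "v = True # enc_vec x" using v(1) unfolding ip_answer_def by auto
    then show ?thesis using False red_feasible_imp_sat by auto
  qed
  moreover have "tm_outputs M (sem (enc_cnf3 \<phi>) RED ((\<lambda>_. 0)(0 := length (enc_cnf3 \<phi>)))) v T"
    using v(2) unfolding sem_RED w_def .
  ultimately show ?thesis by (intro that[of v]) simp_all
qed

section \<open>The family of instances and its hardness\<close>

text \<open>Instances carry their stage sizes, because a matrix can be multi-stage for several lists
  of sizes.\<close>

definition family :: "(ip \<times> nat list) set" where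
  "family = {(red (enc_cnf3 \<phi>), 1 # replicate (hh (length (enc_cnf3 \<phi>))) 2) | \<phi>. wf_cnf3 \<phi>}"

lemma enc_cnf3_pos: "length (enc_cnf3 \<phi>) \<ge> 1"
  by (simp add: enc_cnf3_def enc_nat_length)

lemma family_multi_stage: "(I, \<sigma>) \<in> family \<Longrightarrow> wf_ip I \<and> multi_stage \<sigma> (ip_A I)"
proof -
  assume "(I, \<sigma>) \<in> family"
  then obtain \<phi> where I: "I = red (enc_cnf3 \<phi>)" "\<sigma> = 1 # replicate (hh (length (enc_cnf3 \<phi>))) 2"
    unfolding family_def by blast
  have "JJ (length (enc_cnf3 \<phi>)) \<ge> 1"
    using enc_cnf3_pos[of \<phi>] Bb_pos[of "length (enc_cnf3 \<phi>)"] by (simp add: JJ_def)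
  from multi_stage_Amat[OF hh_pos this] show ?thesis
    unfolding I using wf_gip by (simp add: red_def gip_def)
qed

lemma family_infinite: "infinite {length \<sigma> | I \<sigma>. (I, \<sigma>) \<in> family}"
  unfolding infinite_nat_iff_unbounded
proof
  fix k
  \<comment> \<open>Clauses are not necessary for long inputs: the binary code of the number of
    variables alone has more than \<open>2 ^ (2 ^ k)\<close> bits.\<close>
  define \<phi> :: cnf3 where "\<phi> = (2 ^ (2 ^ (2 ^ k)), [])"
  have wf: "wf_cnf3 \<phi>" by (simp add: \<phi>_def wf_cnf3_def)
  have "(2::nat) ^ (2 ^ (2 ^ k)) < 2 ^ length (binary (2 ^ (2 ^ (2 ^ k))))" by (rule binary_length_lower)
  then have "2 ^ (2 ^ k) < length (binary (2 ^ (2 ^ (2 ^ k))))" by (rule power_less_imp_less_exp[rotated]) simp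
  also have "\<dots> \<le> length (enc_cnf3 \<phi>)" by (simp add: \<phi>_def enc_cnf3_def enc_nat_length)
  finally have "k < hh (length (enc_cnf3 \<phi>))" by (intro hh_lower) simp
  then have "k < length (1 # replicate (hh (length (enc_cnf3 \<phi>))) (2::nat))" by simp
  moreover have "(red (enc_cnf3 \<phi>), 1 # replicate (hh (length (enc_cnf3 \<phi>))) 2) \<in> family"
    unfolding family_def using wf by blast
  ultimately show "\<exists>t>k. t \<in> {length \<sigma> | I \<sigma>. (I, \<sigma>) \<in> family}" by blast
qed

theorem family_hard:
  assumes "ETH"
  shows "\<not> (\<exists>(M :: tm) (f :: nat \<Rightarrow> real) (C :: nat). wf_tm M \<and> (\<lambda>\<tau>. f \<tau> / real \<tau>) \<longlonglongrightarrow> 0 \<and>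
     (\<forall>(I, \<sigma>) \<in> family. solves_ip_in M I (2 powr (2 powr (2 powr f (length \<sigma>))) * real (ip_size I) ^ C)))"
proof
  assume "\<exists>(M :: tm) (f :: nat \<Rightarrow> real) (C :: nat). wf_tm M \<and> (\<lambda>\<tau>. f \<tau> / real \<tau>) \<longlonglongrightarrow> 0 \<and>
     (\<forall>(I, \<sigma>) \<in> family. solves_ip_in M I (2 powr (2 powr (2 powr f (length \<sigma>))) * real (ip_size I) ^ C))"
  then obtain M f C where M: "wf_tm M" and f: "(\<lambda>\<tau>. f \<tau> / real \<tau>) \<longlonglongrightarrow> 0"
    and solves: "\<And>I \<sigma>. (I, \<sigma>) \<in> family \<Longrightarrow>
      solves_ip_in M I (2 powr (2 powr (2 powr f (length \<sigma>))) * real (ip_size I) ^ C)"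
    by blast
  obtain \<delta> :: real where \<delta>: "\<delta> > 0"
    and hard: "\<not> (\<exists>M K. wf_tm M \<and> solves_3SAT_in M (\<lambda>N. K * 2 powr (\<delta> * real N)))"
    using assms unfolding ETH_def by blast
  obtain M' g where M': "wf_tm M'" and g: "pb g"
    and len: "\<And>w. length (sem w RED ((\<lambda>_. 0)(0 := length w))) \<le> g (length w)"
    and out: "\<And>w v T. tm_outputs M (sem w RED ((\<lambda>_. 0)(0 := length w))) v T \<Longrightarrow> v \<noteq> [] \<Longrightarrow>
       tm_outputs M' w [hd v] (real (g (length w)) + T)"
    using machine_for_reduction[OF M, of RED] by metis
  obtain d where d: "\<And>m. g m \<le> (m + 2) ^ d" using g unfolding pb_def by blast
  obtain c where c: "c > 0" "\<And>t. f t \<le> real t / 4 + c" using sublinear_bound[OF f] by blast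
  \<comment> \<open>From \<open>2 powr \<tau> \<le> 400 * log 2 (N + 2)\<close> and
    \<open>f \<tau> \<le> \<tau> / 4 + c\<close>.\<close>
  define A where "A = 2 powr c * 400 powr (1/4)"
  have A: "A > 0" by (simp add: A_def)
  obtain K where K: "\<forall>N. (real N + 2) ^ (11 * d) + 2 powr (2 powr (A * log 2 (real N + 2) powr (1/4))) * (real N + 2) ^ (11 * d * C)
     \<le> K * 2 powr (\<delta> * real N)"
    by (rule reduction_time_bound[OF A \<delta>, of "11 * d" "11 * d * C"])
  have "solves_3SAT_in M' (\<lambda>N. K * 2 powr (\<delta> * real N))"
    unfolding solves_3SAT_in_def
  proof (intro allI impI)
    fix \<phi> :: cnf3 assume wf: "wf_cnf3 \<phi>"
    obtain N cs where \<phi>: "\<phi> = (N, cs)" by (cases \<phi>)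
    define n where "n = length (enc_cnf3 \<phi>)"
    define \<tau> where "\<tau> = Suc (hh n)"
    define T where "T = 2 powr (2 powr (2 powr f \<tau>)) * real (ip_size (red (enc_cnf3 \<phi>))) ^ C"
    have n: "n + 2 \<le> (N + 2) ^ 11" unfolding n_def \<phi> by (rule enc_cnf3_length) (use wf \<phi> in simp)
    have "(red (enc_cnf3 \<phi>), 1 # replicate (hh n) 2) \<in> family" unfolding family_def n_def using wf by blast
    from solves[OF this] have "solves_ip_in M (red (enc_cnf3 \<phi>)) T" by (simp add: T_def \<tau>_def)
    then obtain v where v: "v \<noteq> []" "hd v = satisfiable \<phi>"
      "tm_outputs M (sem (enc_cnf3 \<phi>) RED ((\<lambda>_. 0)(0 := length (enc_cnf3 \<phi>)))) v T"
      by (rule solves_ip_decides[OF wf])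
    have o: "tm_outputs M' (enc_cnf3 \<phi>) [satisfiable \<phi>] (real (g n) + T)"
      using out[OF v(3,1)] v(2) by (simp add: n_def)
    have "g n \<le> ((N + 2) ^ 11) ^ d" using d[of n] power_mono[OF n, of d] by simp
    then have "g n \<le> (N + 2) ^ (11 * d)" by (simp only: power_mult)
    then have "real (g n) \<le> real ((N + 2) ^ (11 * d))" by (simp only: of_nat_le_iff)
    then have gn: "real (g n) \<le> (real N + 2) ^ (11 * d)" by (simp add: add.commute)
    have "ip_size (red (enc_cnf3 \<phi>)) \<le> g n"
      using len[of "enc_cnf3 \<phi>"] unfolding sem_RED n_def ip_size_def .
    then have "real (ip_size (red (enc_cnf3 \<phi>))) \<le> (real N + 2) ^ (11 * d)" using gn by linarith
    then have "real (ip_size (red (enc_cnf3 \<phi>))) ^ C \<le> ((real N + 2) ^ (11 * d)) ^ C" by (rule power_mono) simp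
    then have size: "real (ip_size (red (enc_cnf3 \<phi>))) ^ C \<le> (real N + 2) ^ (11 * d * C)" by (simp only: power_mult)
    have L: "log 2 (real N + 2) > 0" by simp
    \<comment> \<open>The stage of \<open>x\<close> on top of the \<open>hh n\<close> tree levels
      doubles the 200 of \<open>hh_upper\<close>.\<close>
    have t: "2 powr (real \<tau>) \<le> 400 * log 2 (real N + 2)"
      using hh_upper[OF n] by (simp add: \<tau>_def powr_realpow[symmetric] powr_add)
    have "2 powr f \<tau> \<le> 2 powr (real \<tau> / 4 + c)" using c(2)[of \<tau>] by (intro powr_mono) auto
    also have "\<dots> = (2 powr real \<tau>) powr (1/4) * 2 powr c" by (simp add: powr_add powr_powr)
    also have "\<dots> \<le> (400 * log 2 (real N + 2)) powr (1/4) * 2 powr c"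
      using t by (intro mult_right_mono powr_mono2) auto
    also have "\<dots> = A * log 2 (real N + 2) powr (1/4)" using L by (simp add: A_def powr_mult)
    finally have "2 powr (2 powr (2 powr f \<tau>)) \<le> 2 powr (2 powr (A * log 2 (real N + 2) powr (1/4)))"
      by (rule triple_exp_mono)
    then have "T \<le> 2 powr (2 powr (A * log 2 (real N + 2) powr (1/4))) * (real N + 2) ^ (11 * d * C)"
      unfolding T_def using size by (intro mult_mono) auto
    then have "real (g n) + T \<le> K * 2 powr (\<delta> * real N)" using gn K[rule_format, of N] by linarith
    then show "tm_outputs M' (enc_cnf3 \<phi>) [satisfiable \<phi>] (K * 2 powr (\<delta> * real (fst \<phi>)))"
      using tm_outputs_mono[OF o] by (simp add: \<phi>)
  qed
  then show False using hard M' by blast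
qed

theorem corollary2:
  shows "\<exists>F :: (ip \<times> nat list) set.
    (\<forall>(I, \<sigma>) \<in> F. wf_ip I \<and> multi_stage \<sigma> (ip_A I)) \<and>
    infinite {length \<sigma> | I \<sigma>. (I, \<sigma>) \<in> F} \<and>
    (\<exists>s :: nat. \<forall>(I, \<sigma>) \<in> F. \<forall>k \<in> set \<sigma>. k \<le> s) \<and>
    (\<exists>\<Delta> :: int. \<forall>(I, \<sigma>) \<in> F. \<forall>a \<in> elements_mat (ip_A I). \<bar>a\<bar> \<le> \<Delta>) \<and>
    (ETH \<longrightarrow>
      \<not> (\<exists>(M :: tm) (f :: nat \<Rightarrow> real) (C :: nat).
           wf_tm M \<and>
           (\<lambda>\<tau>. f \<tau> / real \<tau>) \<longlonglongrightarrow> 0 \<and>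
           (\<forall>(I, \<sigma>) \<in> F.
              solves_ip_in M I
                (2 powr (2 powr (2 powr f (length \<sigma>))) * real (ip_size I) ^ C))))"
proof (intro exI[of _ family] conjI impI)
  show "\<forall>(I, \<sigma>) \<in> family. wf_ip I \<and> multi_stage \<sigma> (ip_A I)"
    using family_multi_stage by blast
  show "infinite {length \<sigma> | I \<sigma>. (I, \<sigma>) \<in> family}" by (rule family_infinite)
  show "\<exists>s. \<forall>(I, \<sigma>) \<in> family. \<forall>k \<in> set \<sigma>. k \<le> s"
    by (rule exI[of _ 2]) (auto simp: family_def)
  show "\<exists>\<Delta>. \<forall>(I, \<sigma>) \<in> family. \<forall>a \<in> elements_mat (ip_A I). \<bar>a\<bar> \<le> \<Delta>"
    by (rule exI[of _ 2]) (auto simp: family_def red_def gip_def dest: elements_Amat)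
qed (rule family_hard)

end
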